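(* Assume D1 and D2 (stated in the context), let $r=1/2$ and consider the test statistics $T(\boldsymbol{y})=\sum_{j=1}^\infty\kappa_j^2y_j^2$. For $l=1,2,\ldots$, $P_0>0$ put $U(l,P_0)=\{f=\sum_{j=1}^{l}\theta_j\phi_j:\ \|f\|\le P_0\}$ and $\Xi=\bigcup_{l,P_0}U(l,P_0)$. Below, except in (c) and (f), $f_n=\sum_{j=1}^\infty\theta_{nj}\phi_j$ is a sequence of alternatives with $cn^{-1/2}\le\|f_n\|\le Cn^{-1/2}$, $0<c<C<\infty$. (a) $f_n$ is consistent if and only if there are $c_1>0,c_2>0,n_0$ such that $\sum_{j<c_2}\theta_{nj}^2>c_1n^{-1}$ for all $n>n_0$. (b) $f_n$ is inconsistent if and only if for any $c_2>0$ one has $\sum_{j<c_2}\theta_{nj}^2=o(n^{-1})$ as $n\to\infty$. (c) The sets $U(l,P_0)$ and the space $\Xi$ satisfy: any subsequence $f_{n_i}\in\gamma U(l,P_0)$ ($\gamma>0$) with $cn_i^{-1/2}<\|f_{n_i}\|<Cn_i^{-1/2}$, $n_i\to\infty$, is consistent; and if $f\notin\Xi$, then any convex ortho-symmetric set $V$ containing $f$ contains an inconsistent subsequence $f_{n_i}\in V$ with $cn_i^{-1/2}<\|f_{n_i}\|<Cn_i^{-1/2}$ for some $0<c<C$, $n_i\to\infty$. (d) $f_n$ is consistent if and only if there are $l$, $P_0>0$, $0<c_1<C_1$ and $f_{1n}\in U(l,P_0)$ with $c_1n^{-1/2}\le\|f_{1n}\|\le C_1n^{-1/2}$ such that $\|f_n\|^2=\|f_{1n}\|^2+\|f_n-f_{1n}\|^2$.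 Therefore, whenever $f_{1n}\in U(l,P_0)$ and $f_{2n}$ is orthogonal to $f_{1n}$, with $c_1n^{-1/2}\le\|f_{1n}\|,\|f_{2n}\|\le C_1n^{-1/2}$, the sequence $f_{1n}+f_{2n}$ is consistent. (e) If $f_n$ is consistent, then for any $\varepsilon>0$ there are $l$, $P_0>0$, $0<c_1<C_1$ and $f_{1n}\in U(l,P_0)$ with $c_1n^{-1/2}\le\|f_{1n}\|\le C_1n^{-1/2}$ such that $f_{1n}$ is orthogonal to $f_n-f_{1n}$ and, for any $\alpha\in(0,1)$, for the tests $K_n$ generated by $T$ with $\alpha(K_n)=\alpha(1+o(1))$, there is $n_\varepsilon$ such that $|\beta(K_n,f_n)-\beta(K_n,f_{1n})|\le\varepsilon$ and $\beta(K_n,f_n-f_{1n})\ge1-\alpha-\varepsilon$ for all $n>n_\varepsilon$. (f) If $f_n$ is a consistent and $f_{1n}$ an inconsistent sequence of alternatives, then for tests $K_n$ generated by $T$ with $\alpha(K_n)=\alpha(1+o(1))$, $0<\alpha<1$, $\lim_{n\to\infty}(\beta(K_n,f_n)-\beta(K_n,f_n+f_{1n}))=0$. (g) $f_n$ is purely $n^{-1/2}$-consistent if and only if for any $\varepsilon>0$ there are $C_1(\varepsilon)$ and $n_0(\varepsilon)$ such that $\sum_{j>C_1(\varepsilon)}\theta_{nj}^2\le\varepsilon n^{-1}$ for all $n>n_0(\varepsilon)$. (h) $f_n$ is purely $n^{-1/2}$-consistent if and only if for any $\varepsilon>0$ there are $l$, $P_0>0$ and $f_{1n}\in U(l,P_0)$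 with $\|f_n-f_{1n}\|\le\varepsilon n^{-1/2}$ and $\|f_n\|^2=\|f_{1n}\|^2+\|f_n-f_{1n}\|^2$. (i) $f_n$ is purely $n^{-1/2}$-consistent if and only if for any inconsistent subsequence of alternatives $f_{1n_i}$ with $cn_i^{-1/2}<\|f_{1n_i}\|<Cn_i^{-1/2}$, $n_i\to\infty$, one has $\|f_{n_i}+f_{1n_i}\|^2=\|f_{n_i}\|^2+\|f_{1n_i}\|^2+o(n_i^{-1})$.
   Context: Setting. $(\phi_j)_{j\ge1}$ is an orthonormal basis of $L_2(0,1)$ and $f=\sum_j\theta_j\phi_j$ is identified with $\boldsymbol{\theta}=\{\theta_j\}$. One observes independent random variables $y_j=\theta_j+n^{-1/2}\sigma_j\xi_j$, $j\ge1$, where $\xi_j$ are Gaussian with $\mathbf{E}\xi_j=0$, $\mathbf{E}\xi_j^2=1$. The hypothesis is $\theta_j=0$ for all $j$. D1: the sequence $\kappa_j^2$ is decreasing and $\sum_{j=1}^\infty\kappa_j^2<\infty$. D2: there is $C>0$ such that $0<\sigma_j<C$ for all $j$. A test $K_n$ generated by $T$ rejects the hypothesis when $T(\boldsymbol{y})$ exceeds a threshold; $\alpha(K_n)$, $\beta(K_n,f)$ are type I and type II error probabilities. A sequence $f_n$ is consistent if for any $\alpha\in(0,1)$, for tests $K_n$ generated by $T$ with $\alpha(K_n)=\alpha(1+o(1))$, $\limsup_n\beta(K_n,f_n)<1-\alpha$; it is inconsistent if $\liminf_n(\alpha(K_n)+\beta(K_n,f_n))\ge1$ for each sequence of tests $K_n$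 generated by $T$. For alternatives given only along $n_i\to\infty$ the limits are taken along $n_i$. A consistent sequence $f_n$ with $cn^{-1/2}\le\|f_n\|\le Cn^{-1/2}$ is purely $n^{-1/2}$-consistent if there is no subsequence $f_{n_i}=f_{1n_i}+f_{2n_i}$ with $f_{2n_i}$ orthogonal to $f_{1n_i}$, $\|f_{2n_i}\|>c_1n_i^{-1/2}$ for some $c_1>0$, and $f_{2n_i}$ inconsistent. A set $V$ is ortho-symmetric if $\sum_j\theta_j\phi_j\in V$ implies $\sum_j\tilde\theta_j\phi_j\in V$ for all $\tilde\theta_j\in\{\theta_j,-\theta_j\}$. *)

theory Defs
  imports "HOL-Probability.Probability" "HOL-Library.Landau_Symbols"
begin

section \<open>The Hilbert space $L_2(0,1)$\<close>

text \<open>Real functions on $(0,1)$ that are square integrable for Lebesgue measure, modulo equality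
  almost everywhere.\<close>

definition square_integrable :: "(real \<Rightarrow> real) \<Rightarrow> bool" where
  "square_integrable f \<longleftrightarrow>
     f \<in> borel_measurable (lebesgue_on {0<..<1}) \<and>
     integrable (lebesgue_on {0<..<1}) (\<lambda>x. (f x)\<^sup>2)"

definition L2_rel :: "(real \<Rightarrow> real) \<Rightarrow> (real \<Rightarrow> real) \<Rightarrow> bool" where
  "L2_rel f g \<longleftrightarrow> square_integrable f \<and> square_integrable g \<and>
     (AE x in lebesgue_on {0<..<1}. f x = g x)"

lemma square_integrable_zero: "square_integrable (\<lambda>x. 0)"
  by (simp add: square_integrable_def)

lemma square_integrable_mult:
  assumes "square_integrable f" "square_integrable g"
  shows "integrable (lebesgue_on {0<..<1}) (\<lambda>x. f x * g x)"
proof (rule Bochner_Integration.integrable_bound)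
  show "integrable (lebesgue_on {0<..<1}) (\<lambda>x. (f x)\<^sup>2 + (g x)\<^sup>2)"
    using assms by (auto simp: square_integrable_def)
  show "(\<lambda>x. f x * g x) \<in> borel_measurable (lebesgue_on {0<..<1})"
    using assms by (auto simp: square_integrable_def)
  have "\<bar>a * b\<bar> \<le> a\<^sup>2 + b\<^sup>2" for a b :: real
  proof -
    have "2 * (\<bar>a\<bar> * \<bar>b\<bar>) \<le> a\<^sup>2 + b\<^sup>2"
      using sum_squares_bound[of "\<bar>a\<bar>" "\<bar>b\<bar>"] by (simp add: mult.assoc)
    moreover have "0 \<le> \<bar>a\<bar> * \<bar>b\<bar>" by simp
    ultimately show ?thesis unfolding abs_mult by linarith
  qed
  then show "AE x in lebesgue_on {0<..<1}. norm (f x * g x) \<le> norm ((f x)\<^sup>2 + (g x)\<^sup>2)"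
    by auto
qed

lemma square_integrable_add:
  assumes "square_integrable f" "square_integrable g"
  shows "square_integrable (\<lambda>x. f x + g x)"
proof -
  have "integrable (lebesgue_on {0<..<1}) (\<lambda>x. (f x)\<^sup>2 + (g x)\<^sup>2 + 2 * (f x * g x))"
    using assms square_integrable_mult[OF assms]
    by (intro Bochner_Integration.integrable_add integrable_mult_right)
       (auto simp: square_integrable_def)
  then show ?thesis
    using assms by (auto simp: square_integrable_def power2_sum mult.assoc)
qed

lemma square_integrable_scale:
  "square_integrable f \<Longrightarrow> square_integrable (\<lambda>x. c * f x)"
  by (auto simp: square_integrable_def power_mult_distrib)

quotient_type L2 = "real \<Rightarrow> real" / partial: L2_rel
proof (rule part_equivpI)
  show "\<exists>f. L2_rel f f"
    using square_integrable_zero by (auto simp: L2_rel_def)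
  show "symp L2_rel"
    by (auto simp: symp_def L2_rel_def eq_commute)
  show "transp L2_rel"
    unfolding transp_def L2_rel_def by (auto elim: AE_mp)
qed

instantiation L2 :: real_inner
begin

lift_definition zero_L2 :: L2 is "\<lambda>x. 0"
  by (simp add: L2_rel_def square_integrable_zero)

lift_definition plus_L2 :: "L2 \<Rightarrow> L2 \<Rightarrow> L2" is "\<lambda>f g x. f x + g x"
  unfolding L2_rel_def by (auto intro: square_integrable_add)

lift_definition scaleR_L2 :: "real \<Rightarrow> L2 \<Rightarrow> L2" is "\<lambda>c f x. c * f x"
  unfolding L2_rel_def by (auto intro: square_integrable_scale)

definition uminus_L2 :: "L2 \<Rightarrow> L2" where "uminus_L2 f = (- 1) *\<^sub>R f"

definition minus_L2 :: "L2 \<Rightarrow> L2 \<Rightarrow> L2" where "minus_L2 f g = f + - g"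

lift_definition inner_L2 :: "L2 \<Rightarrow> L2 \<Rightarrow> real"
  is "\<lambda>f g. LINT x|lebesgue_on {0<..<1}. f x * g x"
proof -
  fix f f' g g' assume "L2_rel f f'" "L2_rel g g'"
  then show "(LINT x|lebesgue_on {0<..<1}. f x * g x) = (LINT x|lebesgue_on {0<..<1}. f' x * g' x)"
    unfolding L2_rel_def
    by (intro integral_cong_AE borel_measurable_times) (auto simp: square_integrable_def)
qed

definition norm_L2 :: "L2 \<Rightarrow> real" where "norm_L2 f = sqrt (f \<bullet> f)"
definition dist_L2 :: "L2 \<Rightarrow> L2 \<Rightarrow> real" where "dist_L2 f g = norm (f - g)"
definition sgn_L2 :: "L2 \<Rightarrow> L2" where "sgn_L2 f = inverse (norm f) *\<^sub>R f"
definition uniformity_L2 :: "(L2 \<times> L2) filter" where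
  "uniformity_L2 = (INF e\<in>{0<..}. principal {(x, y). dist x y < e})"
definition open_L2 :: "L2 set \<Rightarrow> bool" where
  "open_L2 U = (\<forall>x\<in>U. \<forall>\<^sub>F (x', y) in uniformity. x' = x \<longrightarrow> y \<in> U)"

instance
proof
  fix a b :: real and f g h :: L2
  show "f + g + h = f + (g + h)"
    by transfer (auto simp: L2_rel_def add.assoc intro!: square_integrable_add)
  show "f + g = g + f"
    by transfer (auto simp: L2_rel_def add.commute intro!: square_integrable_add)
  show "0 + f = f"
    by transfer (auto simp: L2_rel_def)
  show "- f + f = 0"
    unfolding uminus_L2_def
    by transfer (auto simp: L2_rel_def square_integrable_zero)
  show "f - g = f + - g"
    by (simp add: minus_L2_def)
  show "a *\<^sub>R (f + g) = a *\<^sub>R f + a *\<^sub>R g"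
    by transfer (auto simp: L2_rel_def distrib_left
        intro!: square_integrable_add square_integrable_scale)
  show "(a + b) *\<^sub>R f = a *\<^sub>R f + b *\<^sub>R f"
    by transfer (auto simp: L2_rel_def distrib_right
        intro!: square_integrable_add square_integrable_scale)
  show "a *\<^sub>R b *\<^sub>R f = (a * b) *\<^sub>R f"
    by transfer (auto simp: L2_rel_def mult.assoc intro!: square_integrable_scale)
  show "1 *\<^sub>R f = f"
    by transfer (auto simp: L2_rel_def)
  show "dist f g = norm (f - g)"
    by (simp add: dist_L2_def)
  show "sgn f = inverse (norm f) *\<^sub>R f"
    by (simp add: sgn_L2_def)
  show "uniformity = (INF e\<in>{0<..}. principal {(x :: L2, y). dist x y < e})"
    by (simp add: uniformity_L2_def)
  show "open U = (\<forall>x\<in>U. \<forall>\<^sub>F (x', y) in uniformity. x' = x \<longrightarrow> y \<in> U)" for U :: "L2 set"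
    by (simp add: open_L2_def)
  show "f \<bullet> g = g \<bullet> f"
    by transfer (simp add: mult.commute)
  show "(f + g) \<bullet> h = f \<bullet> h + g \<bullet> h"
    by transfer (simp add: L2_rel_def distrib_right square_integrable_mult)
  show "(a *\<^sub>R f) \<bullet> g = a * (f \<bullet> g)"
    by transfer (simp add: mult.assoc)
  show "0 \<le> f \<bullet> f"
    by transfer simp
  show "(f \<bullet> f = 0) = (f = 0)"
    by transfer
       (auto simp: L2_rel_def square_integrable_zero square_integrable_mult
          integral_nonneg_eq_0_iff_AE)
  show "norm f = sqrt (f \<bullet> f)"
    by (simp add: norm_L2_def)
qed

end

section \<open>The sequence model\<close>

text \<open>All sequences indexed by \<open>j\<close> (basis, noise, \<open>\<kappa>\<close>, \<open>\<sigma>\<close>, observations) start at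
  \<open>j = 1\<close>; the value at \<open>0\<close> is never used.  The coefficient \<open>\<theta>\<^sub>j\<close> of \<open>f\<close> is \<open>f \<bullet> \<phi> j\<close>.\<close>

definition orthonormal_basis :: "(nat \<Rightarrow> L2) \<Rightarrow> bool" where
  "orthonormal_basis \<phi> \<longleftrightarrow>
     (\<forall>i\<ge>1. \<forall>j\<ge>1. \<phi> i \<bullet> \<phi> j = (if i = j then 1 else 0)) \<and>
     closure (span (\<phi> ` {1..})) = UNIV"

definition standard_gaussian_noise :: "'w measure \<Rightarrow> (nat \<Rightarrow> 'w \<Rightarrow> real) \<Rightarrow> bool" where
  "standard_gaussian_noise M \<xi> \<longleftrightarrow>
     prob_space M \<and>
     prob_space.indep_vars M (\<lambda>_. borel) \<xi> {1..} \<and>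
     (\<forall>j\<ge>1. distributed M lborel (\<xi> j) std_normal_density)"

text \<open>Positivity of \<open>\<kappa>\<^sub>j\<^sup>2\<close> is automatic when ``decreasing'' is read strictly.  The weak
  reading is admitted here as well, and then positivity has to be required: with \<open>\<kappa>\<^sub>j = 0\<close> from
  some \<open>j\<close> on, the statistic does not see the corresponding coordinates.\<close>

definition D1 :: "(nat \<Rightarrow> real) \<Rightarrow> bool" where
  "D1 \<kappa> \<longleftrightarrow> decseq (\<lambda>j. (\<kappa> (Suc j))\<^sup>2) \<and> (\<forall>j\<ge>1. (\<kappa> j)\<^sup>2 > 0) \<and>
     summable (\<lambda>j. (\<kappa> (Suc j))\<^sup>2)"

definition D2 :: "(nat \<Rightarrow> real) \<Rightarrow> bool" where
  "D2 \<sigma> \<longleftrightarrow> (\<exists>C>0. \<forall>j\<ge>1. 0 < \<sigma> j \<and> \<sigma> j < C)"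

definition observation ::
    "(nat \<Rightarrow> 'w \<Rightarrow> real) \<Rightarrow> (nat \<Rightarrow> L2) \<Rightarrow> (nat \<Rightarrow> real) \<Rightarrow> nat \<Rightarrow> L2 \<Rightarrow> 'w \<Rightarrow> nat \<Rightarrow> real" where
  "observation \<xi> \<phi> \<sigma> n f \<omega> j = f \<bullet> \<phi> j + real n powr (-1/2) * \<sigma> j * \<xi> j \<omega>"

definition T_stat :: "(nat \<Rightarrow> real) \<Rightarrow> (nat \<Rightarrow> real) \<Rightarrow> real" where
  "T_stat \<kappa> y = (\<Sum>j. (\<kappa> (Suc j))\<^sup>2 * (y (Suc j))\<^sup>2)"

section \<open>Tests, consistency and inconsistency\<close>

text \<open>A test is identified with its rejection rule: \<open>K y\<close> holds iff the hypothesis is rejected.\<close>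

type_synonym test = "(nat \<Rightarrow> real) \<Rightarrow> bool"

definition generated_by :: "((nat \<Rightarrow> real) \<Rightarrow> real) \<Rightarrow> test \<Rightarrow> bool" where
  "generated_by T K \<longleftrightarrow> (\<exists>t. \<forall>y. K y \<longleftrightarrow> T y > t)"

definition type_I_error ::
    "'w measure \<Rightarrow> (nat \<Rightarrow> 'w \<Rightarrow> real) \<Rightarrow> (nat \<Rightarrow> L2) \<Rightarrow> (nat \<Rightarrow> real) \<Rightarrow> nat \<Rightarrow> test \<Rightarrow> real" where
  "type_I_error M \<xi> \<phi> \<sigma> n K = measure M {\<omega> \<in> space M. K (observation \<xi> \<phi> \<sigma> n 0 \<omega>)}"

definition type_II_error ::
    "'w measure \<Rightarrow> (nat \<Rightarrow> 'w \<Rightarrow> real) \<Rightarrow> (nat \<Rightarrow> L2) \<Rightarrow> (nat \<Rightarrow> real) \<Rightarrow>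
     nat \<Rightarrow> test \<Rightarrow> L2 \<Rightarrow> real" where
  "type_II_error M \<xi> \<phi> \<sigma> n K f =
     measure M {\<omega> \<in> space M. \<not> K (observation \<xi> \<phi> \<sigma> n f \<omega>)}"

text \<open>Below, \<open>N\<close> is the sequence of sample sizes \<open>n\<^sub>i\<close>, and alternatives and tests are indexed
  by \<open>i\<close>; a full sequence is the case \<open>N = id\<close>.  The index \<open>n = 0\<close> is irrelevant there, since
  only limits are involved.\<close>

definition subsequence_index :: "(nat \<Rightarrow> nat) \<Rightarrow> bool" where
  "subsequence_index N \<longleftrightarrow> strict_mono N \<and> (\<forall>i. N i \<ge> 1)"

text \<open>The condition \<open>\<alpha>(K\<^sub>n) = \<alpha> (1 + o(1))\<close>.\<close>

definition tests_of_level ::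
    "'w measure \<Rightarrow> (nat \<Rightarrow> 'w \<Rightarrow> real) \<Rightarrow> (nat \<Rightarrow> L2) \<Rightarrow> (nat \<Rightarrow> real) \<Rightarrow> (nat \<Rightarrow> real) \<Rightarrow>
     (nat \<Rightarrow> nat) \<Rightarrow> real \<Rightarrow> (nat \<Rightarrow> test) \<Rightarrow> bool" where
  "tests_of_level M \<xi> \<phi> \<sigma> \<kappa> N \<alpha> K \<longleftrightarrow>
     (\<forall>i. generated_by (T_stat \<kappa>) (K i)) \<and>
     (\<lambda>i. type_I_error M \<xi> \<phi> \<sigma> (N i) (K i)) \<sim>[sequentially] (\<lambda>_. \<alpha>)"

definition consistent ::
    "'w measure \<Rightarrow> (nat \<Rightarrow> 'w \<Rightarrow> real) \<Rightarrow> (nat \<Rightarrow> L2) \<Rightarrow> (nat \<Rightarrow> real) \<Rightarrow> (nat \<Rightarrow> real) \<Rightarrow>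
     (nat \<Rightarrow> nat) \<Rightarrow> (nat \<Rightarrow> L2) \<Rightarrow> bool" where
  "consistent M \<xi> \<phi> \<sigma> \<kappa> N f \<longleftrightarrow>
     (\<forall>\<alpha>\<in>{0<..<1}. \<forall>K. tests_of_level M \<xi> \<phi> \<sigma> \<kappa> N \<alpha> K \<longrightarrow>
        limsup (\<lambda>i. ereal (type_II_error M \<xi> \<phi> \<sigma> (N i) (K i) (f i))) < ereal (1 - \<alpha>))"

definition inconsistent ::
    "'w measure \<Rightarrow> (nat \<Rightarrow> 'w \<Rightarrow> real) \<Rightarrow> (nat \<Rightarrow> L2) \<Rightarrow> (nat \<Rightarrow> real) \<Rightarrow> (nat \<Rightarrow> real) \<Rightarrow>
     (nat \<Rightarrow> nat) \<Rightarrow> (nat \<Rightarrow> L2) \<Rightarrow> bool" where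
  "inconsistent M \<xi> \<phi> \<sigma> \<kappa> N f \<longleftrightarrow>
     (\<forall>K. (\<forall>i. generated_by (T_stat \<kappa>) (K i)) \<longrightarrow>
        liminf (\<lambda>i. ereal (type_I_error M \<xi> \<phi> \<sigma> (N i) (K i)
                         + type_II_error M \<xi> \<phi> \<sigma> (N i) (K i) (f i))) \<ge> 1)"

definition order_root_n :: "(nat \<Rightarrow> L2) \<Rightarrow> bool" where
  "order_root_n f \<longleftrightarrow> (\<exists>c C. 0 < c \<and> c < C \<and>
     (\<forall>n\<ge>1. c * real n powr (-1/2) \<le> norm (f n) \<and> norm (f n) \<le> C * real n powr (-1/2)))"

definition order_root_n_along :: "(nat \<Rightarrow> nat) \<Rightarrow> (nat \<Rightarrow> L2) \<Rightarrow> bool" where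
  "order_root_n_along N f \<longleftrightarrow> (\<exists>c C. 0 < c \<and> c < C \<and>
     (\<forall>i. c * real (N i) powr (-1/2) < norm (f i) \<and> norm (f i) < C * real (N i) powr (-1/2)))"

definition purely_consistent ::
    "'w measure \<Rightarrow> (nat \<Rightarrow> 'w \<Rightarrow> real) \<Rightarrow> (nat \<Rightarrow> L2) \<Rightarrow> (nat \<Rightarrow> real) \<Rightarrow> (nat \<Rightarrow> real) \<Rightarrow>
     (nat \<Rightarrow> L2) \<Rightarrow> bool" where
  "purely_consistent M \<xi> \<phi> \<sigma> \<kappa> f \<longleftrightarrow>
     order_root_n f \<and> consistent M \<xi> \<phi> \<sigma> \<kappa> id f \<and>
     \<not> (\<exists>N f1 f2. subsequence_index N \<and>
          (\<forall>i. f (N i) = f1 i + f2 i \<and> f2 i \<bullet> f1 i = 0) \<and>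
          (\<exists>c1>0. \<forall>i. norm (f2 i) > c1 * real (N i) powr (-1/2)) \<and>
          inconsistent M \<xi> \<phi> \<sigma> \<kappa> N f2)"

section \<open>The sets of alternatives\<close>

definition U_set :: "(nat \<Rightarrow> L2) \<Rightarrow> nat \<Rightarrow> real \<Rightarrow> L2 set" where
  "U_set \<phi> l P0 = {f. (\<exists>\<theta>. f = (\<Sum>j=1..l. \<theta> j *\<^sub>R \<phi> j)) \<and> norm f \<le> P0}"

definition Xi_space :: "(nat \<Rightarrow> L2) \<Rightarrow> L2 set" where
  "Xi_space \<phi> = (\<Union>l\<in>{1..}. \<Union>P0\<in>{0<..}. U_set \<phi> l P0)"

definition ortho_symmetric :: "(nat \<Rightarrow> L2) \<Rightarrow> L2 set \<Rightarrow> bool" where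
  "ortho_symmetric \<phi> V \<longleftrightarrow>
     (\<forall>f\<in>V. \<forall>g. (\<forall>j\<ge>1. g \<bullet> \<phi> j \<in> {f \<bullet> \<phi> j, - (f \<bullet> \<phi> j)}) \<longrightarrow> g \<in> V)"

end

theory Submission
  imports Defs
begin

text \<open>Multiplied by \<open>n\<close>, the statistic is almost surely the energy
  \<open>\<Sum>\<^sub>j (a\<^sub>j + \<tau>\<^sub>j \<zeta>\<^sub>j)\<^sup>2\<close> of the signal \<open>a\<^sub>j = \<bar>\<kappa>\<^sub>j\<bar> \<surd>n \<theta>\<^sub>j\<close> in independent
  Gaussian noise with square-summable amplitudes \<open>\<tau>\<^sub>j = \<bar>\<kappa>\<^sub>j\<bar> \<sigma>\<^sub>j\<close>.  A test generated by the
  statistic compares this energy with a threshold \<open>x\<close>.  If \<open>F\<^sub>a\<close> is the distribution function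
  of the energy, the error probabilities of the test are \<open>1 - F\<^sub>0(x)\<close> and \<open>F\<^sub>a(x)\<close>.  So the
  whole theorem rests on how \<open>F\<^sub>a\<close> depends on \<open>a\<close>.  Two facts show that only the size
  \<open>\<Sum>\<^sub>j a\<^sub>j\<^sup>2 = n \<Sum>\<^sub>j \<kappa>\<^sub>j\<^sup>2 \<theta>\<^sub>j\<^sup>2\<close> decides whether \<open>F\<^sub>a\<close> can be told from \<open>F\<^sub>0\<close>.

  First, small signals are invisible (\<open>energy_cdf_modulus\<close>): the root of the energy is a norm, so
  adding \<open>b\<close> to the signal moves it by at most \<open>\<parallel>b\<parallel>\<close>, and the energy cannot concentrate on a
  short interval, since the randomness of one coordinate alone forbids it, whatever the signal.

  Second, signals of size at least \<open>\<delta>\<close> are seen (\<open>energy_cdf_gap\<close>): they lower \<open>F\<^sub>0(q)\<close> by an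
  amount that depends, for given noise, only on \<open>\<delta>\<close> and \<open>q\<close>.  By the one-dimensional case of Anderson's inequality,
  \<open>F\<^sub>a\<close> decreases in every \<open>\<bar>a\<^sub>j\<bar>\<close> (\<open>energy_cdf_antimono_signal\<close>), so parts of the signal may be
  erased.  What is kept is either a spike of fixed height in one of finitely many coordinates, or
  a block of coordinates so far out that the noise in them is tiny.  A block acts like a
  deterministic shift of the energy.

  Hence a sequence is consistent iff \<open>n \<Sum>\<^sub>j \<kappa>\<^sub>j\<^sup>2 \<theta>\<^sub>n\<^sub>j\<^sup>2\<close> stays away from \<open>0\<close>, and inconsistent iff it
  tends to \<open>0\<close> (\<open>consistent_iff_weighted_energy\<close>, \<open>inconsistent_iff_weighted_energy\<close>).  The weights
  are positive and tend to \<open>0\<close>.  Therefore, for norms of order \<open>n\<^sup>-\<^sup>1\<^sup>/\<^sup>2\<close>, consistency says that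
  finitely many coordinates carry a fixed share of \<open>n \<parallel>f\<^sub>n\<parallel>\<^sup>2\<close>, and inconsistency says that any
  finitely many carry a vanishing share.  With the orthogonal projection \<open>P\<^sub>l\<close> on the first \<open>l\<close>
  basis functions as the candidate for \<open>f\<^sub>1\<^sub>n\<close>, the statements on consistent and inconsistent
  sequences become Hilbert space geometry.

  Pure consistency means that the tails \<open>n \<parallel>f\<^sub>n - P\<^sub>l f\<^sub>n\<parallel>\<^sup>2\<close> are eventually small, uniformly in
  \<open>n\<close>, once \<open>l\<close> is large.  If this fails, tails \<open>f\<^sub>N\<^sub>i - P\<^sub>i f\<^sub>N\<^sub>i\<close> along a subsequence keep a
  fixed size and are inconsistent (\<open>not_tail_negligible_witness\<close>); they are the forbidden
  orthogonal component, and they have a large inner product with \<open>f\<^sub>N\<^sub>i\<close>.  If it holds,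
  \<open>f\<^sub>n\<close> lives essentially in a fixed finite-dimensional space, which an inconsistent sequence leaves,
  so the two are asymptotically orthogonal (\<open>tail_negligible_inner_inconsistent\<close>).\<close>

section \<open>Conditioning on one of two independent variables\<close>

text \<open>Fubini for the product law of an independent pair.  The three comparison rules that follow
  reduce statements on the energy to statements on a single coordinate, the other coordinates being
  frozen in the value \<open>y\<close>.\<close>

lemma (in prob_space) prob_indep_pair_eq_expectation:
  fixes X Y :: "'a \<Rightarrow> real"
  assumes "indep_var borel X borel Y" and B[measurable]: "B \<in> sets (borel \<Otimes>\<^sub>M borel)"
  shows "(\<lambda>y. prob {\<omega>\<in>space M. (X \<omega>, y) \<in> B}) \<in> borel_measurable borel"
    and "prob {\<omega>\<in>space M. (X \<omega>, Y \<omega>) \<in> B} =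
           expectation (\<lambda>\<omega>. prob {\<omega>'\<in>space M. (X \<omega>', Y \<omega>) \<in> B})"
proof -
  have X[measurable]: "X \<in> borel_measurable M" and Y[measurable]: "Y \<in> borel_measurable M"
    and prod: "distr M borel X \<Otimes>\<^sub>M distr M borel Y = distr M (borel \<Otimes>\<^sub>M borel) (\<lambda>x. (X x, Y x))"
    using assms(1) by (auto simp: indep_var_distribution_eq)
  interpret X: prob_space "distr M borel X" by (rule prob_space_distr) simp
  interpret Y: prob_space "distr M borel Y" by (rule prob_space_distr) simp
  interpret XY: pair_prob_space "distr M borel X" "distr M borel Y" ..
  let ?h = "\<lambda>y. prob {\<omega>\<in>space M. (X \<omega>, y) \<in> B}"
  have sect: "emeasure (distr M borel X) ((\<lambda>x. (x, y)) -` B) = ennreal (?h y)" for y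
  proof -
    have "(\<lambda>x. (x, y)) -` B \<in> sets borel"
      using sets_Pair2[OF B, of y] by simp
    then show ?thesis
      by (subst emeasure_distr) (auto simp: emeasure_eq_measure vimage_def Int_def conj_commute)
  qed
  have "(\<lambda>y. emeasure (distr M borel X) ((\<lambda>x. (x, y)) -` B)) \<in> borel_measurable (distr M borel Y)"
    by (rule XY.measurable_emeasure_Pair2) (simp add: B)
  then have "(\<lambda>y. enn2real (ennreal (?h y))) \<in> borel_measurable borel"
    unfolding sect by measurable
  then show h[measurable]: "?h \<in> borel_measurable borel"
    by simp
  have "emeasure M {\<omega>\<in>space M. (X \<omega>, Y \<omega>) \<in> B} =
      emeasure (distr M borel X \<Otimes>\<^sub>M distr M borel Y) B"
    unfolding prod by (subst emeasure_distr) (auto intro!: arg_cong[where f = "emeasure M"])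
  also have "\<dots> = (\<integral>\<^sup>+y. ennreal (?h y) \<partial>distr M borel Y)"
    by (subst XY.emeasure_pair_measure_alt2) (auto simp: sect B)
  also have "\<dots> = (\<integral>\<^sup>+\<omega>. ennreal (?h (Y \<omega>)) \<partial>M)"
    by (subst nn_integral_distr) auto
  also have "\<dots> = ennreal (expectation (\<lambda>\<omega>. ?h (Y \<omega>)))"
    by (rule nn_integral_eq_integral)
       (auto intro!: integrable_const_bound[where B = 1] simp: measure_nonneg)
  finally show "prob {\<omega>\<in>space M. (X \<omega>, Y \<omega>) \<in> B} = expectation (\<lambda>\<omega>. ?h (Y \<omega>))"
    by (simp add: emeasure_eq_measure)
qed

lemma (in prob_space) integrable_section_prob:
  fixes X Y :: "'a \<Rightarrow> real"
  assumes "indep_var borel X borel Y" and "B \<in> sets (borel \<Otimes>\<^sub>M borel)"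
  shows "integrable M (\<lambda>\<omega>. prob {\<omega>'\<in>space M. (X \<omega>', Y \<omega>) \<in> B})"
proof -
  have [measurable]: "Y \<in> borel_measurable M"
    using assms(1) by (auto simp: indep_var_distribution_eq)
  note [measurable] = prob_indep_pair_eq_expectation(1)[OF assms]
  show ?thesis
    by (auto intro!: integrable_const_bound[where B = 1] simp: measure_nonneg)
qed

lemma (in prob_space) prob_indep_pair_mono:
  fixes X Y :: "'a \<Rightarrow> real"
  assumes "indep_var borel X borel Y"
    and "B \<in> sets (borel \<Otimes>\<^sub>M borel)" "C \<in> sets (borel \<Otimes>\<^sub>M borel)"
    and "\<And>y. prob {\<omega>\<in>space M. (X \<omega>, y) \<in> B} \<le> prob {\<omega>\<in>space M. (X \<omega>, y) \<in> C}"
  shows "prob {\<omega>\<in>space M. (X \<omega>, Y \<omega>) \<in> B} \<le> prob {\<omega>\<in>space M. (X \<omega>, Y \<omega>) \<in> C}"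
  unfolding prob_indep_pair_eq_expectation(2)[OF assms(1,2)]
    prob_indep_pair_eq_expectation(2)[OF assms(1,3)]
  using assms by (intro integral_mono integrable_section_prob) auto

lemma (in prob_space) prob_indep_pair_less:
  fixes X Y :: "'a \<Rightarrow> real"
  assumes ind: "indep_var borel X borel Y"
    and B: "B \<in> sets (borel \<Otimes>\<^sub>M borel)" "C \<in> sets (borel \<Otimes>\<^sub>M borel)"
    and le: "\<And>y. prob {\<omega>\<in>space M. (X \<omega>, y) \<in> B} \<le> prob {\<omega>\<in>space M. (X \<omega>, y) \<in> C}"
    and less: "\<And>y. y \<in> A \<Longrightarrow> prob {\<omega>\<in>space M. (X \<omega>, y) \<in> B} < prob {\<omega>\<in>space M. (X \<omega>, y) \<in> C}"
    and A[measurable]: "A \<in> sets borel" and pos: "prob {\<omega>\<in>space M. Y \<omega> \<in> A} > 0"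
  shows "prob {\<omega>\<in>space M. (X \<omega>, Y \<omega>) \<in> B} < prob {\<omega>\<in>space M. (X \<omega>, Y \<omega>) \<in> C}"
proof -
  have [measurable]: "Y \<in> borel_measurable M"
    using ind by (auto simp: indep_var_distribution_eq)
  show ?thesis
    unfolding prob_indep_pair_eq_expectation(2)[OF ind B(1)]
      prob_indep_pair_eq_expectation(2)[OF ind B(2)]
    using pos le
  proof (intro integral_less_AE[where A = "{\<omega>\<in>space M. Y \<omega> \<in> A}"] integrable_section_prob ind B)
    show "AE \<omega> in M. \<omega> \<in> {\<omega> \<in> space M. Y \<omega> \<in> A} \<longrightarrow>
        prob {\<omega>' \<in> space M. (X \<omega>', Y \<omega>) \<in> B} \<noteq> prob {\<omega>' \<in> space M. (X \<omega>', Y \<omega>) \<in> C}"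
      using less by (intro AE_I2) (fastforce dest: less_imp_neq)
  qed (auto simp: emeasure_eq_measure)
qed

lemma (in prob_space) prob_indep_pair_bound:
  fixes X Y :: "'a \<Rightarrow> real"
  assumes "indep_var borel X borel Y" and "B \<in> sets (borel \<Otimes>\<^sub>M borel)"
    and "\<And>y. prob {\<omega>\<in>space M. (X \<omega>, y) \<in> B} \<le> c"
  shows "prob {\<omega>\<in>space M. (X \<omega>, Y \<omega>) \<in> B} \<le> c"
proof -
  have "expectation (\<lambda>\<omega>. prob {\<omega>'\<in>space M. (X \<omega>', Y \<omega>) \<in> B}) \<le> expectation (\<lambda>_. c)"
    using assms by (intro integral_mono integrable_section_prob) auto
  then show ?thesis
    unfolding prob_indep_pair_eq_expectation(2)[OF assms(1,2)] by (simp add: prob_space)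
qed

section \<open>One shifted Gaussian coordinate\<close>

lemma std_normal_density_le_half: "std_normal_density x \<le> 1 / 2"
proof -
  have "2 \<le> sqrt (2 * pi)"
    using pi_gt3 by (intro real_le_rsqrt) auto
  then have "1 / sqrt (2 * pi) \<le> 1 / 2"
    by (intro divide_left_mono) auto
  moreover have "exp (- x\<^sup>2 / 2) \<le> 1"
    by simp
  ultimately have "(1 / sqrt (2 * pi)) * exp (- x\<^sup>2 / 2) \<le> (1 / 2) * 1"
    by (intro mult_mono) auto
  then show ?thesis
    by (simp add: std_normal_density_def)
qed

lemma std_normal_density_mono:
  "\<bar>x\<bar> \<le> \<bar>y\<bar> \<Longrightarrow> std_normal_density y \<le> std_normal_density x"
  "\<bar>x\<bar> < \<bar>y\<bar> \<Longrightarrow> std_normal_density y < std_normal_density x"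
  unfolding std_normal_density_def
  by (auto intro!: divide_right_mono divide_strict_right_mono
      simp: abs_le_square_iff power2_strict_mono)

text \<open>A primitive of the density is preferred to the distribution function of \<open>Z\<close>, because the
  arguments below differentiate.\<close>

lemma (in prob_space) std_normal_interval_prob:
  assumes "distributed M lborel Z std_normal_density"
  obtains F :: "real \<Rightarrow> real" where
    "\<And>x. (F has_real_derivative std_normal_density x) (at x)"
    "\<And>u v. u \<le> v \<Longrightarrow> prob {\<omega>\<in>space M. u \<le> Z \<omega> \<and> Z \<omega> \<le> v} = F v - F u"
proof -
  have "isCont std_normal_density x" for x
    unfolding normal_density_def by (intro continuous_intros) auto
  then obtain F where F: "(F has_vector_derivative std_normal_density x) (at x)" for x
    using einterval_antiderivative[of "-\<infinity>" "\<infinity>" std_normal_density] by auto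
  then have D: "(F has_real_derivative std_normal_density x) (at x)" for x
    by (simp add: has_real_derivative_iff_has_vector_derivative)
  have "prob {\<omega>\<in>space M. u \<le> Z \<omega> \<and> Z \<omega> \<le> v} = F v - F u" if "u \<le> v" for u v
  proof -
    have "F u \<le> F v"
      by (rule DERIV_nonneg_imp_nondecreasing[OF that]) (use D normal_density_nonneg in blast)
    have "emeasure M (Z -` {u..v} \<inter> space M) = (\<integral>\<^sup>+x. ennreal (std_normal_density x) * indicator {u..v} x \<partial>lborel)"
      using distributed_emeasure[OF assms, of "{u..v}"] by simp
    also have "\<dots> = F v - F u"
      by (rule nn_integral_FTC_Icc) (auto simp: D that)
    finally have "prob (Z -` {u..v} \<inter> space M) = F v - F u"
      using \<open>F u \<le> F v\<close> by (simp add: emeasure_eq_measure)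
    moreover have "Z -` {u..v} \<inter> space M = {\<omega>\<in>space M. u \<le> Z \<omega> \<and> Z \<omega> \<le> v}"
      by auto
    ultimately show ?thesis by simp
  qed
  with D show thesis by (rule that)
qed

lemma shifted_square_le_iff:
  fixes a t r z :: real
  assumes "0 < t" "0 \<le> r"
  shows "(a + t * z)\<^sup>2 \<le> r \<longleftrightarrow> (- sqrt r - a) / t \<le> z \<and> z \<le> (sqrt r - a) / t"
proof -
  have "(a + t * z)\<^sup>2 \<le> r \<longleftrightarrow> \<bar>a + t * z\<bar> \<le> sqrt r"
    using assms by (metis real_sqrt_abs real_sqrt_le_iff)
  then show ?thesis
    using assms(1) by (auto simp: field_simps)
qed

text \<open>Anderson's inequality for one coordinate: a centred interval receives more Gaussian mass than
  a shifted one of the same length.  The mass of the interval of half-width \<open>s\<close> around \<open>c\<close> has derivative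
  proportional to the difference of the densities at \<open>s + c\<close> and \<open>s - c\<close>, which is negative for
  \<open>c > 0\<close>.\<close>

lemma (in prob_space) shifted_square_prob_mono:
  fixes Z :: "'a \<Rightarrow> real"
  assumes Z: "distributed M lborel Z std_normal_density" and t: "0 < t"
  shows "\<bar>a'\<bar> \<le> \<bar>a\<bar> \<Longrightarrow>
           prob {\<omega>\<in>space M. (a + t * Z \<omega>)\<^sup>2 \<le> r} \<le> prob {\<omega>\<in>space M. (a' + t * Z \<omega>)\<^sup>2 \<le> r}"
    and "\<bar>a'\<bar> < \<bar>a\<bar> \<Longrightarrow> 0 < r \<Longrightarrow>
           prob {\<omega>\<in>space M. (a + t * Z \<omega>)\<^sup>2 \<le> r} < prob {\<omega>\<in>space M. (a' + t * Z \<omega>)\<^sup>2 \<le> r}"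
proof -
  obtain F where F: "\<And>x. (F has_real_derivative std_normal_density x) (at x)"
    "\<And>u v. u \<le> v \<Longrightarrow> prob {\<omega>\<in>space M. u \<le> Z \<omega> \<and> Z \<omega> \<le> v} = F v - F u"
    using std_normal_interval_prob[OF Z] by blast
  define s where "s = sqrt r"
  define G where "G c = F ((s - c) / t) - F ((- s - c) / t)" for c
  define g where "g c = (std_normal_density ((s + c) / t) - std_normal_density ((s - c) / t)) / t" for c
  have even: "std_normal_density (- x) = std_normal_density x" for x
    by (simp add: std_normal_density_def)
  have G: "(G has_real_derivative g c) (at c)" for c
  proof -
    have "std_normal_density ((- s - c) / t) = std_normal_density ((s + c) / t)"
      using even[of "(s + c) / t"] by (simp add: minus_divide_left)
    then show ?thesis
      unfolding G_def g_def using t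
      by (auto intro!: derivative_eq_intros DERIV_chain2[OF F(1)] simp: diff_divide_distrib)
  qed
  \<comment> \<open>Symmetry of the density makes the mass of the interval depend on \<open>\<bar>c\<bar>\<close> only.\<close>
  have G_even: "G (- c) = G c" for c
  proof -
    have "((\<lambda>c. G c - G (- c)) has_real_derivative 0) (at x)" for x
    proof -
      have "g x + g (- x) = 0"
        by (simp add: g_def flip: add_divide_distrib)
      moreover have "((\<lambda>c. G c - G (- c)) has_real_derivative (g x - g (- x) * (- 1))) (at x)"
        by (intro DERIV_diff G DERIV_chain2[OF G]) (auto intro!: derivative_eq_intros)
      ultimately show ?thesis by simp
    qed
    then have "G c - G (- c) = G 0 - G (- 0)"
      by (intro DERIV_isconst_all) auto
    then show ?thesis by simp
  qed
  have P: "prob {\<omega>\<in>space M. (c + t * Z \<omega>)\<^sup>2 \<le> r} = G \<bar>c\<bar>" if "0 \<le> r" for c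
  proof -
    have "(- s - c) / t \<le> (s - c) / t"
      using that t by (intro divide_right_mono) (auto simp: s_def)
    then have "prob {\<omega>\<in>space M. (c + t * Z \<omega>)\<^sup>2 \<le> r} = G c"
      unfolding shifted_square_le_iff[OF t that] using F(2) by (simp add: G_def s_def)
    then show ?thesis
      using G_even[of c] by (cases "c \<ge> 0") auto
  qed
  have neg: "prob {\<omega>\<in>space M. (c + t * Z \<omega>)\<^sup>2 \<le> r} = 0" if "r < 0" for c
  proof -
    have "\<not> (c + t * Z \<omega>)\<^sup>2 \<le> r" for \<omega>
      using that zero_le_power2[of "c + t * Z \<omega>"] by linarith
    then show ?thesis by simp
  qed
  show "prob {\<omega>\<in>space M. (a + t * Z \<omega>)\<^sup>2 \<le> r} \<le> prob {\<omega>\<in>space M. (a' + t * Z \<omega>)\<^sup>2 \<le> r}"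
    if "\<bar>a'\<bar> \<le> \<bar>a\<bar>"
  proof (cases "r < 0")
    case False
    have "g c \<le> 0" if "0 \<le> c" for c
    proof -
      have "std_normal_density ((s + c) / t) \<le> std_normal_density ((s - c) / t)"
      proof (rule std_normal_density_mono(1))
        have "0 \<le> s"
          using False by (simp add: s_def)
        then have "\<bar>s - c\<bar> \<le> \<bar>s + c\<bar>"
          using that by linarith
        then show "\<bar>(s - c) / t\<bar> \<le> \<bar>(s + c) / t\<bar>"
          by (simp add: abs_divide divide_right_mono)
      qed
      then show ?thesis
        using t by (simp add: g_def divide_nonpos_pos)
    qed
    then have "G \<bar>a\<bar> \<le> G \<bar>a'\<bar>"
      using that by (intro DERIV_nonpos_imp_nonincreasing[OF that]) (meson G abs_ge_zero order_trans)
    then show ?thesis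
      using P False by simp
  qed (simp add: neg)
  show "prob {\<omega>\<in>space M. (a + t * Z \<omega>)\<^sup>2 \<le> r} < prob {\<omega>\<in>space M. (a' + t * Z \<omega>)\<^sup>2 \<le> r}"
    if a: "\<bar>a'\<bar> < \<bar>a\<bar>" and r: "0 < r"
  proof -
    have neg: "g c < 0" if "0 < c" for c
    proof -
      have "std_normal_density ((s + c) / t) < std_normal_density ((s - c) / t)"
      proof (rule std_normal_density_mono(2))
        have "0 < s"
          using r by (simp add: s_def)
        then have "\<bar>s - c\<bar> < \<bar>s + c\<bar>"
          using that by linarith
        then show "\<bar>(s - c) / t\<bar> < \<bar>(s + c) / t\<bar>"
          using t by (simp add: abs_divide divide_strict_right_mono)
      qed
      then show ?thesis
        using t by (simp add: g_def divide_neg_pos)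
    qed
    have "G \<bar>a\<bar> < G \<bar>a'\<bar>"
    proof (rule DERIV_neg_imp_decreasing_open[OF a])
      show "\<exists>y. (G has_real_derivative y) (at x) \<and> y < 0" if "\<bar>a'\<bar> < x" for x
        using G[of x] neg[of x] that by (intro exI[of _ "g x"]) auto
      show "continuous_on {\<bar>a'\<bar>..\<bar>a\<bar>} G"
        by (meson DERIV_isCont G continuous_at_imp_continuous_on)
    qed
    then show ?thesis
      using P r by simp
  qed
qed

text \<open>The square lies in \<open>(x', x]\<close> only if the absolute value lies in an interval of length
  \<open>\<surd>x - \<surd>x' \<le> \<surd>(x - x')\<close>.  Hence the bound does not depend on the shift, nor on the
  position of the interval.\<close>

lemma (in prob_space) shifted_square_prob_concentration:
  fixes Z :: "'a \<Rightarrow> real"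
  assumes Z: "distributed M lborel Z std_normal_density" and t: "0 < t" and x: "x' \<le> x"
  shows "prob {\<omega>\<in>space M. x' < (a + t * Z \<omega>)\<^sup>2 \<and> (a + t * Z \<omega>)\<^sup>2 \<le> x} \<le> sqrt (x - x') / t"
proof (cases "x < 0")
  case True
  then have "\<not> (a + t * Z \<omega>)\<^sup>2 \<le> x" for \<omega>
    using zero_le_power2[of "a + t * Z \<omega>"] by linarith
  then show ?thesis
    using x t by simp
next
  case False
  obtain F where F: "\<And>x. (F has_real_derivative std_normal_density x) (at x)"
    "\<And>u v. u \<le> v \<Longrightarrow> prob {\<omega>\<in>space M. u \<le> Z \<omega> \<and> Z \<omega> \<le> v} = F v - F u"
    using std_normal_interval_prob[OF Z] by blast
  have Zm[measurable]: "Z \<in> borel_measurable M"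
    using distributed_measurable[OF Z] by simp
  have len: "prob {\<omega>\<in>space M. u \<le> Z \<omega> \<and> Z \<omega> \<le> v} \<le> (v - u) / 2" if "u \<le> v" for u v
  proof -
    have "v / 2 - F v \<ge> u / 2 - F u"
    proof (rule DERIV_nonneg_imp_nondecreasing[OF that, where f = "\<lambda>x. x / 2 - F x"])
      fix x
      show "\<exists>y. ((\<lambda>x. x / 2 - F x) has_real_derivative y) (at x) \<and> 0 \<le> y"
        using std_normal_density_le_half[of x]
        by (intro exI[of _ "1 / 2 - std_normal_density x"] conjI)
           (auto intro!: derivative_eq_intros F(1))
    qed
    then show ?thesis
      unfolding F(2)[OF that] by (simp add: diff_divide_distrib)
  qed
  define s' s where "s' = sqrt (max x' 0)" and "s = sqrt x"
  have s: "0 \<le> s'" "s' \<le> s" "s - s' \<le> sqrt (x - x')"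
  proof -
    show "0 \<le> s'" "s' \<le> s"
      using False x by (auto simp: s_def s'_def)
    have "s \<le> s' + sqrt (x - max x' 0)"
      using sqrt_add_le_add_sqrt[of "max x' 0" "x - max x' 0"] False x
      by (simp add: s_def s'_def)
    moreover have "sqrt (x - max x' 0) \<le> sqrt (x - x')"
      by simp
    ultimately show "s - s' \<le> sqrt (x - x')"
      by linarith
  qed
  let ?I = "\<lambda>u v. {\<omega>\<in>space M. (u - a) / t \<le> Z \<omega> \<and> Z \<omega> \<le> (v - a) / t}"
  have bd: "s' \<le> \<bar>y\<bar> \<and> \<bar>y\<bar> \<le> s" if "x' < y\<^sup>2" "y\<^sup>2 \<le> x" for y :: real
  proof -
    have "max x' 0 \<le> y\<^sup>2"
      using that by simp
    then have "sqrt (max x' 0) \<le> sqrt (y\<^sup>2)" "sqrt (y\<^sup>2) \<le> sqrt x"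
      using that by (auto intro!: real_sqrt_le_mono simp del: real_sqrt_abs)
    then show ?thesis
      by (simp add: s_def s'_def)
  qed
  have "{\<omega>\<in>space M. x' < (a + t * Z \<omega>)\<^sup>2 \<and> (a + t * Z \<omega>)\<^sup>2 \<le> x} \<subseteq> ?I s' s \<union> ?I (- s) (- s')"
  proof (intro subsetI)
    fix \<omega> assume \<omega>: "\<omega> \<in> {\<omega>\<in>space M. x' < (a + t * Z \<omega>)\<^sup>2 \<and> (a + t * Z \<omega>)\<^sup>2 \<le> x}"
    have "s' \<le> \<bar>a + t * Z \<omega>\<bar>" "\<bar>a + t * Z \<omega>\<bar> \<le> s"
      using bd \<omega> by auto
    then show "\<omega> \<in> ?I s' s \<union> ?I (- s) (- s')"
      using \<omega> t by (cases "a + t * Z \<omega> \<ge> 0") (auto simp: field_simps)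
  qed
  then have "prob {\<omega>\<in>space M. x' < (a + t * Z \<omega>)\<^sup>2 \<and> (a + t * Z \<omega>)\<^sup>2 \<le> x}
      \<le> prob (?I s' s \<union> ?I (- s) (- s'))"
    by (rule finite_measure_mono) measurable
  also have "\<dots> \<le> prob (?I s' s) + prob (?I (- s) (- s'))"
    by (rule measure_Un_le) measurable
  also have "\<dots> \<le> ((s - a) / t - (s' - a) / t) / 2 + ((- s' - a) / t - (- s - a) / t) / 2"
    using s t by (intro add_mono len divide_right_mono) auto
  also have "\<dots> = (s - s') / t"
    using t by (simp add: field_simps)
  also have "\<dots> \<le> sqrt (x - x') / t"
    using s t by (intro divide_right_mono) auto
  finally show ?thesis .
qed

lemma (in prob_space) square_annulus_prob_pos:
  fixes Z :: "'a \<Rightarrow> real"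
  assumes Z: "distributed M lborel Z std_normal_density" and t: "0 < t" and x: "x' < x" "0 < x"
  shows "0 < prob {\<omega>\<in>space M. x' < (t * Z \<omega>)\<^sup>2 \<and> (t * Z \<omega>)\<^sup>2 \<le> x}"
proof -
  obtain F where F: "\<And>x. (F has_real_derivative std_normal_density x) (at x)"
    "\<And>u v. u \<le> v \<Longrightarrow> prob {\<omega>\<in>space M. u \<le> Z \<omega> \<and> Z \<omega> \<le> v} = F v - F u"
    using std_normal_interval_prob[OF Z] by blast
  have [measurable]: "Z \<in> borel_measurable M"
    using distributed_measurable[OF Z] by simp
  define s' s where "s' = sqrt (max x' 0)" and "s = sqrt x"
  define m where "m = (s' + s) / 2"
  have s: "s' < m" "m < s" "0 \<le> s'"
    using x by (auto simp: m_def s_def s'_def)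
  have "m / t < s / t"
    using s t by (simp add: divide_strict_right_mono)
  have "F (m / t) < F (s / t)"
    using F(1) by (intro DERIV_pos_imp_increasing[OF \<open>m / t < s / t\<close>])
      (auto simp: normal_density_def intro!: exI[of _ "std_normal_density _"])
  then have "0 < prob {\<omega>\<in>space M. m / t \<le> Z \<omega> \<and> Z \<omega> \<le> s / t}"
    using F(2)[of "m / t" "s / t"] \<open>m / t < s / t\<close> by simp
  also have "\<dots> \<le> prob {\<omega>\<in>space M. x' < (t * Z \<omega>)\<^sup>2 \<and> (t * Z \<omega>)\<^sup>2 \<le> x}"
  proof (rule finite_measure_mono)
    show "{\<omega>\<in>space M. m / t \<le> Z \<omega> \<and> Z \<omega> \<le> s / t} \<subseteq>
      {\<omega>\<in>space M. x' < (t * Z \<omega>)\<^sup>2 \<and> (t * Z \<omega>)\<^sup>2 \<le> x}"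
    proof (intro subsetI)
      fix \<omega> assume \<omega>: "\<omega> \<in> {\<omega>\<in>space M. m / t \<le> Z \<omega> \<and> Z \<omega> \<le> s / t}"
      have b: "m \<le> t * Z \<omega>" "t * Z \<omega> \<le> s"
        using \<omega> t by (auto simp: field_simps)
      have "s'\<^sup>2 < (t * Z \<omega>)\<^sup>2" "(t * Z \<omega>)\<^sup>2 \<le> s\<^sup>2"
        using b s by (auto intro!: power_strict_mono power_mono)
      moreover have "s'\<^sup>2 \<ge> x'" "s\<^sup>2 = x"
        using x by (auto simp: s_def s'_def)
      ultimately show "\<omega> \<in> {\<omega>\<in>space M. x' < (t * Z \<omega>)\<^sup>2 \<and> (t * Z \<omega>)\<^sup>2 \<le> x}"
        using \<omega> by auto
    qed
  qed measurable
  finally show ?thesis .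
qed

section \<open>Square-summable sequences\<close>

abbreviation square_summable :: "(nat \<Rightarrow> real) \<Rightarrow> bool" where
  "square_summable a \<equiv> summable (\<lambda>j. (a j)\<^sup>2)"

lemma square_summable_add:
  assumes "square_summable a" "square_summable b"
  shows "square_summable (\<lambda>j. a j + b j)"
proof (rule summable_comparison_test_ev)
  show "summable (\<lambda>j. 2 * (a j)\<^sup>2 + 2 * (b j)\<^sup>2)"
    using assms by (intro summable_add summable_mult)
  have "(x + y)\<^sup>2 \<le> 2 * x\<^sup>2 + 2 * y\<^sup>2" for x y :: real
    using zero_le_power2[of "x - y"] by (simp add: power2_sum power2_diff)
  then show "\<forall>\<^sub>F j in sequentially. norm ((a j + b j)\<^sup>2) \<le> 2 * (a j)\<^sup>2 + 2 * (b j)\<^sup>2"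
    by simp
qed

lemma square_summable_bound:
  assumes "square_summable a" "\<And>j. \<bar>b j\<bar> \<le> \<bar>a j\<bar>"
  shows "square_summable b"
proof (rule summable_comparison_test_ev[OF _ assms(1)])
  have "(b j)\<^sup>2 \<le> (a j)\<^sup>2" for j
    using assms(2)[of j] by (simp only: abs_le_square_iff)
  then show "\<forall>\<^sub>F j in sequentially. norm ((b j)\<^sup>2) \<le> (a j)\<^sup>2"
    by simp
qed

lemma square_summable_upd: "square_summable a \<Longrightarrow> square_summable (a(j := c))"
proof -
  assume a: "square_summable a"
  have "\<forall>\<^sub>F i in sequentially. (a i)\<^sup>2 = ((a(j := c)) i)\<^sup>2"
    using eventually_gt_at_top[of j] by eventually_elim simp
  from summable_cong[OF this] a show ?thesis
    by (rule iffD1)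
qed

lemma sqrt_suminf_triangle:
  assumes "square_summable a" "square_summable b"
  shows "sqrt (\<Sum>j. (a j + b j)\<^sup>2) \<le> sqrt (\<Sum>j. (a j)\<^sup>2) + sqrt (\<Sum>j. (b j)\<^sup>2)"
proof (rule LIMSEQ_le)
  show "(\<lambda>n. L2_set (\<lambda>j. a j + b j) {..<n}) \<longlonglongrightarrow> sqrt (\<Sum>j. (a j + b j)\<^sup>2)"
    unfolding L2_set_def by (intro tendsto_intros summable_LIMSEQ square_summable_add assms)
  show "(\<lambda>n. L2_set a {..<n} + L2_set b {..<n}) \<longlonglongrightarrow> sqrt (\<Sum>j. (a j)\<^sup>2) + sqrt (\<Sum>j. (b j)\<^sup>2)"
    unfolding L2_set_def by (intro tendsto_intros summable_LIMSEQ assms)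
  show "\<exists>N. \<forall>n\<ge>N. L2_set (\<lambda>j. a j + b j) {..<n} \<le> L2_set a {..<n} + L2_set b {..<n}"
    by (auto intro: L2_set_triangle_ineq)
qed

lemma suminf_split_upd:
  fixes f :: "nat \<Rightarrow> real"
  assumes "summable f"
  shows "(\<Sum>j. f j) = f k + (\<Sum>j. (f(k := 0)) j)"
proof -
  have "summable (f(k := 0))"
  proof -
    have "\<forall>\<^sub>F i in sequentially. f i = (f(k := 0)) i"
      using eventually_gt_at_top[of k] by eventually_elim simp
    from summable_cong[OF this] assms show ?thesis
      by (rule iffD1)
  qed
  then have "(\<lambda>j. (if j = k then f j else 0) + (f(k := 0)) j) sums (f k + (\<Sum>j. (f(k := 0)) j))"
    by (intro sums_add sums_single summable_sums)
  moreover have "(\<lambda>j. (if j = k then f j else 0) + (f(k := 0)) j) = f"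
    by auto
  ultimately show ?thesis
    by (simp add: sums_iff)
qed

lemma suminf_drop_initial:
  fixes f :: "nat \<Rightarrow> real"
  assumes "summable f"
  shows "summable (\<lambda>j. if j < m then 0 else f j)"
    and "(\<Sum>j. if j < m then 0 else f j) = (\<Sum>j. f j) - (\<Sum>j<m. f j)"
proof -
  have "(\<lambda>j. f j - (if j \<in> {..<m} then f j else 0)) sums ((\<Sum>j. f j) - (\<Sum>j<m. f j))"
    by (intro sums_diff summable_sums assms sums_If_finite_set) simp
  moreover have "(\<lambda>j. f j - (if j \<in> {..<m} then f j else 0)) = (\<lambda>j. if j < m then 0 else f j)"
    by auto
  ultimately have "(\<lambda>j. if j < m then 0 else f j) sums ((\<Sum>j. f j) - (\<Sum>j<m. f j))"
    by simp
  then show "summable (\<lambda>j. if j < m then 0 else f j)"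
    "(\<Sum>j. if j < m then 0 else f j) = (\<Sum>j. f j) - (\<Sum>j<m. f j)"
    by (auto simp: sums_iff)
qed

lemma suminf_drop_initial_tendsto:
  fixes f :: "nat \<Rightarrow> real"
  assumes "summable f"
  shows "(\<lambda>m. \<Sum>j. if j < m then 0 else f j) \<longlonglongrightarrow> 0"
proof -
  have "(\<lambda>m. (\<Sum>j. f j) - (\<Sum>j<m. f j)) \<longlonglongrightarrow> (\<Sum>j. f j) - (\<Sum>j. f j)"
    by (intro tendsto_intros summable_LIMSEQ assms)
  then show ?thesis
    by (simp add: suminf_drop_initial(2)[OF assms])
qed

section \<open>The energy of a signal in Gaussian noise\<close>

lemma Collect_pair_borel:
  fixes P :: "real \<times> real \<Rightarrow> bool"
  assumes "Measurable.pred (borel \<Otimes>\<^sub>M borel) P"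
  shows "{p. P p} \<in> sets (borel \<Otimes>\<^sub>M borel)"
  using assms by (simp add: pred_def space_pair_measure)

text \<open>The amplitudes \<open>t\<close> of the noise are arguments of the energy rather than parameters of the
  locale, so that single coordinates can be switched off by setting signal and amplitude to \<open>0\<close>
  there.\<close>

locale gaussian_noise = prob_space M for M :: "'w measure" +
  fixes \<zeta> :: "nat \<Rightarrow> 'w \<Rightarrow> real"
  assumes indep_noise: "indep_vars (\<lambda>_. borel) \<zeta> UNIV"
    and normal_noise: "distributed M lborel (\<zeta> j) std_normal_density"
begin

lemma noise_measurable[measurable]: "\<zeta> j \<in> borel_measurable M"
  using distributed_measurable[OF normal_noise] by simp

definition energy :: "(nat \<Rightarrow> real) \<Rightarrow> (nat \<Rightarrow> real) \<Rightarrow> 'w \<Rightarrow> real" where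
  "energy a t \<omega> = (\<Sum>j. (a j + t j * \<zeta> j \<omega>)\<^sup>2)"

definition energy_cdf :: "(nat \<Rightarrow> real) \<Rightarrow> (nat \<Rightarrow> real) \<Rightarrow> real \<Rightarrow> real" where
  "energy_cdf a t x = prob {\<omega>\<in>space M. energy a t \<omega> \<le> x}"

lemma energy_measurable[measurable]: "energy a t \<in> borel_measurable M"
  unfolding energy_def[abs_def] by measurable

lemma noise_second_moment:
  "integrable M (\<lambda>\<omega>. (\<zeta> j \<omega>)\<^sup>2)" "expectation (\<lambda>\<omega>. (\<zeta> j \<omega>)\<^sup>2) = 1"
proof -
  have "has_bochner_integral lborel (\<lambda>x. std_normal_density x * x\<^sup>2) 1"
    using std_normal_moment_even[of 1] by simp
  then show "integrable M (\<lambda>\<omega>. (\<zeta> j \<omega>)\<^sup>2)" "expectation (\<lambda>\<omega>. (\<zeta> j \<omega>)\<^sup>2) = 1"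
    using distributed_integrable[OF normal_noise, of "\<lambda>x. x\<^sup>2" j]
      distributed_integral[OF normal_noise, of "\<lambda>x. x\<^sup>2" j]
    by (auto simp: has_bochner_integral_iff)
qed

lemma noise_nn_second_moment: "(\<integral>\<^sup>+\<omega>. ennreal ((t * \<zeta> j \<omega>)\<^sup>2) \<partial>M) = ennreal (t\<^sup>2)"
proof -
  have "(\<integral>\<^sup>+\<omega>. ennreal ((t * \<zeta> j \<omega>)\<^sup>2) \<partial>M) = ennreal (expectation (\<lambda>\<omega>. (t * \<zeta> j \<omega>)\<^sup>2))"
    using noise_second_moment(1) by (intro nn_integral_eq_integral) (auto simp: power_mult_distrib)
  then show ?thesis
    by (simp add: power_mult_distrib noise_second_moment(2))
qed

lemma nn_integral_noise_energy:
  assumes "square_summable t"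
  shows "(\<integral>\<^sup>+\<omega>. (\<Sum>j. ennreal ((t j * \<zeta> j \<omega>)\<^sup>2)) \<partial>M) = ennreal (\<Sum>j. (t j)\<^sup>2)"
  by (subst nn_integral_suminf) (auto simp: noise_nn_second_moment suminf_ennreal_eq[OF _ summable_sums[OF assms]])

text \<open>One null set serves all signals, since only the noise has to be square-summable.\<close>

lemma AE_square_summable_observation:
  assumes "square_summable t"
  shows "AE \<omega> in M. \<forall>a. square_summable a \<longrightarrow> square_summable (\<lambda>j. a j + t j * \<zeta> j \<omega>)"
proof -
  have "AE \<omega> in M. (\<Sum>j. ennreal ((t j * \<zeta> j \<omega>)\<^sup>2)) \<noteq> \<infinity>"
    using nn_integral_noise_energy[OF assms] by (intro nn_integral_PInf_AE) auto
  then show ?thesis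
  proof eventually_elim
    case (elim \<omega>)
    then have "square_summable (\<lambda>j. t j * \<zeta> j \<omega>)"
      by (intro summable_suminf_not_top) auto
    then show ?case
      by (intro allI impI square_summable_add)
  qed
qed

lemma energy_nonneg: "square_summable (\<lambda>j. a j + t j * \<zeta> j \<omega>) \<Longrightarrow> 0 \<le> energy a t \<omega>"
  unfolding energy_def by (intro suminf_nonneg) auto

text \<open>What remains after removing a coordinate is again an energy.\<close>

lemma energy_split_coordinate:
  assumes "square_summable (\<lambda>j. a j + t j * \<zeta> j \<omega>)"
  shows "energy a t \<omega> = (a k + t k * \<zeta> k \<omega>)\<^sup>2 + energy (a(k := 0)) (t(k := 0)) \<omega>"
proof -
  have "(\<lambda>j. (a j + t j * \<zeta> j \<omega>)\<^sup>2)(k := 0) = (\<lambda>j. ((a(k := 0)) j + (t(k := 0)) j * \<zeta> j \<omega>)\<^sup>2)"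
    by auto
  then show ?thesis
    using suminf_split_upd[OF assms, of k] unfolding energy_def by simp
qed

lemma indep_noise_energy:
  assumes "a k = 0" "t k = 0"
  shows "indep_var borel (\<zeta> k) borel (energy a t)"
proof -
  define g where "g z = (\<Sum>j. (a j + t j * (if j = k then 0 else z j))\<^sup>2)" for z :: "nat \<Rightarrow> real"
  have "(\<lambda>z. if j = k then 0 else z j) \<in> borel_measurable (PiM (- {k}) (\<lambda>_. borel))" for j :: nat
    by (cases "j = k") (auto intro!: measurable_component_singleton)
  then have g: "g \<in> borel_measurable (PiM (- {k}) (\<lambda>_. borel))"
    unfolding g_def by measurable
  have "indep_var borel ((\<lambda>z. z k) \<circ> (\<lambda>\<omega>. restrict (\<lambda>i. \<zeta> i \<omega>) {k}))
           borel (g \<circ> (\<lambda>\<omega>. restrict (\<lambda>i. \<zeta> i \<omega>) (- {k})))"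
    by (intro indep_var_compose[OF indep_var_restrict[OF indep_noise]] g) auto
  moreover have "(\<lambda>z. z k) \<circ> (\<lambda>\<omega>. restrict (\<lambda>i. \<zeta> i \<omega>) {k}) = \<zeta> k"
    by auto
  moreover have "g \<circ> (\<lambda>\<omega>. restrict (\<lambda>i. \<zeta> i \<omega>) (- {k})) = energy a t"
    unfolding g_def energy_def[abs_def] comp_def
    using assms by (intro ext suminf_cong) auto
  ultimately show ?thesis by simp
qed

text \<open>Prepares the comparison rules for independent pairs: the energy becomes a function of
  \<open>\<zeta> k\<close> and of an independent variable that does not involve \<open>a k\<close>.\<close>

lemma energy_cdf_eq_pair:
  assumes "square_summable a" "square_summable t" and [measurable]: "Measurable.pred borel P"
  shows "prob {\<omega>\<in>space M. P (energy a t \<omega>)} =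
    prob {\<omega>\<in>space M. P ((a k + t k * \<zeta> k \<omega>)\<^sup>2 + energy (a(k := 0)) (t(k := 0)) \<omega>)}"
proof (rule finite_measure_eq_AE)
  show "AE \<omega> in M. (\<omega> \<in> {\<omega>\<in>space M. P (energy a t \<omega>)}) =
     (\<omega> \<in> {\<omega>\<in>space M. P ((a k + t k * \<zeta> k \<omega>)\<^sup>2 + energy (a(k := 0)) (t(k := 0)) \<omega>)})"
    using AE_square_summable_observation[OF assms(2)]
    by eventually_elim (use energy_split_coordinate assms(1) in auto)
qed measurable

lemma energy_cdf_coordinate_mono:
  assumes a: "square_summable a" and t: "square_summable t" and k: "0 < t k" and c: "\<bar>c\<bar> \<le> \<bar>a k\<bar>"
  shows "energy_cdf a t x \<le> energy_cdf (a(k := c)) t x"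
proof -
  define Y where "Y = energy (a(k := 0)) (t(k := 0))"
  define B where "B d = {(z, y). (d + t k * z)\<^sup>2 + y \<le> x}" for d
  have B: "B d \<in> sets (borel \<Otimes>\<^sub>M borel)" for d
    unfolding B_def case_prod_unfold by (intro Collect_pair_borel) measurable
  have "indep_var borel (\<zeta> k) borel Y"
    unfolding Y_def by (intro indep_noise_energy) auto
  then have "prob {\<omega>\<in>space M. (\<zeta> k \<omega>, Y \<omega>) \<in> B (a k)} \<le> prob {\<omega>\<in>space M. (\<zeta> k \<omega>, Y \<omega>) \<in> B c}"
  proof (rule prob_indep_pair_mono[OF _ B B])
    show "prob {\<omega>\<in>space M. (\<zeta> k \<omega>, y) \<in> B (a k)} \<le> prob {\<omega>\<in>space M. (\<zeta> k \<omega>, y) \<in> B c}" for y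
      using shifted_square_prob_mono(1)[OF normal_noise[of k] k c, where r = "x - y"]
      by (simp add: B_def le_diff_eq)
  qed
  then show ?thesis
    unfolding energy_cdf_def
    using energy_cdf_eq_pair[OF a t, of "\<lambda>e. e \<le> x" k]
      energy_cdf_eq_pair[of "a(k := c)" t "\<lambda>e. e \<le> x" k] a t square_summable_upd[OF a, of k c]
    by (simp add: B_def Y_def)
qed

text \<open>The strict form of Anderson's inequality in coordinate \<open>k\<close> applies whenever the remaining
  energy is below \<open>x\<close>, and this happens with positive probability.\<close>

lemma energy_cdf_spike_less:
  assumes t: "square_summable t" and k: "0 < t k" and s: "0 < s" and x: "0 < x"
    and pos: "0 < prob {\<omega>\<in>space M. energy (\<lambda>_. 0) (t(k := 0)) \<omega> < x}"
  shows "energy_cdf ((\<lambda>_. 0)(k := s)) t x < energy_cdf (\<lambda>_. 0) t x"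
proof -
  define Y where "Y = energy (\<lambda>_. 0) (t(k := 0))"
  define B where "B d = {(z, y). (d + t k * z)\<^sup>2 + y \<le> x}" for d
  have B: "B d \<in> sets (borel \<Otimes>\<^sub>M borel)" for d
    unfolding B_def case_prod_unfold by (intro Collect_pair_borel) measurable
  have ind: "indep_var borel (\<zeta> k) borel Y"
    unfolding Y_def by (intro indep_noise_energy) auto
  have "prob {\<omega>\<in>space M. (\<zeta> k \<omega>, Y \<omega>) \<in> B s} < prob {\<omega>\<in>space M. (\<zeta> k \<omega>, Y \<omega>) \<in> B 0}"
  proof (rule prob_indep_pair_less[OF ind B B, where A = "{..<x}"])
    show "prob {\<omega>\<in>space M. (\<zeta> k \<omega>, y) \<in> B s} \<le> prob {\<omega>\<in>space M. (\<zeta> k \<omega>, y) \<in> B 0}" for y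
      using shifted_square_prob_mono(1)[OF normal_noise[of k] k, where a' = 0 and a = s and r = "x - y"] s
      by (simp add: B_def le_diff_eq)
    show "prob {\<omega>\<in>space M. (\<zeta> k \<omega>, y) \<in> B s} < prob {\<omega>\<in>space M. (\<zeta> k \<omega>, y) \<in> B 0}"
      if "y \<in> {..<x}" for y
      using shifted_square_prob_mono(2)[OF normal_noise[of k] k, where a' = 0 and a = s and r = "x - y"] s that
      by (simp add: B_def le_diff_eq)
  qed (use pos in \<open>auto simp: Y_def\<close>)
  moreover have "(\<lambda>_. 0 :: real)(k := 0) = (\<lambda>_. 0)"
    by auto
  ultimately show ?thesis
    unfolding energy_cdf_def
    using energy_cdf_eq_pair[of "(\<lambda>_. 0)(k := s)" t "\<lambda>e. e \<le> x" k]
      square_summable_upd[of "\<lambda>_. 0" k s]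
      energy_cdf_eq_pair[of "\<lambda>_. 0" t "\<lambda>e. e \<le> x" k] t
    by (simp add: B_def Y_def)
qed

text \<open>Any single coordinate with non-degenerate noise prevents concentration, uniformly in the
  signal.\<close>

lemma energy_concentration:
  assumes a: "square_summable a" and t: "square_summable t" and k: "0 < t k" and x: "x' \<le> x"
  shows "prob {\<omega>\<in>space M. x' < energy a t \<omega> \<and> energy a t \<omega> \<le> x} \<le> sqrt (x - x') / t k"
proof -
  define Y where "Y = energy (a(k := 0)) (t(k := 0))"
  define B where "B = {(z, y). x' < (a k + t k * z)\<^sup>2 + y \<and> (a k + t k * z)\<^sup>2 + y \<le> x}"
  have B: "B \<in> sets (borel \<Otimes>\<^sub>M borel)"
    unfolding B_def case_prod_unfold by (intro Collect_pair_borel) measurable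
  have "indep_var borel (\<zeta> k) borel Y"
    unfolding Y_def by (intro indep_noise_energy) auto
  then have "prob {\<omega>\<in>space M. (\<zeta> k \<omega>, Y \<omega>) \<in> B} \<le> sqrt (x - x') / t k"
  proof (rule prob_indep_pair_bound[OF _ B])
    show "prob {\<omega>\<in>space M. (\<zeta> k \<omega>, y) \<in> B} \<le> sqrt (x - x') / t k" for y
      using shifted_square_prob_concentration[OF normal_noise[of k] k, where x' = "x' - y" and x = "x - y" and a = "a k"] x
      by (simp add: B_def le_diff_eq diff_less_eq)
  qed
  then show ?thesis
    using energy_cdf_eq_pair[OF a t, of "\<lambda>e. x' < e \<and> e \<le> x" k]
    by (simp add: B_def Y_def)
qed

section \<open>Small balls and strict monotonicity of the null distribution\<close>

lemma AE_energy_nonneg: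
  assumes a: "square_summable a" and t: "square_summable t"
  shows "AE \<omega> in M. 0 \<le> energy a t \<omega>"
  using AE_square_summable_observation[OF t]
proof eventually_elim
  case (elim \<omega>)
  then show ?case
    using a by (intro energy_nonneg) simp
qed

lemma energy_zero_expectation:
  assumes t: "square_summable t"
  shows "integrable M (energy (\<lambda>_. 0) t)" "expectation (energy (\<lambda>_. 0) t) = (\<Sum>j. (t j)\<^sup>2)"
proof -
  have eq: "AE \<omega> in M. ennreal (energy (\<lambda>_. 0) t \<omega>) = (\<Sum>j. ennreal ((t j * \<zeta> j \<omega>)\<^sup>2))"
    using AE_square_summable_observation[OF t]
  proof eventually_elim
    case (elim \<omega>)
    then have "square_summable (\<lambda>j. t j * \<zeta> j \<omega>)"
      by (auto dest: spec[of _ "\<lambda>_. 0"])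
    then show ?case
      unfolding energy_def by (simp add: suminf_ennreal2)
  qed
  have nonneg: "AE \<omega> in M. 0 \<le> energy (\<lambda>_. 0) t \<omega>"
    by (rule AE_energy_nonneg[OF _ t]) simp
  have nn: "(\<integral>\<^sup>+\<omega>. ennreal (energy (\<lambda>_. 0) t \<omega>) \<partial>M) = ennreal (\<Sum>j. (t j)\<^sup>2)"
    using nn_integral_noise_energy[OF t] nn_integral_cong_AE[OF eq] by simp
  show int: "integrable M (energy (\<lambda>_. 0) t)"
    using nn nonneg by (intro integrableI_nonneg) auto
  have "ennreal (expectation (energy (\<lambda>_. 0) t)) = ennreal (\<Sum>j. (t j)\<^sup>2)"
    using nn_integral_eq_integral[OF int nonneg] nn by simp
  then show "expectation (energy (\<lambda>_. 0) t) = (\<Sum>j. (t j)\<^sup>2)"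
    using nonneg t by (subst (asm) ennreal_inj) (auto intro!: integral_nonneg_AE suminf_nonneg)
qed

lemma energy_markov:
  assumes t: "square_summable t" and c: "0 < c"
  shows "prob {\<omega>\<in>space M. c \<le> energy (\<lambda>_. 0) t \<omega>} \<le> (\<Sum>j. (t j)\<^sup>2) / c"
proof -
  have "AE \<omega> in M. 0 \<le> energy (\<lambda>_. 0) t \<omega>"
    by (rule AE_energy_nonneg[OF _ t]) simp
  then show ?thesis
    using integral_Markov_inequality_measure[OF energy_zero_expectation(1)[OF t] _ _ c, of "{}"]
      energy_zero_expectation(2)[OF t] by simp
qed

text \<open>The expected energy of a far tail is small, so by Markov's inequality the tail is below
  \<open>x / 2\<close> with positive probability; each of the finitely many remaining coordinates is small with
  positive probability, independently.\<close>

lemma energy_small_ball: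
  assumes t: "square_summable t" "\<And>j. 0 \<le> t j" and x: "0 < x"
  shows "0 < prob {\<omega>\<in>space M. energy (\<lambda>_. 0) t \<omega> < x}"
proof -
  define T where "T k j = (if j < k then 0 else t j)" for k j
  have T2: "(T k j)\<^sup>2 = (if j < k then 0 else (t j)\<^sup>2)" for k j
    by (simp add: T_def)
  have T: "square_summable (T k)" for k
    unfolding T2 by (rule suminf_drop_initial(1)[OF t(1)])
  have "\<forall>\<^sub>F k in sequentially. (\<Sum>j. (T k j)\<^sup>2) < x / 2"
    using suminf_drop_initial_tendsto[OF t(1)] x unfolding T2 by (intro order_tendstoD(2)) auto
  then obtain J where J: "(\<Sum>j. (T J j)\<^sup>2) < x / 2"
    by (auto simp: eventually_sequentially)
  \<comment> \<open>Coordinates are put back one at a time, each costing an arbitrarily small part of the slack.\<close>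
  have "\<forall>y>x/2. 0 < prob {\<omega>\<in>space M. energy (\<lambda>_. 0) (T 0) \<omega> < y}"
  proof (rule inc_induct[of 0 J])
    show "\<forall>y>x/2. 0 < prob {\<omega>\<in>space M. energy (\<lambda>_. 0) (T J) \<omega> < y}"
    proof (intro allI impI)
      fix y assume y: "x / 2 < y"
      have "prob {\<omega>\<in>space M. y \<le> energy (\<lambda>_. 0) (T J) \<omega>} \<le> (\<Sum>j. (T J j)\<^sup>2) / y"
        using y x by (intro energy_markov T) auto
      also have "\<dots> < 1"
        using J y x by simp
      finally have "0 < 1 - prob {\<omega>\<in>space M. y \<le> energy (\<lambda>_. 0) (T J) \<omega>}"
        by simp
      also have "\<dots> = prob {\<omega>\<in>space M. \<not> y \<le> energy (\<lambda>_. 0) (T J) \<omega>}"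
        by (rule prob_neg[symmetric]) measurable
      finally show "0 < prob {\<omega>\<in>space M. energy (\<lambda>_. 0) (T J) \<omega> < y}"
        by (simp add: not_le)
    qed
  next
    fix k
    assume IH: "\<forall>y>x/2. 0 < prob {\<omega>\<in>space M. energy (\<lambda>_. 0) (T (Suc k)) \<omega> < y}"
    show "\<forall>y>x/2. 0 < prob {\<omega>\<in>space M. energy (\<lambda>_. 0) (T k) \<omega> < y}"
    proof (intro allI impI)
      fix y assume y: "x / 2 < y"
      define z where "z = (y + x / 2) / 2"
      have z: "x / 2 < z" "0 < y - z"
        using y by (auto simp: z_def)
      have one: "0 < prob {\<omega>\<in>space M. (t k * \<zeta> k \<omega>)\<^sup>2 < y - z}"
      proof (cases "t k = 0")
        case True
        then show ?thesis using z by (simp add: prob_space)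
      next
        case False
        then have "0 < t k" using t(2)[of k] by simp
        then have "0 < prob {\<omega>\<in>space M. -1 < (t k * \<zeta> k \<omega>)\<^sup>2 \<and> (t k * \<zeta> k \<omega>)\<^sup>2 \<le> (y - z) / 2}"
          using z by (intro square_annulus_prob_pos normal_noise) auto
        also have "\<dots> \<le> prob {\<omega>\<in>space M. (t k * \<zeta> k \<omega>)\<^sup>2 < y - z}"
          using z by (intro finite_measure_mono) auto
        finally show ?thesis .
      qed
      have ind: "indep_var borel (\<zeta> k) borel (energy (\<lambda>_. 0) (T (Suc k)))"
        by (intro indep_noise_energy) (auto simp: T_def)
      have "0 < prob (\<zeta> k -` {u. (t k * u)\<^sup>2 < y - z} \<inter> space M) *
          prob (energy (\<lambda>_. 0) (T (Suc k)) -` {..<z} \<inter> space M)"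
        using one IH z by (auto simp: vimage_def Int_def conj_commute)
      also have "\<dots> = prob ((\<lambda>\<omega>. (\<zeta> k \<omega>, energy (\<lambda>_. 0) (T (Suc k)) \<omega>)) -`
          ({u. (t k * u)\<^sup>2 < y - z} \<times> {..<z}) \<inter> space M)"
        by (rule indep_varD[OF ind, symmetric]) auto
      also have "\<dots> \<le> prob {\<omega>\<in>space M. (T k k * \<zeta> k \<omega>)\<^sup>2 + energy (\<lambda>_. 0) (T (Suc k)) \<omega> < y}"
        by (intro finite_measure_mono) (auto simp: T_def)
      also have "\<dots> = prob {\<omega>\<in>space M. energy (\<lambda>_. 0) (T k) \<omega> < y}"
      proof -
        have "(T k)(k := 0) = T (Suc k)" "(\<lambda>_. 0 :: real)(k := 0) = (\<lambda>_. 0)"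
          by (auto simp: T_def fun_eq_iff)
        then show ?thesis
          using energy_cdf_eq_pair[of "\<lambda>_. 0" "T k" "\<lambda>e. e < y" k] T by simp
      qed
      finally show "0 < prob {\<omega>\<in>space M. energy (\<lambda>_. 0) (T k) \<omega> < y}" .
    qed
  qed simp
  moreover have "T 0 = t"
    by (auto simp: T_def)
  ultimately show ?thesis
    using x by auto
qed

lemma energy_cdf_mono: "x' \<le> x \<Longrightarrow> energy_cdf a t x' \<le> energy_cdf a t x"
  unfolding energy_cdf_def by (intro finite_measure_mono) auto

lemma energy_cdf_le_1: "energy_cdf a t x \<le> 1"
  by (simp add: energy_cdf_def)

lemma energy_cdf_diff:
  assumes "x' \<le> x"
  shows "energy_cdf a t x - energy_cdf a t x' = prob {\<omega>\<in>space M. x' < energy a t \<omega> \<and> energy a t \<omega> \<le> x}"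
proof -
  have "prob ({\<omega>\<in>space M. energy a t \<omega> \<le> x} - {\<omega>\<in>space M. energy a t \<omega> \<le> x'}) =
     prob {\<omega>\<in>space M. energy a t \<omega> \<le> x} - prob {\<omega>\<in>space M. energy a t \<omega> \<le> x'}"
    using assms by (intro finite_measure_Diff) auto
  moreover have "{\<omega>\<in>space M. energy a t \<omega> \<le> x} - {\<omega>\<in>space M. energy a t \<omega> \<le> x'} =
     {\<omega>\<in>space M. x' < energy a t \<omega> \<and> energy a t \<omega> \<le> x}"
    by auto
  ultimately show ?thesis
    by (simp add: energy_cdf_def)
qed

text \<open>Continuity of the distribution function in the threshold.\<close>

lemma energy_cdf_holder:
  assumes "square_summable a" "square_summable t" "0 < t k" "x' \<le> x"
  shows "energy_cdf a t x - energy_cdf a t x' \<le> sqrt (x - x') / t k"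
  using energy_concentration[OF assms] energy_cdf_diff[OF assms(4)] by simp

lemma energy_cdf_neg:
  assumes "square_summable a" "square_summable t" "x < 0"
  shows "energy_cdf a t x = 0"
proof -
  have "AE \<omega> in M. \<not> energy a t \<omega> \<le> x"
    using AE_energy_nonneg[OF assms(1,2)] by eventually_elim (use assms(3) in simp)
  then show ?thesis
    unfolding energy_cdf_def by (subst prob_eq_0) auto
qed

text \<open>If the energy of the coordinates other than the first is \<open>y < x\<close>, the first one still has a
  chance to bring the total into \<open>(x', x]\<close>.\<close>

lemma energy_cdf_zero_strict_mono:
  assumes t: "square_summable t" "\<And>j. 0 < t j" and x: "x' < x" "0 < x"
  shows "energy_cdf (\<lambda>_. 0) t x' < energy_cdf (\<lambda>_. 0) t x"
proof -
  define Y where "Y = energy (\<lambda>_. 0) (t(0 := 0))"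
  define B where "B r = {(z, y). (t 0 * z)\<^sup>2 + y \<le> r}" for r
  have B: "B r \<in> sets (borel \<Otimes>\<^sub>M borel)" for r
    unfolding B_def case_prod_unfold by (intro Collect_pair_borel) measurable
  have ind: "indep_var borel (\<zeta> 0) borel Y"
    unfolding Y_def by (intro indep_noise_energy) auto
  have pos: "0 < prob {\<omega>\<in>space M. Y \<omega> < x}"
    unfolding Y_def using t x by (intro energy_small_ball square_summable_upd) (auto simp: less_imp_le)
  have "prob {\<omega>\<in>space M. (\<zeta> 0 \<omega>, Y \<omega>) \<in> B x'} < prob {\<omega>\<in>space M. (\<zeta> 0 \<omega>, Y \<omega>) \<in> B x}"
  proof (rule prob_indep_pair_less[OF ind B B, where A = "{..<x}"])
    show "prob {\<omega>\<in>space M. (\<zeta> 0 \<omega>, y) \<in> B x'} \<le> prob {\<omega>\<in>space M. (\<zeta> 0 \<omega>, y) \<in> B x}" for y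
      using x by (intro finite_measure_mono) (auto simp: B_def)
    show "prob {\<omega>\<in>space M. (\<zeta> 0 \<omega>, y) \<in> B x'} < prob {\<omega>\<in>space M. (\<zeta> 0 \<omega>, y) \<in> B x}"
      if y: "y \<in> {..<x}" for y
    proof -
      have "0 < prob {\<omega>\<in>space M. x' - y < (t 0 * \<zeta> 0 \<omega>)\<^sup>2 \<and> (t 0 * \<zeta> 0 \<omega>)\<^sup>2 \<le> x - y}"
        using x y by (intro square_annulus_prob_pos normal_noise t) auto
      also have "{\<omega>\<in>space M. x' - y < (t 0 * \<zeta> 0 \<omega>)\<^sup>2 \<and> (t 0 * \<zeta> 0 \<omega>)\<^sup>2 \<le> x - y} =
         {\<omega>\<in>space M. (\<zeta> 0 \<omega>, y) \<in> B x} - {\<omega>\<in>space M. (\<zeta> 0 \<omega>, y) \<in> B x'}"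
        by (auto simp: B_def)
      also have "prob \<dots> = prob {\<omega>\<in>space M. (\<zeta> 0 \<omega>, y) \<in> B x} - prob {\<omega>\<in>space M. (\<zeta> 0 \<omega>, y) \<in> B x'}"
        using x by (intro finite_measure_Diff) (auto simp: B_def)
      finally show ?thesis by simp
    qed
  qed (use pos in auto)
  moreover have "(\<lambda>_. 0 :: real)(0 :: nat := 0) = (\<lambda>_. 0)"
    by auto
  ultimately show ?thesis
    unfolding energy_cdf_def
    using energy_cdf_eq_pair[of "\<lambda>_. 0" t "\<lambda>e. e \<le> x" 0] t(1)
      energy_cdf_eq_pair[of "\<lambda>_. 0" t "\<lambda>e. e \<le> x'" 0]
    by (simp add: B_def Y_def)
qed

section \<open>Continuity of the distribution in the signal\<close>

text \<open>Triangle inequality for the root of the energy.\<close>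

lemma energy_cdf_translate:
  assumes a: "square_summable a" and b: "square_summable b" and t: "square_summable t" and x: "0 \<le> x"
  shows "energy_cdf a t x \<le> energy_cdf (\<lambda>j. a j + b j) t ((sqrt x + sqrt (\<Sum>j. (b j)\<^sup>2))\<^sup>2)"
  unfolding energy_cdf_def
proof (rule finite_measure_mono_AE)
  let ?r = "sqrt (\<Sum>j. (b j)\<^sup>2)"
  show "AE \<omega> in M. \<omega> \<in> {\<omega>\<in>space M. energy a t \<omega> \<le> x} \<longrightarrow>
      \<omega> \<in> {\<omega>\<in>space M. energy (\<lambda>j. a j + b j) t \<omega> \<le> (sqrt x + ?r)\<^sup>2}"
    using AE_square_summable_observation[OF t]
  proof eventually_elim
    case (elim \<omega>)
    have "square_summable (\<lambda>j. a j + t j * \<zeta> j \<omega>)"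
      using elim a by simp
    from sqrt_suminf_triangle[OF this b]
    have "sqrt (energy (\<lambda>j. a j + b j) t \<omega>) \<le> sqrt (energy a t \<omega>) + ?r"
      by (simp add: energy_def algebra_simps)
    also have "\<dots> \<le> sqrt x + ?r" if "energy a t \<omega> \<le> x"
      using that by simp
    finally show ?case
      using sqrt_le_D by auto
  qed
qed measurable

text \<open>The translation bound enlarges the threshold from \<open>x\<close> to \<open>(\<surd>x + r)\<^sup>2\<close>, and the Hoelder
  bound pays for the difference \<open>2 \<surd>x r + r\<^sup>2\<close>.  The bound is uniform in the signal \<open>a\<close>.\<close>

lemma energy_cdf_modulus:
  assumes a: "square_summable a" and b: "square_summable b" and t: "square_summable t" and k: "0 < t k"
    and x: "0 \<le> x" and r: "r = sqrt (\<Sum>j. (b j)\<^sup>2)"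
  shows "\<bar>energy_cdf (\<lambda>j. a j + b j) t x - energy_cdf a t x\<bar> \<le> sqrt (2 * sqrt x * r + r\<^sup>2) / t k"
proof -
  have r0: "0 \<le> r"
    unfolding r using b by (auto intro!: suminf_nonneg)
  have xr: "x \<le> (sqrt x + r)\<^sup>2" "(sqrt x + r)\<^sup>2 - x = 2 * sqrt x * r + r\<^sup>2"
    using x r0 by (auto simp: power2_sum)
  have ab: "square_summable (\<lambda>j. a j + b j)"
    by (intro square_summable_add a b)
  have "energy_cdf a t x \<le> energy_cdf (\<lambda>j. a j + b j) t ((sqrt x + r)\<^sup>2)"
    unfolding r by (intro energy_cdf_translate a b t x)
  moreover have "energy_cdf (\<lambda>j. a j + b j) t ((sqrt x + r)\<^sup>2) - energy_cdf (\<lambda>j. a j + b j) t x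
      \<le> sqrt (2 * sqrt x * r + r\<^sup>2) / t k"
    unfolding xr(2)[symmetric] by (intro energy_cdf_holder ab t k xr)
  moreover have "energy_cdf (\<lambda>j. a j + b j) t x \<le> energy_cdf a t ((sqrt x + r)\<^sup>2)"
    using energy_cdf_translate[OF ab _ t x, of "\<lambda>j. - b j"] b r by simp
  moreover have "energy_cdf a t ((sqrt x + r)\<^sup>2) - energy_cdf a t x \<le> sqrt (2 * sqrt x * r + r\<^sup>2) / t k"
    unfolding xr(2)[symmetric] by (intro energy_cdf_holder a t k xr)
  ultimately show ?thesis
    by linarith
qed

text \<open>The modulus grows with the threshold, so uniformity needs thresholds bounded by \<open>X\<close>.  This
  version suits tests of a fixed level and signals of unbounded size.\<close>

lemma energy_cdf_uniformly_continuous: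
  assumes t: "square_summable t" and k: "0 < t k" and \<epsilon>: "0 < \<epsilon>"
  obtains \<delta> where "0 < \<delta>"
    "\<And>a b x. square_summable a \<Longrightarrow> square_summable b \<Longrightarrow> (\<Sum>j. (b j)\<^sup>2) \<le> \<delta> \<Longrightarrow> x \<le> X \<Longrightarrow>
      \<bar>energy_cdf (\<lambda>j. a j + b j) t x - energy_cdf a t x\<bar> \<le> \<epsilon>"
proof -
  define w where "w r = sqrt (2 * sqrt (max X 0) * r + r\<^sup>2) / t k" for r
  have "isCont w 0"
    unfolding w_def by (intro continuous_intros) (use k in auto)
  then have "(w \<longlongrightarrow> w 0) (at_right 0)"
    unfolding isCont_def by (rule filterlim_mono) (auto intro: at_le)
  moreover have "w 0 < \<epsilon>"
    using \<epsilon> by (simp add: w_def)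
  ultimately have "\<forall>\<^sub>F r in at_right 0. w r < \<epsilon>"
    by (rule order_tendstoD(2))
  then obtain r0 where r0: "0 < r0" "\<And>r. 0 < r \<Longrightarrow> r < r0 \<Longrightarrow> w r < \<epsilon>"
    by (auto simp: eventually_at_right_field)
  define \<rho> where "\<rho> = r0 / 2"
  have \<rho>: "0 < \<rho>" "w \<rho> < \<epsilon>"
    using r0 by (auto simp: \<rho>_def)
  show thesis
  proof (rule that[of "\<rho>\<^sup>2"])
    fix a b :: "nat \<Rightarrow> real" and x
    assume *: "square_summable a" "square_summable b" "(\<Sum>j. (b j)\<^sup>2) \<le> \<rho>\<^sup>2" "x \<le> X"
    show "\<bar>energy_cdf (\<lambda>j. a j + b j) t x - energy_cdf a t x\<bar> \<le> \<epsilon>"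
    proof (cases "x < 0")
      case True
      then show ?thesis
        using * \<epsilon> t by (simp add: energy_cdf_neg square_summable_add)
    next
      case False
      define r where "r = sqrt (\<Sum>j. (b j)\<^sup>2)"
      have r: "0 \<le> r" "r \<le> \<rho>"
        unfolding r_def using * \<rho>(1) by (auto intro!: suminf_nonneg real_le_lsqrt)
      have "\<bar>energy_cdf (\<lambda>j. a j + b j) t x - energy_cdf a t x\<bar> \<le> sqrt (2 * sqrt x * r + r\<^sup>2) / t k"
        using * False by (intro energy_cdf_modulus t k r_def) auto
      also have "\<dots> \<le> w \<rho>"
        unfolding w_def using * False r k
        by (intro divide_right_mono real_sqrt_le_mono add_mono mult_mono power_mono) auto
      finally show ?thesis
        using \<rho> by simp
    qed
  qed (use \<rho> in auto)
qed

lemma energy_cdf_zero_tail: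
  assumes t: "square_summable t" and \<epsilon>: "0 < \<epsilon>"
  obtains x where "0 < x" "1 - \<epsilon> \<le> energy_cdf (\<lambda>_. 0) t x"
proof -
  \<comment> \<open>Markov's inequality; the summand \<open>1\<close> keeps the threshold positive when the noise vanishes.\<close>
  define x where "x = (\<Sum>j. (t j)\<^sup>2) / \<epsilon> + 1"
  have s: "0 \<le> (\<Sum>j. (t j)\<^sup>2)"
    by (intro suminf_nonneg t) auto
  have x: "0 < x"
    unfolding x_def using s \<epsilon> by (intro add_nonneg_pos) auto
  have "prob {\<omega>\<in>space M. \<not> energy (\<lambda>_. 0) t \<omega> \<le> x} \<le> prob {\<omega>\<in>space M. x \<le> energy (\<lambda>_. 0) t \<omega>}"
    by (intro finite_measure_mono) auto
  also have "\<dots> \<le> (\<Sum>j. (t j)\<^sup>2) / x"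
    by (rule energy_markov[OF t x])
  also have "\<dots> \<le> \<epsilon>"
    using x \<epsilon> s by (simp add: x_def field_simps)
  finally have "1 - energy_cdf (\<lambda>_. 0) t x \<le> \<epsilon>"
    unfolding energy_cdf_def by (subst (asm) prob_neg) auto
  then show thesis
    using that[of x] x by simp
qed

text \<open>For signals of bounded size, large thresholds are harmless: beyond some \<open>X\<close> all distribution
  functions involved are close to \<open>1\<close>.  This version suits tests of arbitrary level.\<close>

lemma energy_cdf_uniformly_continuous_bounded:
  assumes t: "square_summable t" and k: "0 < t k" and \<epsilon>: "0 < \<epsilon>"
  obtains \<delta> where "0 < \<delta>"
    "\<And>a b x. square_summable a \<Longrightarrow> square_summable b \<Longrightarrow> (\<Sum>j. (a j)\<^sup>2) \<le> B \<Longrightarrow> (\<Sum>j. (b j)\<^sup>2) \<le> \<delta> \<Longrightarrow>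
      \<bar>energy_cdf (\<lambda>j. a j + b j) t x - energy_cdf a t x\<bar> \<le> \<epsilon>"
proof -
  obtain x0 where x0: "0 < x0" "1 - \<epsilon> \<le> energy_cdf (\<lambda>_. 0) t x0"
    using energy_cdf_zero_tail[OF t \<epsilon>] by blast
  \<comment> \<open>Bounds the norms of \<open>a\<close> and of \<open>a + b\<close> once \<open>b\<close> has norm at most \<open>1\<close>.\<close>
  define R where "R = sqrt (max B 0) + 1"
  define X where "X = (sqrt x0 + R)\<^sup>2"
  have R: "1 \<le> R"
    by (simp add: R_def)
  have large: "1 - \<epsilon> \<le> energy_cdf c t x" if "square_summable c" "sqrt (\<Sum>j. (c j)\<^sup>2) \<le> R" "X < x" for c x
  proof -
    have "energy_cdf (\<lambda>_. 0) t x0 \<le> energy_cdf (\<lambda>j. 0 + c j) t ((sqrt x0 + sqrt (\<Sum>j. (c j)\<^sup>2))\<^sup>2)"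
      using x0 that by (intro energy_cdf_translate t) auto
    also have "(\<lambda>j. 0 + c j) = c"
      by simp
    also have "energy_cdf c t ((sqrt x0 + sqrt (\<Sum>j. (c j)\<^sup>2))\<^sup>2) \<le> energy_cdf c t x"
    proof (rule energy_cdf_mono)
      have "(sqrt x0 + sqrt (\<Sum>j. (c j)\<^sup>2))\<^sup>2 \<le> X"
        unfolding X_def using that x0 by (intro power_mono) (auto intro!: add_nonneg_nonneg suminf_nonneg)
      then show "(sqrt x0 + sqrt (\<Sum>j. (c j)\<^sup>2))\<^sup>2 \<le> x"
        using that by simp
    qed
    finally show ?thesis
      using x0 by simp
  qed
  obtain \<delta> where \<delta>: "0 < \<delta>"
    "\<And>a b x. square_summable a \<Longrightarrow> square_summable b \<Longrightarrow> (\<Sum>j. (b j)\<^sup>2) \<le> \<delta> \<Longrightarrow> x \<le> X \<Longrightarrow>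
      \<bar>energy_cdf (\<lambda>j. a j + b j) t x - energy_cdf a t x\<bar> \<le> \<epsilon>"
    by (rule energy_cdf_uniformly_continuous[where X = X, OF t k \<epsilon>]) (rule that)
  show thesis
  proof (rule that[of "min \<delta> 1"])
    fix a b :: "nat \<Rightarrow> real" and x
    assume *: "square_summable a" "square_summable b" "(\<Sum>j. (a j)\<^sup>2) \<le> B" "(\<Sum>j. (b j)\<^sup>2) \<le> min \<delta> 1"
    show "\<bar>energy_cdf (\<lambda>j. a j + b j) t x - energy_cdf a t x\<bar> \<le> \<epsilon>"
    proof (cases "x \<le> X")
      case False
      have a: "sqrt (\<Sum>j. (a j)\<^sup>2) \<le> sqrt (max B 0)"
        using * by (intro real_sqrt_le_mono) auto
      have b: "sqrt (\<Sum>j. (b j)\<^sup>2) \<le> 1"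
        using * by simp
      have "sqrt (\<Sum>j. (a j + b j)\<^sup>2) \<le> R"
        using sqrt_suminf_triangle[OF *(1,2)] a b unfolding R_def by linarith
      then have "1 - \<epsilon> \<le> energy_cdf (\<lambda>j. a j + b j) t x"
        using * False by (intro large square_summable_add) auto
      moreover have "sqrt (\<Sum>j. (a j)\<^sup>2) \<le> R"
        using a unfolding R_def by linarith
      then have "1 - \<epsilon> \<le> energy_cdf a t x"
        using * False by (intro large) auto
      ultimately show ?thesis
        using energy_cdf_le_1[of a t x] energy_cdf_le_1[of "\<lambda>j. a j + b j" t x] by linarith
    qed (use * \<delta> in auto)
  qed (use \<delta> in auto)
qed

section \<open>Monotonicity in the signal and the uniform gap\<close>

text \<open>Anderson's inequality for the energy.  The coordinates of the signal are replaced one by one;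
  after \<open>m\<close> replacements the signal differs from \<open>a'\<close> by a tail of square-summable differences, whose effect
  vanishes by \<open>energy_cdf_modulus\<close>.\<close>

lemma energy_cdf_antimono_signal:
  assumes a: "square_summable a" and t: "square_summable t" "\<And>j. 0 < t j"
    and le: "\<And>j. \<bar>a' j\<bar> \<le> \<bar>a j\<bar>"
  shows "energy_cdf a t x \<le> energy_cdf a' t x"
proof (cases "x < 0")
  case True
  then show ?thesis
    using energy_cdf_neg[OF _ t(1)] square_summable_bound[OF a le] a by simp
next
  case False
  define A where "A m j = (if j < m then a' j else a j)" for m j
  have a': "square_summable a'"
    by (rule square_summable_bound[OF a le])
  have A: "square_summable (A m)" for m
    by (rule square_summable_bound[OF a]) (auto simp: A_def le)
  have step: "energy_cdf a t x \<le> energy_cdf (A m) t x" for m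
  proof (induction m)
    case 0
    then show ?case by (simp add: A_def)
  next
    case (Suc m)
    have "A (Suc m) = (A m)(m := a' m)"
      by (auto simp: A_def fun_eq_iff less_Suc_eq)
    moreover have "energy_cdf (A m) t x \<le> energy_cdf ((A m)(m := a' m)) t x"
      by (rule energy_cdf_coordinate_mono[OF A t(1) t(2)]) (simp add: A_def le)
    ultimately show ?case
      using Suc by (simp only:)
  qed
  define d where "d j = a j - a' j" for j
  have d: "square_summable d"
    using square_summable_add[of a "\<lambda>j. - a' j"] a a' by (simp add: d_def[abs_def])
  define r where "r m = sqrt (\<Sum>j. if j < m then 0 else (d j)\<^sup>2)" for m
  have le': "energy_cdf a t x \<le> energy_cdf a' t x + sqrt (2 * sqrt x * r m + (r m)\<^sup>2) / t 0" for m
  proof -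
    define b where "b j = (if j < m then 0 else d j)" for j
    have b2: "(b j)\<^sup>2 = (if j < m then 0 else (d j)\<^sup>2)" for j
      by (simp add: b_def)
    have b: "square_summable b"
      by (rule square_summable_bound[OF d]) (simp add: b_def)
    have "(\<lambda>j. a' j + b j) = A m"
      by (auto simp: A_def b_def d_def)
    then have "\<bar>energy_cdf (A m) t x - energy_cdf a' t x\<bar> \<le> sqrt (2 * sqrt x * r m + (r m)\<^sup>2) / t 0"
      using energy_cdf_modulus[OF a' b t(1) t(2)[of 0], of x "r m"] False
      by (simp add: r_def b2)
    then show ?thesis
      using step[of m] by linarith
  qed
  have "r \<longlonglongrightarrow> sqrt 0"
    unfolding r_def by (intro tendsto_real_sqrt suminf_drop_initial_tendsto d)
  then have "(\<lambda>m. energy_cdf a' t x + sqrt (2 * sqrt x * r m + (r m)\<^sup>2) / t 0)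
      \<longlonglongrightarrow> energy_cdf a' t x + sqrt (2 * sqrt x * sqrt 0 + (sqrt 0)\<^sup>2) / t 0"
    using t(2)[of 0] by (intro tendsto_intros) auto
  then show ?thesis
    using le' by (intro LIMSEQ_le_const[where a = "energy_cdf a t x"]) auto
qed

lemma noise_uncorrelated:
  "integrable M (\<lambda>\<omega>. \<zeta> i \<omega> * \<zeta> j \<omega>)"
  "expectation (\<lambda>\<omega>. \<zeta> i \<omega> * \<zeta> j \<omega>) = (if i = j then 1 else 0)"
proof -
  have int: "integrable M (\<zeta> j)" for j
    using distributed_integrable[OF normal_noise, of "\<lambda>x. x" j] integrable_std_normal_moment[of 1] by simp
  have zero: "expectation (\<zeta> j) = 0" for j
    using distributed_integral[OF normal_noise, of "\<lambda>x. x" j] integral_std_normal_moment_odd[of 0] by simp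
  have ind: "indep_var borel (\<zeta> i) borel (\<zeta> j)" if "i \<noteq> j" for i j
    using indep_vars_subset[OF indep_noise, of "{i, j}"] indep_vars_sum[of "{j}" i \<zeta>] that by simp
  show "integrable M (\<lambda>\<omega>. \<zeta> i \<omega> * \<zeta> j \<omega>)"
    using noise_second_moment(1)[of j] indep_var_integrable[OF ind int int, of i j]
    by (cases "i = j") (auto simp: power2_eq_square)
  show "expectation (\<lambda>\<omega>. \<zeta> i \<omega> * \<zeta> j \<omega>) = (if i = j then 1 else 0)"
    using noise_second_moment(2)[of j] indep_var_lebesgue_integral[OF ind int int, of i j] zero
    by (cases "i = j") (auto simp: power2_eq_square)
qed

lemma finite_noise_sum_chebyshev:
  assumes F: "finite F" and s: "0 < s"
  shows "prob {\<omega>\<in>space M. s \<le> \<bar>\<Sum>j\<in>F. c j * \<zeta> j \<omega>\<bar>} \<le> (\<Sum>j\<in>F. (c j)\<^sup>2) / s\<^sup>2"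
proof -
  let ?Z = "\<lambda>\<omega>. \<Sum>j\<in>F. c j * \<zeta> j \<omega>"
  have sq: "(?Z \<omega>)\<^sup>2 = (\<Sum>i\<in>F. \<Sum>j\<in>F. (c i * c j) * (\<zeta> i \<omega> * \<zeta> j \<omega>))" for \<omega>
    by (simp add: power2_eq_square sum_product mult_ac)
  have int: "integrable M (\<lambda>\<omega>. (?Z \<omega>)\<^sup>2)"
    unfolding sq by (intro Bochner_Integration.integrable_sum integrable_mult_right noise_uncorrelated)
  have "expectation (\<lambda>\<omega>. (?Z \<omega>)\<^sup>2) = (\<Sum>i\<in>F. \<Sum>j\<in>F. (c i * c j) * expectation (\<lambda>\<omega>. \<zeta> i \<omega> * \<zeta> j \<omega>))"
    unfolding sq
    by (simp add: Bochner_Integration.integral_sum Bochner_Integration.integrable_sum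
        integrable_mult_right noise_uncorrelated(1) del: mult.assoc)
  also have "\<dots> = (\<Sum>j\<in>F. (c j)\<^sup>2)"
    using F by (simp add: noise_uncorrelated(2) if_distrib sum.delta power2_eq_square cong: if_cong)
  finally have E: "expectation (\<lambda>\<omega>. (?Z \<omega>)\<^sup>2) = (\<Sum>j\<in>F. (c j)\<^sup>2)" .
  have "{\<omega>\<in>space M. s \<le> \<bar>?Z \<omega>\<bar>} = {\<omega>\<in>space M. s\<^sup>2 \<le> (?Z \<omega>)\<^sup>2}"
    using s by (auto simp: abs_le_square_iff[symmetric])
  then show ?thesis
    using integral_Markov_inequality_measure[OF int, of "{}" "s\<^sup>2"] E s by simp
qed

text \<open>The energy exceeds that of pure noise by \<open>A\<close> plus twice the cross term
  \<open>\<Sum>\<^sub>j a\<^sub>j t\<^sub>j \<zeta>\<^sub>j\<close>, whose variance is at most \<open>v A\<close>.  So, for small \<open>v\<close>, the signal acts as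
  a shift of the threshold by at least \<open>A / 2\<close>.\<close>

lemma energy_cdf_finite_signal:
  assumes t: "square_summable t" and F: "finite F" "\<And>j. j \<notin> F \<Longrightarrow> a j = 0"
    and v: "\<And>j. j \<in> F \<Longrightarrow> (t j)\<^sup>2 \<le> v" and A: "A = (\<Sum>j\<in>F. (a j)\<^sup>2)" "0 < A"
  shows "energy_cdf a t x \<le> energy_cdf (\<lambda>_. 0) t (x - A / 2) + 16 * v / A"
proof -
  let ?Z = "\<lambda>\<omega>. \<Sum>j\<in>F. (a j * t j) * \<zeta> j \<omega>"
  have expand: "AE \<omega> in M. energy a t \<omega> = energy (\<lambda>_. 0) t \<omega> + 2 * ?Z \<omega> + A"
    using AE_square_summable_observation[OF t]
  proof eventually_elim
    case (elim \<omega>)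
    from elim[rule_format, of "\<lambda>_. 0"] have "square_summable (\<lambda>j. t j * \<zeta> j \<omega>)"
      by simp
    then have "(\<lambda>j. (t j * \<zeta> j \<omega>)\<^sup>2) sums energy (\<lambda>_. 0) t \<omega>"
      by (simp add: energy_def summable_sums)
    moreover have "(\<lambda>j. 2 * (a j * t j) * \<zeta> j \<omega> + (a j)\<^sup>2) sums (\<Sum>j\<in>F. 2 * (a j * t j) * \<zeta> j \<omega> + (a j)\<^sup>2)"
      using F by (intro sums_finite) auto
    ultimately have "(\<lambda>j. (t j * \<zeta> j \<omega>)\<^sup>2 + (2 * (a j * t j) * \<zeta> j \<omega> + (a j)\<^sup>2)) sums
       (energy (\<lambda>_. 0) t \<omega> + (\<Sum>j\<in>F. 2 * (a j * t j) * \<zeta> j \<omega> + (a j)\<^sup>2))"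
      by (rule sums_add)
    moreover have "(t j * \<zeta> j \<omega>)\<^sup>2 + (2 * (a j * t j) * \<zeta> j \<omega> + (a j)\<^sup>2) = (a j + t j * \<zeta> j \<omega>)\<^sup>2" for j
      by (simp add: power2_sum mult_ac)
    moreover have "(\<Sum>j\<in>F. 2 * (a j * t j) * \<zeta> j \<omega> + (a j)\<^sup>2) = 2 * ?Z \<omega> + A"
      by (simp add: sum.distrib A(1) sum_distrib_left mult.assoc)
    ultimately show ?case
      unfolding energy_def[of a] by (simp add: sums_iff)
  qed
  have "energy_cdf a t x \<le> prob ({\<omega>\<in>space M. energy (\<lambda>_. 0) t \<omega> \<le> x - A / 2} \<union> {\<omega>\<in>space M. A / 4 \<le> \<bar>?Z \<omega>\<bar>})"
    unfolding energy_cdf_def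
  proof (rule finite_measure_mono_AE)
    show "AE \<omega> in M. \<omega> \<in> {\<omega>\<in>space M. energy a t \<omega> \<le> x} \<longrightarrow>
      \<omega> \<in> {\<omega>\<in>space M. energy (\<lambda>_. 0) t \<omega> \<le> x - A / 2} \<union> {\<omega>\<in>space M. A / 4 \<le> \<bar>?Z \<omega>\<bar>}"
      using expand
    proof eventually_elim
      case (elim \<omega>)
      then show ?case
        by (auto simp del: sum.distrib)
    qed
  qed measurable
  also have "\<dots> \<le> energy_cdf (\<lambda>_. 0) t (x - A / 2) + prob {\<omega>\<in>space M. A / 4 \<le> \<bar>?Z \<omega>\<bar>}"
    unfolding energy_cdf_def by (rule measure_Un_le) measurable
  also have "prob {\<omega>\<in>space M. A / 4 \<le> \<bar>?Z \<omega>\<bar>} \<le> (\<Sum>j\<in>F. (a j * t j)\<^sup>2) / (A / 4)\<^sup>2"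
    using A by (intro finite_noise_sum_chebyshev F) auto
  also have "(\<Sum>j\<in>F. (a j * t j)\<^sup>2) \<le> (\<Sum>j\<in>F. (a j)\<^sup>2 * v)"
    using v by (intro sum_mono) (auto simp: power_mult_distrib intro!: mult_left_mono)
  also have "(\<Sum>j\<in>F. (a j)\<^sup>2 * v) = A * v"
    by (simp add: A sum_distrib_right)
  finally show ?thesis
    using A(2) by (simp add: divide_right_mono field_simps power2_eq_square)
qed

text \<open>A signal of size at least \<open>\<delta>\<close> has at least \<open>\<delta> / 2\<close> on the first \<open>J\<close> coordinates, or at least
  \<open>\<delta> / 4\<close> on a finite block beyond \<open>J\<close>.  In the first case one of the \<open>J\<close> coordinates dominates a spike of
  fixed height, and there are finitely many spikes to compare with.  In the second case the block,
  scaled down to size exactly \<open>\<delta> / 4\<close>, acts as a shift, provided that \<open>J\<close> was chosen so large that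
  the noise beyond it is negligible.\<close>

lemma energy_cdf_gap:
  assumes t: "square_summable t" "\<And>j. 0 < t j" and q: "0 < q" and \<delta>: "0 < \<delta>"
  obtains \<eta> where "0 < \<eta>"
    "\<And>a. square_summable a \<Longrightarrow> \<delta> \<le> (\<Sum>j. (a j)\<^sup>2) \<Longrightarrow> energy_cdf a t q \<le> energy_cdf (\<lambda>_. 0) t q - \<eta>"
proof -
  define g where "g = energy_cdf (\<lambda>_. 0) t q - energy_cdf (\<lambda>_. 0) t (q - \<delta> / 8)"
  have g: "0 < g"
    unfolding g_def using energy_cdf_zero_strict_mono[OF t, of "q - \<delta> / 8" q] q \<delta> by simp
  \<comment> \<open>With this bound on the squared amplitudes, the Chebyshev term \<open>16 v / (\<delta> / 4)\<close> is \<open>g / 2\<close>.\<close>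
  define v where "v = \<delta> * g / 128"
  have v: "0 < v"
    using \<delta> g by (simp add: v_def)
  have "\<forall>\<^sub>F j in sequentially. (t j)\<^sup>2 < v"
    using summable_LIMSEQ_zero[OF t(1)] v by (intro order_tendstoD(2)) auto
  then obtain J where J: "\<And>j. J \<le> j \<Longrightarrow> (t j)\<^sup>2 < v"
    by (auto simp: eventually_sequentially)
  define s where "s = sqrt (\<delta> / (2 * real J))"
  define h where "h j = energy_cdf (\<lambda>_. 0) t q - energy_cdf ((\<lambda>_. 0)(j := s)) t q" for j
  have h: "0 < h j" if "j < J" for j
  proof -
    have "0 < prob {\<omega>\<in>space M. energy (\<lambda>_. 0) (t(j := 0)) \<omega> < q}"
      using t q by (intro energy_small_ball square_summable_upd) (auto simp: less_imp_le)
    moreover have "0 < s"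
      using that \<delta> by (simp add: s_def)
    ultimately show ?thesis
      unfolding h_def using energy_cdf_spike_less[OF t(1) t(2) _ q] by simp
  qed
  define \<eta> where "\<eta> = Min (insert (g / 2) (h ` {..<J}))"
  have \<eta>: "0 < \<eta>"
    using g h by (simp add: \<eta>_def)
  have \<eta>_le: "\<eta> \<le> g / 2" "\<And>j. j < J \<Longrightarrow> \<eta> \<le> h j"
    unfolding \<eta>_def by (intro Min_le; simp)+
  have "energy_cdf a t q \<le> energy_cdf (\<lambda>_. 0) t q - \<eta>"
    if a: "square_summable a" and ge: "\<delta> \<le> (\<Sum>j. (a j)\<^sup>2)" for a
  proof (cases "\<delta> / 2 \<le> (\<Sum>j<J. (a j)\<^sup>2)")
    case True
    then have "J > 0"
      using \<delta> by (auto intro: gr0I)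
    have "\<exists>j<J. \<delta> / (2 * real J) \<le> (a j)\<^sup>2"
    proof (rule ccontr)
      assume "\<not> ?thesis"
      then have "(\<Sum>j<J. (a j)\<^sup>2) < (\<Sum>j<J. \<delta> / (2 * real J))"
        using \<open>J > 0\<close> by (intro sum_strict_mono) auto
      also have "\<dots> = \<delta> / 2"
        using \<open>J > 0\<close> by simp
      finally show False
        using True by simp
    qed
    then obtain j where j: "j < J" "\<delta> / (2 * real J) \<le> (a j)\<^sup>2"
      by blast
    have "s \<le> \<bar>a j\<bar>" "0 \<le> s"
      using real_sqrt_le_mono[OF j(2)] \<delta> by (simp_all add: s_def)
    then have "energy_cdf a t q \<le> energy_cdf ((\<lambda>_. 0)(j := s)) t q"
      by (intro energy_cdf_antimono_signal a t) auto
    then show ?thesis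
      using \<eta>_le(2)[OF j(1)] by (simp add: h_def)
  next
    case False
    have "(\<lambda>m. \<Sum>j<m. (a j)\<^sup>2) \<longlonglongrightarrow> (\<Sum>j. (a j)\<^sup>2)"
      by (rule summable_LIMSEQ[OF a])
    then have "\<forall>\<^sub>F m in sequentially. 3 * \<delta> / 4 < (\<Sum>j<m. (a j)\<^sup>2)"
      using ge \<delta> by (intro order_tendstoD(1)) auto
    then obtain m where m: "J \<le> m" "3 * \<delta> / 4 < (\<Sum>j<m. (a j)\<^sup>2)"
      using eventually_happens[OF eventually_conj[OF eventually_ge_at_top[of J]]] by auto
    define D where "D = (\<Sum>j\<in>{J..<m}. (a j)\<^sup>2)"
    have "(\<Sum>j<m. (a j)\<^sup>2) = (\<Sum>j<J. (a j)\<^sup>2) + D"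
      unfolding D_def using m(1) by (simp add: lessThan_atLeast0 sum.atLeastLessThan_concat)
    then have D: "\<delta> / 4 < D"
      using m False by simp
    define c where "c = sqrt (\<delta> / (4 * D))"
    have c: "0 \<le> c" "c \<le> 1" "c\<^sup>2 = \<delta> / (4 * D)"
      using D \<delta> by (auto simp: c_def)
    define a' where "a' j = (if j \<in> {J..<m} then c * a j else 0)" for j
    have "\<bar>c * a j\<bar> \<le> \<bar>a j\<bar>" for j
      using c by (simp add: abs_mult mult_left_le_one_le)
    then have "energy_cdf a t q \<le> energy_cdf a' t q"
      by (intro energy_cdf_antimono_signal a t) (auto simp: a'_def)
    also have "\<dots> \<le> energy_cdf (\<lambda>_. 0) t (q - (\<delta> / 4) / 2) + 16 * v / (\<delta> / 4)"
    proof (rule energy_cdf_finite_signal[OF t(1), where F = "{J..<m}"])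
      have "(\<Sum>j\<in>{J..<m}. (a' j)\<^sup>2) = c\<^sup>2 * D"
        by (simp add: a'_def D_def sum_distrib_left power_mult_distrib)
      also have "\<dots> = \<delta> / 4"
        using c(3) D \<delta> by simp
      finally show "\<delta> / 4 = (\<Sum>j\<in>{J..<m}. (a' j)\<^sup>2)" ..
    qed (use J \<delta> in \<open>auto simp: a'_def less_imp_le\<close>)
    also have "16 * v / (\<delta> / 4) = g / 2"
      using \<delta> by (simp add: v_def)
    also have "energy_cdf (\<lambda>_. 0) t (q - (\<delta> / 4) / 2) = energy_cdf (\<lambda>_. 0) t q - g"
      by (simp add: g_def)
    finally show ?thesis
      using \<eta>_le(1) by linarith
  qed
  then show thesis
    using that \<eta> by blast
qed

end

section \<open>Projections on the first basis functions\<close>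

locale l2_basis =
  fixes \<phi> :: "nat \<Rightarrow> L2"
  assumes basis: "orthonormal_basis \<phi>"
begin

definition proj :: "nat \<Rightarrow> L2 \<Rightarrow> L2" where
  "proj l f = (\<Sum>j=1..l. (f \<bullet> \<phi> j) *\<^sub>R \<phi> j)"

lemma orthonormal: "1 \<le> i \<Longrightarrow> 1 \<le> j \<Longrightarrow> \<phi> i \<bullet> \<phi> j = (if i = j then 1 else 0)"
  using basis by (auto simp: orthonormal_basis_def)

lemma lincomb_coeff:
  assumes "1 \<le> k"
  shows "(\<Sum>j=1..l. \<theta> j *\<^sub>R \<phi> j) \<bullet> \<phi> k = (if k \<le> l then \<theta> k else 0)"
proof -
  have "(\<Sum>j=1..l. \<theta> j *\<^sub>R \<phi> j) \<bullet> \<phi> k = (\<Sum>j=1..l. if j = k then \<theta> j else 0)"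
    unfolding inner_sum_left using assms by (intro sum.cong) (auto simp: orthonormal)
  then show ?thesis
    using assms by (simp add: sum.delta)
qed

lemma proj_coeff: "1 \<le> k \<Longrightarrow> proj l f \<bullet> \<phi> k = (if k \<le> l then f \<bullet> \<phi> k else 0)"
  unfolding proj_def by (rule lincomb_coeff)

lemma lincomb_inner_diff_proj: "(\<Sum>j=1..l. \<theta> j *\<^sub>R \<phi> j) \<bullet> (f - proj l f) = 0"
proof -
  have "\<phi> j \<bullet> (f - proj l f) = 0" if "j \<in> {1..l}" for j
    using that proj_coeff[of j l f] by (simp add: inner_diff_right inner_commute)
  then show ?thesis
    by (simp add: inner_sum_left)
qed

lemma proj_inner_diff: "proj l g \<bullet> (f - proj l f) = 0"
  unfolding proj_def[of l g] by (rule lincomb_inner_diff_proj)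

lemma inner_proj: "proj l g \<bullet> f = proj l g \<bullet> proj l f"
  using proj_inner_diff[of l g f] by (simp add: inner_diff_right)

lemma proj_proj: "proj l (proj l f) = proj l f"
  unfolding proj_def[of l "proj l f"] by (simp add: proj_coeff) (simp add: proj_def)

lemma proj_add: "proj l (f + g) = proj l f + proj l g"
  by (simp add: proj_def inner_add_left scaleR_add_left sum.distrib)

lemma proj_diff: "proj l (f - g) = proj l f - proj l g"
  by (simp add: proj_def inner_diff_left scaleR_diff_left sum_subtractf)

lemma proj_scaleR: "proj l (c *\<^sub>R f) = c *\<^sub>R proj l f"
  by (simp add: proj_def scaleR_sum_right)

lemma proj_lincomb: "proj l (\<Sum>j=1..l. \<theta> j *\<^sub>R \<phi> j) = (\<Sum>j=1..l. \<theta> j *\<^sub>R \<phi> j)"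
  unfolding proj_def by (intro sum.cong refl) (use lincomb_coeff in auto)

lemma norm_proj: "(norm (proj l f))\<^sup>2 = (\<Sum>j=1..l. (f \<bullet> \<phi> j)\<^sup>2)"
proof -
  have "proj l f \<bullet> proj l f = proj l f \<bullet> f"
    by (rule inner_proj[symmetric])
  also have "\<dots> = (\<Sum>j=1..l. (f \<bullet> \<phi> j)\<^sup>2)"
    by (simp add: proj_def inner_sum_left inner_sum_right power2_eq_square inner_commute[of _ f])
  finally show ?thesis
    by (simp add: power2_norm_eq_inner)
qed

lemma orthogonal_pythagoras: "f \<bullet> g = 0 \<Longrightarrow> (norm (f + g))\<^sup>2 = (norm f)\<^sup>2 + (norm g)\<^sup>2" for f g :: L2
  by (simp add: power2_norm_eq_inner inner_add_left inner_add_right inner_commute)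

lemma norm_split_proj: "(norm f)\<^sup>2 = (norm (proj l f))\<^sup>2 + (norm (f - proj l f))\<^sup>2"
  using orthogonal_pythagoras[OF proj_inner_diff[of l f f]] by simp

lemma norm_proj_le: "norm (proj l f) \<le> norm f"
  using norm_split_proj[of f l] by - (rule power2_le_imp_le, auto)

lemma norm_diff_proj_le: "norm (f - proj l f) \<le> norm f"
  using norm_split_proj[of f l] by - (rule power2_le_imp_le, auto)

lemma proj_best_approximation:
  assumes "proj l g = g"
  shows "norm (f - proj l f) \<le> norm (f - g)"
proof -
  have "(norm (f - g))\<^sup>2 = (norm (proj l (f - g)))\<^sup>2 + (norm (f - g - proj l (f - g)))\<^sup>2"
    by (rule norm_split_proj)
  moreover have "f - g - proj l (f - g) = f - proj l f"
    using assms by (simp add: proj_diff)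
  ultimately show ?thesis
    by - (rule power2_le_imp_le, auto)
qed

lemma norm_proj_mono: "l \<le> l' \<Longrightarrow> norm (proj l f) \<le> norm (proj l' f)"
  by (rule power2_le_imp_le) (auto simp: norm_proj intro!: sum_mono2)

lemma norm_diff_proj_antimono:
  assumes "l \<le> l'"
  shows "norm (f - proj l' f) \<le> norm (f - proj l f)"
proof (rule power2_le_imp_le)
  show "(norm (f - proj l' f))\<^sup>2 \<le> (norm (f - proj l f))\<^sup>2"
    using power_mono[OF norm_proj_mono[OF assms, of f] norm_ge_zero, of 2]
      norm_split_proj[of f l] norm_split_proj[of f l'] by linarith
qed simp

text \<open>Elements of the span are finite combinations, hence fixed by some projection.\<close>

lemma span_basis_lincomb:
  assumes "g \<in> span (\<phi> ` {1..})"
  obtains l where "proj l g = g"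
proof -
  obtain S r where S: "finite S" "S \<subseteq> \<phi> ` {1..}" "g = (\<Sum>a\<in>S. r a *\<^sub>R a)"
    using assms unfolding span_explicit by blast
  obtain I where I: "I \<subseteq> {1..}" "finite I" "S = \<phi> ` I"
    using finite_subset_image[OF S(1,2)] by blast
  define l where "l = Max (insert 0 I)"
  have l: "j \<in> {1..l}" if "j \<in> I" for j
    using that I by (auto simp: l_def intro!: Max_ge)
  have "proj l (\<phi> j) = \<phi> j" if "j \<in> {1..l}" for j
  proof -
    have "proj l (\<phi> j) = (\<Sum>i=1..l. if j = i then \<phi> i else 0)"
      unfolding proj_def using that by (intro sum.cong) (auto simp: orthonormal)
    then show ?thesis
      using that by simp
  qed
  moreover have "proj l (sum h S) = (\<Sum>a\<in>S. proj l (h a))" for h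
    using S(1) by (induction S rule: finite_induct) (simp_all add: proj_add, simp add: proj_def)
  ultimately have "proj l g = g"
    unfolding S(3) using l I(3) by (simp add: proj_scaleR) (intro sum.cong, auto)
  then show thesis
    by (rule that)
qed

lemma proj_tendsto: "(\<lambda>l. norm (f - proj l f)) \<longlonglongrightarrow> 0"
proof (rule LIMSEQ_I)
  fix e :: real assume e: "0 < e"
  have "f \<in> closure (span (\<phi> ` {1..}))"
    using basis by (simp add: orthonormal_basis_def)
  then obtain g where g: "g \<in> span (\<phi> ` {1..})" "dist g f < e"
    using e closure_approachable by blast
  obtain l where l: "proj l g = g"
    using span_basis_lincomb[OF g(1)] .
  have "norm (norm (f - proj m f) - 0) < e" if "l \<le> m" for m
  proof -
    have "norm (f - proj m f) \<le> norm (f - proj l f)"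
      using that by (rule norm_diff_proj_antimono)
    also have "\<dots> \<le> norm (f - g)"
      by (rule proj_best_approximation[OF l])
    also have "\<dots> < e"
      using g(2) by (simp add: dist_norm norm_minus_commute)
    finally show ?thesis by simp
  qed
  then show "\<exists>no. \<forall>m\<ge>no. norm (norm (f - proj m f) - 0) < e"
    by blast
qed

lemma norm_proj_lessThan: "(norm (proj l f))\<^sup>2 = (\<Sum>j<l. (f \<bullet> \<phi> (Suc j))\<^sup>2)"
  using sum.shift_bounds_Suc_ivl[of "\<lambda>j. (f \<bullet> \<phi> j)\<^sup>2" 0 l]
  by (simp add: norm_proj atLeastLessThanSuc_atLeastAtMost lessThan_atLeast0)

lemma parseval: "(\<lambda>j. (f \<bullet> \<phi> (Suc j))\<^sup>2) sums (norm f)\<^sup>2"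
proof -
  have "(\<lambda>l. (norm f)\<^sup>2 - (norm (f - proj l f))\<^sup>2) \<longlonglongrightarrow> (norm f)\<^sup>2 - 0\<^sup>2"
    by (intro tendsto_intros proj_tendsto)
  moreover have "(norm f)\<^sup>2 - (norm (f - proj l f))\<^sup>2 = (\<Sum>j<l. (f \<bullet> \<phi> (Suc j))\<^sup>2)" for l
    using norm_split_proj[of f l] norm_proj_lessThan[of l f] by simp
  ultimately show ?thesis
    by (simp add: sums_def)
qed

text \<open>Parseval's identity for \<open>f - proj l f\<close>.  For negative \<open>C\<close> the truncation of \<open>nat\<close> gives
  \<open>l = 0\<close>, as it should.\<close>

lemma infsum_tail_coeff:
  "(\<Sum>\<^sub>\<infinity>j\<in>{j. 1 \<le> j \<and> C < real j}. (f \<bullet> \<phi> j)\<^sup>2) = (norm (f - proj (nat \<lfloor>C\<rfloor>) f))\<^sup>2"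
proof -
  define l where "l = nat \<lfloor>C\<rfloor>"
  define r where "r = f - proj l f"
  have set: "{j. 1 \<le> j \<and> C < real j} \<subseteq> range Suc"
    by (auto simp: image_iff) (metis Suc_le_D)
  have coeff: "r \<bullet> \<phi> j = (if C < real j then f \<bullet> \<phi> j else 0)" if "1 \<le> j" for j
  proof -
    have "C < real j \<longleftrightarrow> \<not> j \<le> l"
      using that unfolding l_def by linarith
    then show ?thesis
      using that by (simp add: r_def inner_diff_left proj_coeff)
  qed
  have "((\<lambda>j. (r \<bullet> \<phi> (Suc j))\<^sup>2) has_sum (norm r)\<^sup>2) UNIV"
    by (rule sums_nonneg_imp_has_sum[OF parseval]) simp
  then have "(\<Sum>\<^sub>\<infinity>j. (r \<bullet> \<phi> (Suc j))\<^sup>2) = (norm r)\<^sup>2"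
    by (rule infsumI)
  also have "(\<Sum>\<^sub>\<infinity>j. (r \<bullet> \<phi> (Suc j))\<^sup>2) = (\<Sum>\<^sub>\<infinity>j\<in>range Suc. (r \<bullet> \<phi> j)\<^sup>2)"
    by (simp add: infsum_reindex comp_def)
  also have "\<dots> = (\<Sum>\<^sub>\<infinity>j\<in>{j. 1 \<le> j \<and> C < real j}. (f \<bullet> \<phi> j)\<^sup>2)"
    using set by (intro infsum_cong_neutral) (auto simp: coeff)
  finally show ?thesis
    by (simp add: r_def l_def)
qed

lemma sum_head_coeff: "(\<Sum>j | 1 \<le> j \<and> real j < c. (f \<bullet> \<phi> j)\<^sup>2) = (norm (proj (nat (\<lceil>c\<rceil> - 1)) f))\<^sup>2"
proof -
  have "{j. 1 \<le> j \<and> real j < c} = {1..nat (\<lceil>c\<rceil> - 1)}"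
  proof (intro set_eqI)
    fix j
    show "j \<in> {j. 1 \<le> j \<and> real j < c} \<longleftrightarrow> j \<in> {1..nat (\<lceil>c\<rceil> - 1)}"
      using less_ceiling_iff[of "int j" c] by (auto simp: le_nat_iff) 
  qed
  then show ?thesis
    by (simp add: norm_proj)
qed

lemma U_set_iff: "f \<in> U_set \<phi> l P \<longleftrightarrow> proj l f = f \<and> norm f \<le> P"
proof
  assume "f \<in> U_set \<phi> l P"
  then show "proj l f = f \<and> norm f \<le> P"
    unfolding U_set_def using proj_lincomb by auto
next
  assume "proj l f = f \<and> norm f \<le> P"
  then show "f \<in> U_set \<phi> l P"
    unfolding U_set_def by (auto simp: proj_def intro!: exI[of _ "\<lambda>j. f \<bullet> \<phi> j"])
qed

text \<open>If \<open>g\<close> lies in the span of the first \<open>l\<close> basis functions and is an orthogonal component of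
  \<open>f\<close>, then \<open>\<parallel>g\<parallel>\<^sup>2 = \<langle>g, f\<rangle> = \<langle>g, proj l f\<rangle>\<close>.\<close>

lemma norm_le_norm_proj:
  assumes g: "proj l g = g" and orth: "g \<bullet> (f - g) = 0"
  shows "norm g \<le> norm (proj l f)"
proof -
  have "norm g * norm g = g \<bullet> g"
    by (simp add: dot_square_norm power2_eq_square)
  also have "\<dots> = g \<bullet> proj l f"
    using orth inner_proj[of l g f] g by (simp add: inner_diff_right)
  also have "\<dots> \<le> norm g * norm (proj l f)"
    by (rule norm_cauchy_schwarz)
  finally show ?thesis
    by (cases "g = 0") auto
qed

lemma inner_diff_iff_pythagoras: "f1 \<bullet> (f - f1) = 0 \<longleftrightarrow> (norm f)\<^sup>2 = (norm f1)\<^sup>2 + (norm (f - f1))\<^sup>2" for f f1 :: L2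
  by (auto simp: power2_norm_eq_inner inner_diff_left inner_diff_right inner_commute)

end

section \<open>Tests, errors and consistency in terms of the weighted energy\<close>

locale sequence_model = l2_basis \<phi> for \<phi> +
  fixes M :: "'w measure" and \<xi> :: "nat \<Rightarrow> 'w \<Rightarrow> real" and \<sigma> \<kappa> :: "nat \<Rightarrow> real"
  assumes noise: "standard_gaussian_noise M \<xi>" and D1: "D1 \<kappa>" and D2: "D2 \<sigma>"

sublocale sequence_model \<subseteq> gaussian_noise M "\<lambda>j. \<xi> (Suc j)"
proof -
  interpret prob_space M
    using noise by (simp add: standard_gaussian_noise_def)
  have "indep_vars (\<lambda>_. borel) \<xi> {1..}"
    using noise by (simp add: standard_gaussian_noise_def)
  then have "indep_vars (\<lambda>j. PiM {Suc j} (\<lambda>_. borel)) (\<lambda>j \<omega>. restrict (\<lambda>i. \<xi> i \<omega>) {Suc j}) UNIV"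
    by (rule indep_vars_restrict) (auto simp: disjoint_family_on_def)
  then have "indep_vars (\<lambda>_. borel) (\<lambda>j \<omega>. (restrict (\<lambda>i. \<xi> i \<omega>) {Suc j}) (Suc j)) UNIV"
    by (rule indep_vars_compose2) (auto intro!: measurable_component_singleton)
  then have "indep_vars (\<lambda>_. borel) (\<lambda>j. \<xi> (Suc j)) UNIV"
    by simp
  then show "gaussian_noise M (\<lambda>j. \<xi> (Suc j))"
    using noise by unfold_locales (auto simp: standard_gaussian_noise_def)
qed

context sequence_model begin

abbreviation "err1 \<equiv> type_I_error M \<xi> \<phi> \<sigma>"
abbreviation "err2 \<equiv> type_II_error M \<xi> \<phi> \<sigma>"
abbreviation "level_tests \<equiv> tests_of_level M \<xi> \<phi> \<sigma> \<kappa>"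
abbreviation "consist \<equiv> consistent M \<xi> \<phi> \<sigma> \<kappa>"
abbreviation "inconsist \<equiv> inconsistent M \<xi> \<phi> \<sigma> \<kappa>"
abbreviation "purely_consist \<equiv> purely_consistent M \<xi> \<phi> \<sigma> \<kappa>"

definition \<tau> :: "nat \<Rightarrow> real" where
  "\<tau> j = \<bar>\<kappa> (Suc j)\<bar> * \<sigma> (Suc j)"

text \<open>Only \<open>\<kappa>\<^sup>2\<close> enters the statistic, so the sign of \<open>\<kappa>\<close> is dropped; this keeps the amplitudes
  \<open>\<tau>\<close> of the noise positive.\<close>

definition signal :: "nat \<Rightarrow> L2 \<Rightarrow> nat \<Rightarrow> real" where
  "signal n f j = sqrt (real n) * \<bar>\<kappa> (Suc j)\<bar> * (f \<bullet> \<phi> (Suc j))"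

definition weighted_energy :: "L2 \<Rightarrow> real" where
  "weighted_energy f = (\<Sum>j. (\<kappa> (Suc j))\<^sup>2 * (f \<bullet> \<phi> (Suc j))\<^sup>2)"

lemma kappa_summable: "summable (\<lambda>j. (\<kappa> (Suc j))\<^sup>2)"
  and kappa_pos: "0 < (\<kappa> (Suc j))\<^sup>2"
  and kappa_antimono: "i \<le> j \<Longrightarrow> (\<kappa> (Suc j))\<^sup>2 \<le> (\<kappa> (Suc i))\<^sup>2"
  using D1 by (auto simp: D1_def decseq_def)

lemma kappa_tendsto: "(\<lambda>j. (\<kappa> (Suc j))\<^sup>2) \<longlonglongrightarrow> 0"
  by (rule summable_LIMSEQ_zero[OF kappa_summable])

lemma tau_pos: "0 < \<tau> j"
  using D2 kappa_pos[of j] by (auto simp: D2_def \<tau>_def)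

lemma tau_square_summable: "square_summable \<tau>"
proof -
  obtain C where C: "\<And>j. 1 \<le> j \<Longrightarrow> 0 < \<sigma> j \<and> \<sigma> j < C"
    using D2 by (auto simp: D2_def)
  show ?thesis
  proof (rule summable_comparison_test_ev)
    show "summable (\<lambda>j. C\<^sup>2 * (\<kappa> (Suc j))\<^sup>2)"
      by (intro summable_mult kappa_summable)
    have "(\<tau> j)\<^sup>2 \<le> C\<^sup>2 * (\<kappa> (Suc j))\<^sup>2" for j
    proof -
      have "(\<sigma> (Suc j))\<^sup>2 \<le> C\<^sup>2"
        using C[of "Suc j"] by (intro power_mono) auto
      then show ?thesis
        by (simp add: \<tau>_def power_mult_distrib mult.commute[of "C\<^sup>2"] mult_left_mono)
    qed
    then show "\<forall>\<^sub>F j in sequentially. norm ((\<tau> j)\<^sup>2) \<le> C\<^sup>2 * (\<kappa> (Suc j))\<^sup>2"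
      by simp
  qed
qed

lemma weighted_energy_summable: "summable (\<lambda>j. (\<kappa> (Suc j))\<^sup>2 * (f \<bullet> \<phi> (Suc j))\<^sup>2)"
proof (rule summable_comparison_test_ev)
  show "summable (\<lambda>j. (\<kappa> (Suc 0))\<^sup>2 * (f \<bullet> \<phi> (Suc j))\<^sup>2)"
    by (intro summable_mult sums_summable[OF parseval])
  show "\<forall>\<^sub>F j in sequentially. norm ((\<kappa> (Suc j))\<^sup>2 * (f \<bullet> \<phi> (Suc j))\<^sup>2) \<le> (\<kappa> (Suc 0))\<^sup>2 * (f \<bullet> \<phi> (Suc j))\<^sup>2"
    by (auto intro!: always_eventually mult_right_mono kappa_antimono)
qed

lemma weighted_energy_nonneg: "0 \<le> weighted_energy f"
  unfolding weighted_energy_def by (intro suminf_nonneg weighted_energy_summable) auto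

lemma signal_sums: "(\<lambda>j. (signal n f j)\<^sup>2) sums (real n * weighted_energy f)"
proof -
  have "(signal n f j)\<^sup>2 = real n * ((\<kappa> (Suc j))\<^sup>2 * (f \<bullet> \<phi> (Suc j))\<^sup>2)" for j
    by (simp add: signal_def power_mult_distrib)
  then show ?thesis
    unfolding weighted_energy_def by (simp add: sums_mult summable_sums weighted_energy_summable)
qed

lemma signal_square_summable: "square_summable (signal n f)"
  using signal_sums by (rule sums_summable)

lemma signal_energy: "(\<Sum>j. (signal n f j)\<^sup>2) = real n * weighted_energy f"
  using signal_sums by (rule sums_unique[symmetric])

lemma signal_zero: "signal n 0 = (\<lambda>_. 0)"
  by (auto simp: signal_def)

lemma signal_add: "signal n (f + g) = (\<lambda>j. signal n f j + signal n g j)"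
  by (auto simp: signal_def inner_add_left algebra_simps)

lemma T_stat_observation:
  assumes n: "1 \<le> n"
  shows "AE \<omega> in M. real n * T_stat \<kappa> (observation \<xi> \<phi> \<sigma> n f \<omega>) = energy (signal n f) \<tau> \<omega>"
  using AE_square_summable_observation[OF tau_square_summable]
proof eventually_elim
  case (elim \<omega>)
  let ?y = "observation \<xi> \<phi> \<sigma> n f \<omega>"
  have eq: "(signal n f j + \<tau> j * \<xi> (Suc j) \<omega>)\<^sup>2 = real n * ((\<kappa> (Suc j))\<^sup>2 * (?y (Suc j))\<^sup>2)" for j
  proof -
    have "sqrt (real n) * real n powr (-1/2) = 1"
      using n by (simp add: powr_half_sqrt[symmetric] powr_add[symmetric])
    then have "signal n f j + \<tau> j * \<xi> (Suc j) \<omega> = sqrt (real n) * (\<bar>\<kappa> (Suc j)\<bar> * ?y (Suc j))"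
      by (simp add: signal_def \<tau>_def observation_def algebra_simps)
    then show ?thesis
      by (simp add: power_mult_distrib)
  qed
  have "square_summable (\<lambda>j. signal n f j + \<tau> j * \<xi> (Suc j) \<omega>)"
    using elim signal_square_summable by simp
  then have "summable (\<lambda>j. (\<kappa> (Suc j))\<^sup>2 * (?y (Suc j))\<^sup>2)"
    unfolding eq using n by (simp add: summable_cmult_iff)
  then show ?case
    unfolding energy_def eq T_stat_def by (simp add: suminf_mult)
qed

lemma measure_T_stat:
  assumes n: "1 \<le> n"
  shows "measure M {\<omega>\<in>space M. \<not> T_stat \<kappa> (observation \<xi> \<phi> \<sigma> n f \<omega>) > t} = energy_cdf (signal n f) \<tau> (real n * t)"
    and "measure M {\<omega>\<in>space M. T_stat \<kappa> (observation \<xi> \<phi> \<sigma> n f \<omega>) > t} = 1 - energy_cdf (signal n f) \<tau> (real n * t)"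
proof -
  have "(\<lambda>\<omega>. observation \<xi> \<phi> \<sigma> n f \<omega> (Suc j)) \<in> borel_measurable M" for j
    unfolding observation_def by measurable
  then have [measurable]: "(\<lambda>\<omega>. T_stat \<kappa> (observation \<xi> \<phi> \<sigma> n f \<omega>)) \<in> borel_measurable M"
    unfolding T_stat_def by measurable
  show 1: "measure M {\<omega>\<in>space M. \<not> T_stat \<kappa> (observation \<xi> \<phi> \<sigma> n f \<omega>) > t} = energy_cdf (signal n f) \<tau> (real n * t)"
    unfolding energy_cdf_def
  proof (rule finite_measure_eq_AE)
    show "AE \<omega> in M. (\<omega> \<in> {\<omega>\<in>space M. \<not> T_stat \<kappa> (observation \<xi> \<phi> \<sigma> n f \<omega>) > t}) =
       (\<omega> \<in> {\<omega>\<in>space M. energy (signal n f) \<tau> \<omega> \<le> real n * t})"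
      using T_stat_observation[OF n, of f]
    proof eventually_elim
      case (elim \<omega>)
      then show ?case
        using n by (simp add: not_less flip: elim)
    qed
  qed measurable
  show "measure M {\<omega>\<in>space M. T_stat \<kappa> (observation \<xi> \<phi> \<sigma> n f \<omega>) > t} = 1 - energy_cdf (signal n f) \<tau> (real n * t)"
    unfolding 1[symmetric] by (subst prob_neg) auto
qed

definition threshold_test :: "real \<Rightarrow> nat \<Rightarrow> test" where
  "threshold_test q n y \<longleftrightarrow> T_stat \<kappa> y > q / real n"

lemma threshold_test_generated: "generated_by (T_stat \<kappa>) (threshold_test q n)"
  unfolding generated_by_def threshold_test_def by blast

lemma threshold_test_errors:
  assumes "1 \<le> n"
  shows "err1 n (threshold_test q n) = 1 - energy_cdf (\<lambda>_. 0) \<tau> q"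
    "err2 n (threshold_test q n) f = energy_cdf (signal n f) \<tau> q"
  using assms
  by (simp_all only: type_I_error_def type_II_error_def threshold_test_def measure_T_stat[OF assms] signal_zero)
     simp_all

text \<open>The distribution function of the pure noise is continuous and takes values below and above
  \<open>p\<close>; it vanishes at \<open>0\<close> because it vanishes on the negative axis.\<close>

lemma null_quantile_exists:
  assumes "0 < p" "p < 1"
  obtains q where "0 < q" "energy_cdf (\<lambda>_. 0) \<tau> q = p"
proof -
  let ?F = "energy_cdf (\<lambda>_. 0) \<tau>"
  have holder: "?F y - ?F x \<le> sqrt (y - x) / \<tau> 0" if "x \<le> y" for x y
    using that by (intro energy_cdf_holder tau_square_summable tau_pos) auto
  have small: "sqrt d / \<tau> 0 < e" if "0 < e" "d < (e * \<tau> 0)\<^sup>2" for d e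
  proof -
    have "sqrt d < e * \<tau> 0"
      using real_sqrt_less_mono[OF that(2)] that(1) tau_pos[of 0] by simp
    then show ?thesis
      using tau_pos[of 0] by (simp add: field_simps)
  qed
  have cont: "isCont ?F x" for x
    unfolding continuous_at_eps_delta
  proof (intro allI impI)
    fix e :: real assume e: "0 < e"
    have "dist (?F y) (?F x) < e" if "dist y x < (e * \<tau> 0)\<^sup>2" for y
    proof -
      have "\<bar>?F y - ?F x\<bar> \<le> sqrt \<bar>y - x\<bar> / \<tau> 0"
        using holder[of x y] holder[of y x] energy_cdf_mono[of x y "\<lambda>_. 0" \<tau>] energy_cdf_mono[of y x "\<lambda>_. 0" \<tau>]
        by (cases "x \<le> y") auto
      also have "\<dots> < e"
        using that by (intro small e) (simp add: dist_real_def)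
      finally show ?thesis by (simp add: dist_real_def)
    qed
    then show "\<exists>d>0. \<forall>y. dist y x < d \<longrightarrow> dist (?F y) (?F x) < e"
      using e tau_pos[of 0] by (intro exI[of _ "(e * \<tau> 0)\<^sup>2"]) auto
  qed
  have F0: "?F 0 < p"
  proof -
    define d where "d = (p * \<tau> 0)\<^sup>2 / 2"
    have d: "0 < d" "d < (p * \<tau> 0)\<^sup>2"
      using assms tau_pos[of 0] by (auto simp: d_def)
    have "?F 0 \<le> sqrt d / \<tau> 0"
      using holder[of "- d" 0] d energy_cdf_neg[OF _ tau_square_summable, of "\<lambda>_. 0" "- d"] by simp
    also have "\<dots> < p"
      by (rule small) (use assms d in auto)
    finally show ?thesis .
  qed
  obtain x where x: "0 < x" "1 - (1 - p) \<le> ?F x"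
    using energy_cdf_zero_tail[OF tau_square_summable, of "1 - p"] assms by auto
  obtain q where q: "0 \<le> q" "q \<le> x" "?F q = p"
    using IVT[of ?F 0 p x] F0 x cont by auto
  then show thesis
    using that[of q] F0 by (cases "q = 0") auto
qed

lemma levels_tendsto:
  assumes "level_tests N \<alpha> K"
  shows "(\<lambda>i. err1 (N i) (K i)) \<longlonglongrightarrow> \<alpha>"
  using assms by (auto simp: tests_of_level_def intro: asymp_equivD_const)

lemma threshold_tests_of_level:
  assumes N: "\<forall>\<^sub>F i in sequentially. 1 \<le> N i" and q: "energy_cdf (\<lambda>_. 0) \<tau> q = 1 - \<alpha>" and \<alpha>: "0 < \<alpha>"
  shows "level_tests N \<alpha> (\<lambda>i. threshold_test q (N i))"
  unfolding tests_of_level_def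
proof (intro conjI allI threshold_test_generated tendsto_imp_asymp_equiv_const)
  have "\<forall>\<^sub>F i in sequentially. \<alpha> = err1 (N i) (threshold_test q (N i))"
    using N by eventually_elim (simp add: threshold_test_errors q)
  then show "(\<lambda>i. err1 (N i) (threshold_test q (N i))) \<longlonglongrightarrow> \<alpha>"
    by (rule Lim_transform_eventually[OF tendsto_const])
qed (use \<alpha> in simp)

lemma generated_tests_thresholds:
  assumes K: "\<And>i. generated_by (T_stat \<kappa>) (K i)"
  obtains x where
    "\<And>i. 1 \<le> N i \<Longrightarrow> err1 (N i) (K i) = 1 - energy_cdf (\<lambda>_. 0) \<tau> (x i)"
    "\<And>i f. 1 \<le> N i \<Longrightarrow> err2 (N i) (K i) f = energy_cdf (signal (N i) f) \<tau> (x i)"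
proof -
  obtain t where K': "\<And>i y. K i y \<longleftrightarrow> T_stat \<kappa> y > t i"
    using K unfolding generated_by_def by metis
  show thesis
    by (rule that[of "\<lambda>i. real (N i) * t i"])
       (simp_all only: type_I_error_def type_II_error_def K' measure_T_stat signal_zero)
qed

text \<open>If the scaled weighted energy comes close to \<open>0\<close> infinitely often, the test of level \<open>1 / 2\<close> does not separate
  the signal from \<open>0\<close> there, by uniform continuity.  Conversely, the thresholds of tests of level
  \<open>\<alpha>\<close> do not exceed the quantile \<open>q\<close> by a fixed \<open>\<rho>\<close> in the limit, and the gap at \<open>q\<close> survives an
  enlargement of \<open>q\<close> by a small \<open>\<rho>\<close>.\<close>

lemma consistent_iff_weighted_energy:
  assumes N: "\<forall>\<^sub>F i in sequentially. 1 \<le> N i"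
  shows "consist N f \<longleftrightarrow>
    (\<exists>\<delta>>0. \<forall>\<^sub>F i in sequentially. \<delta> \<le> real (N i) * weighted_energy (f i))"
proof
  let ?F = "energy_cdf (\<lambda>_. 0) \<tau>"
  assume cons: "consist N f"
  obtain q where q: "0 < q" "?F q = 1 / 2"
    using null_quantile_exists[of "1 / 2"] by auto
  let ?K = "\<lambda>i. threshold_test q (N i)"
  let ?L = "limsup (\<lambda>i. ereal (err2 (N i) (?K i) (f i)))"
  have "?L < ereal (1 - 1 / 2)"
    using cons threshold_tests_of_level[OF N, of q "1 / 2"] q
    unfolding consistent_def by (auto dest!: bspec[of _ _ "1 / 2 :: real"])
  then obtain c where c: "?L < ereal c" "c < 1 / 2"
    using ereal_dense2 by fastforce
  have beta: "\<forall>\<^sub>F i in sequentially. energy_cdf (signal (N i) (f i)) \<tau> q < c"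
    using Limsup_lessD[OF c(1)] N by eventually_elim (simp add: threshold_test_errors)
  obtain \<delta> where \<delta>: "0 < \<delta>" "\<And>a b x. square_summable a \<Longrightarrow> square_summable b \<Longrightarrow> (\<Sum>j. (b j)\<^sup>2) \<le> \<delta> \<Longrightarrow> x \<le> q \<Longrightarrow>
      \<bar>energy_cdf (\<lambda>j. a j + b j) \<tau> x - energy_cdf a \<tau> x\<bar> \<le> 1 / 2 - c"
    by (rule energy_cdf_uniformly_continuous[OF tau_square_summable tau_pos[of 0], of "1 / 2 - c" q])
       (use c(2) in simp, rule that)
  have "\<forall>\<^sub>F i in sequentially. \<delta> \<le> real (N i) * weighted_energy (f i)"
    using beta
  proof eventually_elim
    case (elim i)
    show ?case
    proof (rule ccontr)
      assume "\<not> ?thesis"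
      then have "\<bar>energy_cdf (\<lambda>j. 0 + signal (N i) (f i) j) \<tau> q - ?F q\<bar> \<le> 1 / 2 - c"
        by (intro \<delta>(2)) (auto simp: signal_square_summable signal_energy)
      then show False
        using elim q by simp
    qed
  qed
  then show "\<exists>\<delta>>0. \<forall>\<^sub>F i in sequentially. \<delta> \<le> real (N i) * weighted_energy (f i)"
    using \<delta>(1) by blast
next
  let ?F = "energy_cdf (\<lambda>_. 0) \<tau>"
  assume "\<exists>\<delta>>0. \<forall>\<^sub>F i in sequentially. \<delta> \<le> real (N i) * weighted_energy (f i)"
  then obtain \<delta> where \<delta>: "0 < \<delta>" "\<forall>\<^sub>F i in sequentially. \<delta> \<le> real (N i) * weighted_energy (f i)"
    by blast
  show "consist N f"
    unfolding consistent_def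
  proof (intro ballI allI impI)
    fix \<alpha> :: real and K
    assume \<alpha>: "\<alpha> \<in> {0<..<1}" and K: "level_tests N \<alpha> K"
    let ?L = "limsup (\<lambda>i. ereal (err2 (N i) (K i) (f i)))"
    obtain x where x: "\<And>i. 1 \<le> N i \<Longrightarrow> err1 (N i) (K i) = 1 - ?F (x i)"
      "\<And>i f. 1 \<le> N i \<Longrightarrow> err2 (N i) (K i) f = energy_cdf (signal (N i) f) \<tau> (x i)"
      using generated_tests_thresholds[of K N] K by (auto simp: tests_of_level_def)
    obtain q where q: "0 < q" "?F q = 1 - \<alpha>"
      using null_quantile_exists[of "1 - \<alpha>"] \<alpha> by auto
    obtain \<eta> where \<eta>: "0 < \<eta>"
      "\<And>a. square_summable a \<Longrightarrow> \<delta> \<le> (\<Sum>j. (a j)\<^sup>2) \<Longrightarrow> energy_cdf a \<tau> q \<le> ?F q - \<eta>"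
      using energy_cdf_gap[OF tau_square_summable tau_pos q(1) \<delta>(1)] by blast
    \<comment> \<open>Enlarging the threshold by \<open>\<rho>\<close> costs at most half of the gap.\<close>
    define \<rho> where "\<rho> = (\<eta> / 2 * \<tau> 0)\<^sup>2"
    have \<rho>: "0 < \<rho>" "sqrt \<rho> / \<tau> 0 = \<eta> / 2"
      using \<eta>(1) tau_pos[of 0] by (auto simp: \<rho>_def)
    have "?F q < ?F (q + \<rho>)"
      using q \<rho> by (intro energy_cdf_zero_strict_mono tau_square_summable tau_pos) auto
    then have "\<forall>\<^sub>F i in sequentially. 1 - ?F (q + \<rho>) < err1 (N i) (K i)"
      using q by (intro order_tendstoD(1)[OF levels_tendsto[OF K]]) simp
    then have "\<forall>\<^sub>F i in sequentially. ereal (err2 (N i) (K i) (f i)) \<le> ereal (1 - \<alpha> - \<eta> / 2)"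
      using N \<delta>(2)
    proof eventually_elim
      case (elim i)
      let ?G = "energy_cdf (signal (N i) (f i)) \<tau>"
      have "x i \<le> q + \<rho>"
      proof (rule ccontr)
        assume "\<not> ?thesis"
        then have "?F (q + \<rho>) \<le> ?F (x i)"
          by (intro energy_cdf_mono) simp
        then show False
          using elim x(1) by simp
      qed
      then have "?G (x i) \<le> ?G (q + \<rho>)"
        by (rule energy_cdf_mono)
      moreover have "?G (q + \<rho>) - ?G q \<le> sqrt (q + \<rho> - q) / \<tau> 0"
        using \<rho> by (intro energy_cdf_holder signal_square_summable tau_square_summable tau_pos) auto
      moreover have "?G q \<le> ?F q - \<eta>"
        using elim by (intro \<eta>(2)) (auto simp: signal_square_summable signal_energy)
      ultimately show ?case
        using x(2) elim q \<rho> by simp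
    qed
    then have "?L \<le> ereal (1 - \<alpha> - \<eta> / 2)"
      by (rule Limsup_bounded)
    also have "\<dots> < ereal (1 - \<alpha>)"
      using \<eta>(1) by simp
    finally show "?L < ereal (1 - \<alpha>)" .
  qed
qed

text \<open>The sum of the two errors at threshold \<open>x\<close> is \<open>1 - (F\<^sub>0(x) - F\<^sub>a(x))\<close>.  The difference tends
  to \<open>0\<close> uniformly in \<open>x\<close> when the signals do; a gap at the median for infinitely many indices
  contradicts inconsistency.\<close>

lemma inconsistent_iff_weighted_energy:
  assumes N: "\<forall>\<^sub>F i in sequentially. 1 \<le> N i"
  shows "inconsist N f \<longleftrightarrow> (\<lambda>i. real (N i) * weighted_energy (f i)) \<longlonglongrightarrow> 0"
proof
  let ?F = "energy_cdf (\<lambda>_. 0) \<tau>"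
  assume inc: "inconsist N f"
  obtain q where q: "0 < q" "?F q = 1 / 2"
    using null_quantile_exists[of "1 / 2"] by auto
  let ?K = "\<lambda>i. threshold_test q (N i)"
  let ?L = "liminf (\<lambda>i. ereal (err1 (N i) (?K i) + err2 (N i) (?K i) (f i)))"
  show "(\<lambda>i. real (N i) * weighted_energy (f i)) \<longlonglongrightarrow> 0"
  proof (rule order_tendstoI)
    fix d :: real assume "d < 0"
    then show "\<forall>\<^sub>F i in sequentially. d < real (N i) * weighted_energy (f i)"
      by (auto intro!: always_eventually less_le_trans[of d 0] mult_nonneg_nonneg weighted_energy_nonneg)
  next
    fix d :: real assume d: "0 < d"
    obtain \<eta> where \<eta>: "0 < \<eta>"
      "\<And>a. square_summable a \<Longrightarrow> d \<le> (\<Sum>j. (a j)\<^sup>2) \<Longrightarrow> energy_cdf a \<tau> q \<le> ?F q - \<eta>"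
      using energy_cdf_gap[OF tau_square_summable tau_pos q(1) d] by blast
    have "1 \<le> ?L"
      by (rule inc[unfolded inconsistent_def, rule_format]) (rule threshold_test_generated)
    moreover have "ereal (1 - \<eta>) < 1"
      using \<eta>(1) by (simp add: one_ereal_def)
    ultimately have "ereal (1 - \<eta>) < ?L"
      by (rule less_le_trans[rotated])
    from less_LiminfD[OF this] N
    show "\<forall>\<^sub>F i in sequentially. real (N i) * weighted_energy (f i) < d"
    proof eventually_elim
      case (elim i)
      show ?case
      proof (rule ccontr)
        assume "\<not> ?thesis"
        then have "energy_cdf (signal (N i) (f i)) \<tau> q \<le> ?F q - \<eta>"
          by (intro \<eta>(2)) (auto simp: signal_square_summable signal_energy)
        then show False
          using elim q by (simp add: threshold_test_errors)
      qed
    qed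
  qed
next
  let ?F = "energy_cdf (\<lambda>_. 0) \<tau>"
  assume lim: "(\<lambda>i. real (N i) * weighted_energy (f i)) \<longlonglongrightarrow> 0"
  show "inconsist N f"
    unfolding inconsistent_def
  proof (intro allI impI)
    fix K :: "nat \<Rightarrow> test" assume K: "\<forall>i. generated_by (T_stat \<kappa>) (K i)"
    let ?L = "liminf (\<lambda>i. ereal (err1 (N i) (K i) + err2 (N i) (K i) (f i)))"
    obtain x where x: "\<And>i. 1 \<le> N i \<Longrightarrow> err1 (N i) (K i) = 1 - ?F (x i)"
      "\<And>i f. 1 \<le> N i \<Longrightarrow> err2 (N i) (K i) f = energy_cdf (signal (N i) f) \<tau> (x i)"
      using generated_tests_thresholds[of K N] K by auto
    show "1 \<le> ?L"
    proof (rule ereal_le_epsilon2)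
      fix e :: real assume e: "0 < e"
      obtain \<delta> where \<delta>: "0 < \<delta>" "\<And>a b x. square_summable a \<Longrightarrow> square_summable b \<Longrightarrow>
          (\<Sum>j. (a j)\<^sup>2) \<le> 0 \<Longrightarrow> (\<Sum>j. (b j)\<^sup>2) \<le> \<delta> \<Longrightarrow>
          \<bar>energy_cdf (\<lambda>j. a j + b j) \<tau> x - energy_cdf a \<tau> x\<bar> \<le> e"
        by (rule energy_cdf_uniformly_continuous_bounded[OF tau_square_summable tau_pos[of 0] e, of 0]) (rule that)
      have "\<forall>\<^sub>F i in sequentially. ereal (1 - e) \<le>
        ereal (err1 (N i) (K i) + err2 (N i) (K i) (f i))"
        using order_tendstoD(2)[OF lim \<delta>(1)] N
      proof eventually_elim
        case (elim i)
        have "\<bar>energy_cdf (\<lambda>j. 0 + signal (N i) (f i) j) \<tau> (x i) - ?F (x i)\<bar> \<le> e"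
          using elim by (intro \<delta>(2)) (auto simp: signal_square_summable signal_energy)
        then show ?case
          using elim x by simp
      qed
      then have "ereal (1 - e) \<le> ?L"
        by (rule Liminf_bounded)
      then show "1 \<le> ?L + ereal e"
        by (cases "?L")
           (auto simp: one_ereal_def)
    qed
  qed
qed

end

section \<open>Rates\<close>

text \<open>Bounds of order \<open>n\<^sup>-\<^sup>1\<^sup>/\<^sup>2\<close> on norms are bounds on \<open>n \<parallel>f\<parallel>\<^sup>2\<close>, the form in which they are
  used.\<close>

lemma root_n_bounds:
  fixes x :: real
  assumes n: "1 \<le> n" and "0 \<le> c" "0 \<le> x"
  shows "c * real n powr (-1/2) \<le> x \<longleftrightarrow> c\<^sup>2 \<le> real n * x\<^sup>2"
    and "x \<le> c * real n powr (-1/2) \<longleftrightarrow> real n * x\<^sup>2 \<le> c\<^sup>2"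
    and "c * real n powr (-1/2) < x \<longleftrightarrow> c\<^sup>2 < real n * x\<^sup>2"
    and "x < c * real n powr (-1/2) \<longleftrightarrow> real n * x\<^sup>2 < c\<^sup>2"
proof -
  define s where "s = sqrt (real n)"
  have s: "0 < s" "s\<^sup>2 = real n"
    using n by (auto simp: s_def)
  have r: "real n powr (-1/2) = 1 / s"
    using n by (simp add: s_def powr_minus_divide powr_half_sqrt)
  have le: "u\<^sup>2 \<le> v\<^sup>2 \<longleftrightarrow> u \<le> v" "u\<^sup>2 < v\<^sup>2 \<longleftrightarrow> u < v" if "0 \<le> u" "0 \<le> v" for u v :: real
    using that by (auto simp: power_mono_iff simp flip: not_le)
  have sx: "real n * x\<^sup>2 = (s * x)\<^sup>2" "0 \<le> s * x"
    using s assms by (auto simp: power_mult_distrib)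
  show "c * real n powr (-1/2) \<le> x \<longleftrightarrow> c\<^sup>2 \<le> real n * x\<^sup>2"
    "x \<le> c * real n powr (-1/2) \<longleftrightarrow> real n * x\<^sup>2 \<le> c\<^sup>2"
    "c * real n powr (-1/2) < x \<longleftrightarrow> c\<^sup>2 < real n * x\<^sup>2"
    "x < c * real n powr (-1/2) \<longleftrightarrow> real n * x\<^sup>2 < c\<^sup>2"
    unfolding sx(1) le(1)[OF assms(2) sx(2)] le(1)[OF sx(2) assms(2)]
      le(2)[OF assms(2) sx(2)] le(2)[OF sx(2) assms(2)] r
    using s by (auto simp: field_simps)
qed

lemma order_root_nD:
  assumes "order_root_n f"
  obtains c C where "0 < c" "c < C" "\<And>n. 1 \<le> n \<Longrightarrow> c\<^sup>2 \<le> real n * (norm (f n))\<^sup>2"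
    "\<And>n. 1 \<le> n \<Longrightarrow> real n * (norm (f n))\<^sup>2 \<le> C\<^sup>2"
proof -
  obtain c C where c: "0 < c" "c < C"
    "\<And>n. 1 \<le> n \<Longrightarrow> c * real n powr (-1/2) \<le> norm (f n) \<and> norm (f n) \<le> C * real n powr (-1/2)"
    using assms unfolding order_root_n_def by blast
  show thesis
    by (rule that[OF c(1,2)])
       (use c root_n_bounds(1)[of _ c] root_n_bounds(2)[of _ C] in auto)
qed

lemma subsequence_index_eventually_ge_1:
  "subsequence_index N \<Longrightarrow> \<forall>\<^sub>F i in sequentially. 1 \<le> N i"
  by (simp add: subsequence_index_def)

lemma smallo_inverse_iff:
  assumes "\<forall>\<^sub>F i in sequentially. 1 \<le> N i"
  shows "h \<in> o(\<lambda>i. 1 / real (N i)) \<longleftrightarrow> (\<lambda>i. real (N i) * h i) \<longlonglongrightarrow> 0"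
proof -
  have eq: "h i / (1 / real (N i)) = real (N i) * h i" for i
    by simp
  have "\<forall>\<^sub>F i in sequentially. 1 / real (N i) \<noteq> 0"
    using assms by eventually_elim simp
  then show ?thesis
    using smalloD_tendsto[of h sequentially "\<lambda>i. 1 / real (N i)"]
      smalloI_tendsto[of h "\<lambda>i. 1 / real (N i)" sequentially]
    unfolding eq by blast
qed

section \<open>Heads and tails of the coefficient sequence\<close>

context sequence_model begin

text \<open>The weights decrease, so the first \<open>l\<close> of them are at least the next one.\<close>

lemma weighted_energy_ge_proj: "(\<kappa> (Suc l))\<^sup>2 * (norm (proj l f))\<^sup>2 \<le> weighted_energy f"
proof -
  have "(\<kappa> (Suc l))\<^sup>2 * (norm (proj l f))\<^sup>2 = (\<Sum>j<l. (\<kappa> (Suc l))\<^sup>2 * (f \<bullet> \<phi> (Suc j))\<^sup>2)"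
    by (simp add: norm_proj_lessThan sum_distrib_left)
  also have "\<dots> \<le> (\<Sum>j<l. (\<kappa> (Suc j))\<^sup>2 * (f \<bullet> \<phi> (Suc j))\<^sup>2)"
    by (intro sum_mono mult_right_mono kappa_antimono) auto
  also have "\<dots> \<le> weighted_energy f"
    unfolding weighted_energy_def by (intro sum_le_suminf weighted_energy_summable) auto
  finally show ?thesis .
qed

text \<open>The first \<open>l\<close> weights are at most the first one, the others at most the one with number
  \<open>l + 1\<close>.\<close>

lemma weighted_energy_le_proj:
  "weighted_energy f \<le> (\<kappa> (Suc 0))\<^sup>2 * (norm (proj l f))\<^sup>2 + (\<kappa> (Suc l))\<^sup>2 * (norm (f - proj l f))\<^sup>2"
proof -
  let ?p = "proj l f"
  have s: "(\<lambda>j. (\<kappa> (Suc 0))\<^sup>2 * (?p \<bullet> \<phi> (Suc j))\<^sup>2 + (\<kappa> (Suc l))\<^sup>2 * ((f - ?p) \<bullet> \<phi> (Suc j))\<^sup>2) sums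
     ((\<kappa> (Suc 0))\<^sup>2 * (norm ?p)\<^sup>2 + (\<kappa> (Suc l))\<^sup>2 * (norm (f - ?p))\<^sup>2)"
    by (intro sums_add sums_mult parseval)
  have "(\<kappa> (Suc j))\<^sup>2 * (f \<bullet> \<phi> (Suc j))\<^sup>2 \<le>
      (\<kappa> (Suc 0))\<^sup>2 * (?p \<bullet> \<phi> (Suc j))\<^sup>2 + (\<kappa> (Suc l))\<^sup>2 * ((f - ?p) \<bullet> \<phi> (Suc j))\<^sup>2" for j
    using kappa_antimono[of 0 j] kappa_antimono[of l j]
    by (cases "Suc j \<le> l") (auto simp: proj_coeff inner_diff_left intro!: mult_right_mono)
  then show ?thesis
    using suminf_le[OF _ weighted_energy_summable sums_summable[OF s]] sums_unique[OF s]
    by (simp add: weighted_energy_def)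
qed

lemma weighted_energy_le_norm: "weighted_energy f \<le> (\<kappa> (Suc 0))\<^sup>2 * (norm f)\<^sup>2"
  using weighted_energy_le_proj[of f 0] by (simp add: proj_def)

lemma consistent_if_head:
  assumes N: "\<forall>\<^sub>F i in sequentially. 1 \<le> N i" and c: "0 < c"
    and head: "\<forall>\<^sub>F i in sequentially. c \<le> real (N i) * (norm (proj l (f i)))\<^sup>2"
  shows "consist N f"
  unfolding consistent_iff_weighted_energy[OF N]
proof (intro exI conjI)
  show "0 < (\<kappa> (Suc l))\<^sup>2 * c"
    using c kappa_pos by simp
  show "\<forall>\<^sub>F i in sequentially. (\<kappa> (Suc l))\<^sup>2 * c \<le> real (N i) * weighted_energy (f i)"
    using head
  proof eventually_elim
    case (elim i)
    have "(\<kappa> (Suc l))\<^sup>2 * c \<le> (\<kappa> (Suc l))\<^sup>2 * (real (N i) * (norm (proj l (f i)))\<^sup>2)"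
      using elim by (intro mult_left_mono) auto
    also have "\<dots> = real (N i) * ((\<kappa> (Suc l))\<^sup>2 * (norm (proj l (f i)))\<^sup>2)"
      by simp
    also have "\<dots> \<le> real (N i) * weighted_energy (f i)"
      by (intro mult_left_mono weighted_energy_ge_proj) auto
    finally show ?case .
  qed
qed

lemma scaled_weighted_energy_le:
  assumes "real n * (norm f)\<^sup>2 \<le> B"
  shows "real n * weighted_energy f \<le> (\<kappa> (Suc 0))\<^sup>2 * (real n * (norm (proj l f))\<^sup>2) + (\<kappa> (Suc l))\<^sup>2 * B"
proof -
  have "real n * (norm (f - proj l f))\<^sup>2 \<le> real n * (norm f)\<^sup>2"
    by (intro mult_left_mono power_mono norm_diff_proj_le) auto
  then have "(\<kappa> (Suc l))\<^sup>2 * (real n * (norm (f - proj l f))\<^sup>2) \<le> (\<kappa> (Suc l))\<^sup>2 * B"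
    using assms by (intro mult_left_mono) auto
  moreover have "real n * weighted_energy f \<le>
     real n * ((\<kappa> (Suc 0))\<^sup>2 * (norm (proj l f))\<^sup>2 + (\<kappa> (Suc l))\<^sup>2 * (norm (f - proj l f))\<^sup>2)"
    by (intro mult_left_mono weighted_energy_le_proj) auto
  ultimately show ?thesis
    by (simp add: algebra_simps)
qed

lemma kappa_eventually_small:
  assumes "0 < e"
  obtains l where "1 \<le> l" "\<And>m. l \<le> m \<Longrightarrow> (\<kappa> (Suc m))\<^sup>2 * B \<le> e"
proof -
  have "(\<lambda>j. (\<kappa> (Suc j))\<^sup>2 * B) \<longlonglongrightarrow> 0 * B"
    by (intro tendsto_intros kappa_tendsto)
  then have "\<forall>\<^sub>F j in sequentially. (\<kappa> (Suc j))\<^sup>2 * B < e"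
    using assms by (intro order_tendstoD(2)) auto
  then obtain l where "\<And>m. l \<le> m \<Longrightarrow> (\<kappa> (Suc m))\<^sup>2 * B < e"
    by (auto simp: eventually_sequentially)
  then show thesis
    by (intro that[of "max 1 l"]) (auto simp: less_imp_le)
qed

text \<open>The weights beyond \<open>l\<close> multiply a bounded quantity, so for large \<open>l\<close> the tail cannot
  account for the energy that consistency provides.\<close>

lemma consistent_imp_head:
  assumes N: "\<forall>\<^sub>F i in sequentially. 1 \<le> N i"
    and B: "\<forall>\<^sub>F i in sequentially. real (N i) * (norm (f i))\<^sup>2 \<le> B"
    and cons: "consist N f"
  obtains l c where "1 \<le> l" "0 < c" "\<forall>\<^sub>F i in sequentially. c \<le> real (N i) * (norm (proj l (f i)))\<^sup>2"
proof -
  obtain \<delta> where \<delta>: "0 < \<delta>" "\<forall>\<^sub>F i in sequentially. \<delta> \<le> real (N i) * weighted_energy (f i)"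
    using cons unfolding consistent_iff_weighted_energy[OF N] by blast
  obtain l where l: "1 \<le> l" "(\<kappa> (Suc l))\<^sup>2 * B \<le> \<delta> / 2"
    using kappa_eventually_small[of "\<delta> / 2" B] \<delta>(1) by (metis half_gt_zero le_refl)
  have "\<forall>\<^sub>F i in sequentially. \<delta> / 2 / (\<kappa> (Suc 0))\<^sup>2 \<le> real (N i) * (norm (proj l (f i)))\<^sup>2"
    using \<delta>(2) B
  proof eventually_elim
    case (elim i)
    then have "\<delta> / 2 \<le> (\<kappa> (Suc 0))\<^sup>2 * (real (N i) * (norm (proj l (f i)))\<^sup>2)"
      using scaled_weighted_energy_le[OF elim(2), of l] l by linarith
    then show ?case
      using kappa_pos[of 0] by (simp add: field_simps)
  qed
  then show thesis
    using that[OF l(1), of "\<delta> / 2 / (\<kappa> (Suc 0))\<^sup>2"] \<delta>(1) kappa_pos[of 0] by simp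
qed

lemma inconsistent_imp_head:
  assumes N: "\<forall>\<^sub>F i in sequentially. 1 \<le> N i" and inc: "inconsist N f"
  shows "(\<lambda>i. real (N i) * (norm (proj l (f i)))\<^sup>2) \<longlonglongrightarrow> 0"
proof (rule tendsto_sandwich[OF _ _ tendsto_const])
  let ?k = "(\<kappa> (Suc l))\<^sup>2"
  have "(\<lambda>i. real (N i) * weighted_energy (f i) / ?k) \<longlonglongrightarrow> 0 / ?k"
    using inc unfolding inconsistent_iff_weighted_energy[OF N] by (intro tendsto_intros) (use kappa_pos[of l] in auto)
  then show "(\<lambda>i. real (N i) * weighted_energy (f i) / ?k) \<longlonglongrightarrow> 0"
    by simp
  show "\<forall>\<^sub>F i in sequentially. real (N i) * (norm (proj l (f i)))\<^sup>2 \<le> real (N i) * weighted_energy (f i) / ?k"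
  proof (intro always_eventually allI)
    fix i
    have "real (N i) * (?k * (norm (proj l (f i)))\<^sup>2) \<le> real (N i) * weighted_energy (f i)"
      by (intro mult_left_mono weighted_energy_ge_proj) auto
    then show "real (N i) * (norm (proj l (f i)))\<^sup>2 \<le> real (N i) * weighted_energy (f i) / ?k"
      using kappa_pos[of l] by (simp add: pos_le_divide_eq mult_ac)
  qed
qed auto

lemma inconsistent_if_head:
  assumes N: "\<forall>\<^sub>F i in sequentially. 1 \<le> N i"
    and B: "\<forall>\<^sub>F i in sequentially. real (N i) * (norm (f i))\<^sup>2 \<le> B"
    and head: "\<And>l. (\<lambda>i. real (N i) * (norm (proj l (f i)))\<^sup>2) \<longlonglongrightarrow> 0"
  shows "inconsist N f"
  unfolding inconsistent_iff_weighted_energy[OF N]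
proof (rule order_tendstoI)
  fix d :: real assume "d < 0"
  then show "\<forall>\<^sub>F i in sequentially. d < real (N i) * weighted_energy (f i)"
    by (auto intro!: always_eventually less_le_trans[of d 0] mult_nonneg_nonneg weighted_energy_nonneg)
next
  fix d :: real assume d: "0 < d"
  obtain l where l: "(\<kappa> (Suc l))\<^sup>2 * B \<le> d / 2"
    using kappa_eventually_small[of "d / 2" B] d by (metis half_gt_zero le_refl)
  have "(\<lambda>i. (\<kappa> (Suc 0))\<^sup>2 * (real (N i) * (norm (proj l (f i)))\<^sup>2)) \<longlonglongrightarrow> (\<kappa> (Suc 0))\<^sup>2 * 0"
    by (intro tendsto_intros head)
  then have "\<forall>\<^sub>F i in sequentially. (\<kappa> (Suc 0))\<^sup>2 * (real (N i) * (norm (proj l (f i)))\<^sup>2) < d / 2"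
    using d by (intro order_tendstoD(2)) auto
  then show "\<forall>\<^sub>F i in sequentially. real (N i) * weighted_energy (f i) < d"
    using B
  proof eventually_elim
    case (elim i)
    then show ?case
      using scaled_weighted_energy_le[OF elim(2), of l] l by linarith
  qed
qed

lemma proj_scaled_eventually:
  assumes "0 < e"
  shows "\<forall>\<^sub>F l in sequentially. real n * (norm (f - proj l f))\<^sup>2 < e"
proof -
  have "(\<lambda>l. real n * (norm (f - proj l f))\<^sup>2) \<longlonglongrightarrow> real n * 0\<^sup>2"
    by (intro tendsto_intros proj_tendsto)
  then show ?thesis
    using assms by (intro order_tendstoD(2)) auto
qed

definition tail_negligible :: "(nat \<Rightarrow> L2) \<Rightarrow> bool" where
  "tail_negligible f \<longleftrightarrow>
     (\<forall>\<epsilon>>0. \<exists>l. \<forall>\<^sub>F n in sequentially. real n * (norm (f n - proj l (f n)))\<^sup>2 \<le> \<epsilon>)"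

lemma tail_antimono:
  "l \<le> m \<Longrightarrow> real n * (norm (g - proj m g))\<^sup>2 \<le> real n * (norm (g - proj l g))\<^sup>2"
  by (intro mult_left_mono power_mono norm_diff_proj_antimono) auto

text \<open>For the finitely many \<open>n\<close> that the definition leaves out, each single tail is small for
  large \<open>l\<close>.\<close>

lemma tail_negligible_uniform:
  assumes "tail_negligible f" "0 < \<epsilon>"
  obtains l where "1 \<le> l" "\<And>n. real n * (norm (f n - proj l (f n)))\<^sup>2 \<le> \<epsilon>"
proof -
  obtain l0 n0 where l0: "\<And>n. n0 \<le> n \<Longrightarrow> real n * (norm (f n - proj l0 (f n)))\<^sup>2 \<le> \<epsilon>"
    using assms unfolding tail_negligible_def eventually_sequentially by blast
  have "\<forall>\<^sub>F l in sequentially. \<forall>n\<in>{..<n0}. real n * (norm (f n - proj l (f n)))\<^sup>2 < \<epsilon>"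
    using assms(2) by (intro eventually_ball_finite ballI proj_scaled_eventually) auto
  then obtain l1 where l1: "\<And>n. n < n0 \<Longrightarrow> real n * (norm (f n - proj l1 (f n)))\<^sup>2 < \<epsilon>"
    unfolding eventually_sequentially by blast
  have "real n * (norm (f n - proj (max 1 (max l0 l1)) (f n)))\<^sup>2 \<le> \<epsilon>" for n
    using l0[of n] l1[of n] tail_antimono[of l0 "max 1 (max l0 l1)" n "f n"]
      tail_antimono[of l1 "max 1 (max l0 l1)" n "f n"]
    by (cases "n < n0") force+
  then show thesis
    by (intro that[of "max 1 (max l0 l1)"]) auto
qed

text \<open>The lower bound holds for large \<open>n\<close> by consistency.  For the finitely many other \<open>n\<close>, the
  projections converge to \<open>f n\<close>, whose norm is bounded below.\<close>

lemma consistent_uniform_head: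
  assumes f: "order_root_n f" and cons: "consist id f"
  obtains l c where "1 \<le> l" "0 < c" "\<And>m n. l \<le> m \<Longrightarrow> 1 \<le> n \<Longrightarrow> c \<le> real n * (norm (proj m (f n)))\<^sup>2"
proof -
  obtain c0 C where C0: "0 < c0" "c0 < C" and C: "\<And>n. 1 \<le> n \<Longrightarrow> c0\<^sup>2 \<le> real n * (norm (f n))\<^sup>2"
    "\<And>n. 1 \<le> n \<Longrightarrow> real n * (norm (f n))\<^sup>2 \<le> C\<^sup>2"
    by (rule order_root_nD[OF f]) (rule that)
  have "\<forall>\<^sub>F n in sequentially. 1 \<le> id n" "\<forall>\<^sub>F n in sequentially. real (id n) * (norm (f n))\<^sup>2 \<le> C\<^sup>2"
    using C(2) by (auto simp: eventually_sequentially)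
  then obtain l0 c1 where l0: "1 \<le> l0" "0 < c1" "\<forall>\<^sub>F n in sequentially. c1 \<le> real (id n) * (norm (proj l0 (f n)))\<^sup>2"
    using consistent_imp_head[OF _ _ cons] by blast
  then obtain n0 where n0: "\<And>n. n0 \<le> n \<Longrightarrow> c1 \<le> real n * (norm (proj l0 (f n)))\<^sup>2"
    by (auto simp: eventually_sequentially)
  have "\<forall>\<^sub>F l in sequentially. \<forall>n\<in>{..<n0}. real n * (norm (f n - proj l (f n)))\<^sup>2 < c0\<^sup>2 / 2"
    using C0(1) by (intro eventually_ball_finite ballI proj_scaled_eventually) auto
  then obtain l1 where l1: "\<And>n. n < n0 \<Longrightarrow> real n * (norm (f n - proj l1 (f n)))\<^sup>2 < c0\<^sup>2 / 2"
    unfolding eventually_sequentially by blast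
  define l where "l = max l0 l1"
  have "min c1 (c0\<^sup>2 / 2) \<le> real n * (norm (proj m (f n)))\<^sup>2" if "l \<le> m" "1 \<le> n" for m n
  proof (cases "n < n0")
    case True
    have "real n * (norm (f n))\<^sup>2 = real n * (norm (proj m (f n)))\<^sup>2 + real n * (norm (f n - proj m (f n)))\<^sup>2"
      using norm_split_proj[of "f n" m] by (simp add: algebra_simps)
    moreover have "real n * (norm (f n - proj m (f n)))\<^sup>2 \<le> real n * (norm (f n - proj l1 (f n)))\<^sup>2"
      using that by (intro tail_antimono) (simp add: l_def)
    ultimately show ?thesis
      using C(1)[OF that(2)] l1[OF True] by linarith
  next
    case False
    have "real n * (norm (proj l0 (f n)))\<^sup>2 \<le> real n * (norm (proj m (f n)))\<^sup>2"
      using that by (intro mult_left_mono power_mono norm_proj_mono) (auto simp: l_def)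
    then show ?thesis
      using n0[of n] False by linarith
  qed
  then show thesis
    using l0 C0(1) by (intro that[of l "min c1 (c0\<^sup>2 / 2)"]) (auto simp: l_def)
qed

text \<open>Along the subsequence the projection index \<open>i\<close> grows, so that every fixed head of the
  difference vanishes eventually.\<close>

lemma not_tail_negligible_witness:
  assumes f: "order_root_n f" and nt: "\<not> tail_negligible f"
  obtains \<epsilon> N where "0 < \<epsilon>" "subsequence_index N"
    "\<And>i. \<epsilon> < real (N i) * (norm (f (N i) - proj i (f (N i))))\<^sup>2"
    "inconsist N (\<lambda>i. f (N i) - proj i (f (N i)))"
proof -
  obtain c0 C where "0 < c0" "c0 < C" "\<And>n. 1 \<le> n \<Longrightarrow> c0\<^sup>2 \<le> real n * (norm (f n))\<^sup>2"
    and C: "\<And>n. 1 \<le> n \<Longrightarrow> real n * (norm (f n))\<^sup>2 \<le> C\<^sup>2"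
    by (rule order_root_nD[OF f]) (rule that)
  obtain \<epsilon> where \<epsilon>: "0 < \<epsilon>" "\<And>l n0. \<exists>n\<ge>n0. \<epsilon> < real n * (norm (f n - proj l (f n)))\<^sup>2"
    using nt unfolding tail_negligible_def eventually_sequentially by (auto simp: not_le)
  have "\<exists>N. \<forall>i. (1 \<le> N i \<and> \<epsilon> < real (N i) * (norm (f (N i) - proj i (f (N i))))\<^sup>2) \<and> N i < N (Suc i)"
  proof (rule dependent_nat_choice)
    show "\<exists>n. 1 \<le> n \<and> \<epsilon> < real n * (norm (f n - proj 0 (f n)))\<^sup>2"
      using \<epsilon>(2)[of 1 0] by blast
    fix n i :: nat
    show "\<exists>m. (1 \<le> m \<and> \<epsilon> < real m * (norm (f m - proj (Suc i) (f m)))\<^sup>2) \<and> n < m"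
      using \<epsilon>(2)[of "Suc n" "Suc i"] by (metis Suc_le_eq le_trans less_imp_le One_nat_def Suc_le_mono zero_le)
  qed
  then obtain N where N: "\<And>i. 1 \<le> N i" "\<And>i. \<epsilon> < real (N i) * (norm (f (N i) - proj i (f (N i))))\<^sup>2"
    "\<And>i. N i < N (Suc i)"
    by blast
  have sub: "subsequence_index N"
    using N by (simp add: subsequence_index_def strict_mono_Suc_iff)
  have "inconsist N (\<lambda>i. f (N i) - proj i (f (N i)))"
  proof (rule inconsistent_if_head)
    show "\<forall>\<^sub>F i in sequentially. real (N i) * (norm (f (N i) - proj i (f (N i))))\<^sup>2 \<le> C\<^sup>2"
    proof (intro always_eventually allI)
      fix i
      have "real (N i) * (norm (f (N i) - proj i (f (N i))))\<^sup>2 \<le> real (N i) * (norm (f (N i)))\<^sup>2"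
        by (intro mult_left_mono power_mono norm_diff_proj_le) auto
      then show "real (N i) * (norm (f (N i) - proj i (f (N i))))\<^sup>2 \<le> C\<^sup>2"
        using C[OF N(1), of i] by linarith
    qed
    show "(\<lambda>i. real (N i) * (norm (proj l (f (N i) - proj i (f (N i)))))\<^sup>2) \<longlonglongrightarrow> 0" for l
    proof (rule tendsto_eventually)
      have "proj l (g - proj i g) = 0" if "l \<le> i" for i g
        unfolding proj_def[of l "g - _"]
        by (intro sum.neutral ballI) (use that in \<open>auto simp: inner_diff_left proj_coeff\<close>)
      then show "\<forall>\<^sub>F i in sequentially. real (N i) * (norm (proj l (f (N i) - proj i (f (N i)))))\<^sup>2 = 0"
        by (auto simp: eventually_sequentially)
    qed
  qed (use subsequence_index_eventually_ge_1[OF sub] in blast)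
  then show thesis
    using that \<epsilon>(1) sub N(2) by blast
qed

text \<open>Split \<open>f\<^sub>N\<^sub>i\<close> into its projection, whose inner product with \<open>g\<^sub>i\<close> sees only the vanishing
  head of \<open>g\<^sub>i\<close>, and its small tail, and apply the Cauchy-Schwarz inequality to both.\<close>

lemma tail_negligible_inner_inconsistent:
  assumes tail: "tail_negligible f" and f: "order_root_n f" and sub: "subsequence_index N"
    and inc: "inconsist N g" and B: "\<And>i. real (N i) * (norm (g i))\<^sup>2 \<le> B"
  shows "(\<lambda>i. real (N i) * (f (N i) \<bullet> g i)) \<longlonglongrightarrow> 0"
proof (rule tendstoI)
  fix e :: real assume e: "0 < e"
  obtain c0 C where "0 < c0" "c0 < C" "\<And>n. 1 \<le> n \<Longrightarrow> c0\<^sup>2 \<le> real n * (norm (f n))\<^sup>2"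
    and C2: "\<And>n. 1 \<le> n \<Longrightarrow> real n * (norm (f n))\<^sup>2 \<le> C\<^sup>2"
    by (rule order_root_nD[OF f]) (rule that)
  then have C: "0 < C" by linarith
  have N: "\<And>i. 1 \<le> N i" "\<forall>\<^sub>F i in sequentially. 1 \<le> N i"
    using sub by (auto simp: subsequence_index_def)
  define b where "b = sqrt (max B 0) + 1"
  have b: "0 < b"
    by (simp add: b_def add_nonneg_pos)
  obtain l where l: "\<And>n. real n * (norm (f n - proj l (f n)))\<^sup>2 \<le> (e / (2 * b))\<^sup>2"
    using tail_negligible_uniform[OF tail, of "(e / (2 * b))\<^sup>2"] e b by auto
  have "\<forall>\<^sub>F i in sequentially. real (N i) * (norm (proj l (g i)))\<^sup>2 < (e / (2 * C))\<^sup>2"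
    using e C by (intro order_tendstoD(2)[OF inconsistent_imp_head[OF N(2) inc]]) auto
  then show "\<forall>\<^sub>F i in sequentially. dist (real (N i) * (f (N i) \<bullet> g i)) 0 < e"
  proof eventually_elim
    case (elim i)
    define s where "s = sqrt (real (N i))"
    let ?f = "f (N i)"
    have s2: "real (N i) = s * s" and s0: "0 \<le> s"
      by (auto simp: s_def)
    have sq: "s * x \<le> y" if "real (N i) * x\<^sup>2 \<le> y\<^sup>2" "0 \<le> y" for x y
      using that s0 by - (rule power2_le_imp_le, auto simp: power_mult_distrib s_def)
    have sq': "s * x < y" if "real (N i) * x\<^sup>2 < y\<^sup>2" "0 \<le> y" for x y
      using that s0 by - (rule power2_less_imp_less, auto simp: power_mult_distrib s_def)
    have 1: "s * norm ?f \<le> C"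
      using C C2 N by (intro sq) auto
    have 2: "s * norm (proj l (g i)) < e / (2 * C)"
      using elim e C by (intro sq') auto
    have 3: "s * norm (?f - proj l ?f) \<le> e / (2 * b)"
      using l e b by (intro sq) auto
    have 4: "s * norm (g i) < b"
    proof -
      have "s * norm (g i) \<le> sqrt (max B 0)"
        using B[of i] by (intro sq) auto
      then show ?thesis by (simp add: b_def)
    qed
    have "?f \<bullet> g i = proj l ?f \<bullet> g i + (?f - proj l ?f) \<bullet> g i"
      by (simp add: inner_diff_left)
    also have "proj l ?f \<bullet> g i = proj l (g i) \<bullet> ?f"
      using inner_proj[of l ?f "g i"] inner_proj[of l "g i" ?f] by (simp add: inner_commute)
    finally have "\<bar>?f \<bullet> g i\<bar> \<le> norm (proj l (g i)) * norm ?f + norm (?f - proj l ?f) * norm (g i)"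
      using Cauchy_Schwarz_ineq2[of "proj l (g i)" ?f] Cauchy_Schwarz_ineq2[of "?f - proj l ?f" "g i"] by linarith
    then have "\<bar>real (N i) * (?f \<bullet> g i)\<bar> \<le>
        real (N i) * (norm (proj l (g i)) * norm ?f + norm (?f - proj l ?f) * norm (g i))"
      by (simp add: abs_mult mult_left_mono)
    also have "\<dots> = (s * norm (proj l (g i))) * (s * norm ?f) + (s * norm (?f - proj l ?f)) * (s * norm (g i))"
      unfolding s2 by (simp add: algebra_simps)
    also have "\<dots> < e"
    proof -
      have "(s * norm (proj l (g i))) * (s * norm ?f) \<le> (s * norm (proj l (g i))) * C"
        using 1 s0 by (intro mult_left_mono) auto
      also have "\<dots> < e / (2 * C) * C"
        using 2 C by (intro mult_strict_right_mono)
      also have "\<dots> = e / 2"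
        using C by simp
      finally have "(s * norm (proj l (g i))) * (s * norm ?f) < e / 2" .
      moreover have "(s * norm (?f - proj l ?f)) * (s * norm (g i)) \<le> e / (2 * b) * b"
        using 3 4 s0 e b by (intro mult_mono) auto
      moreover have "e / (2 * b) * b = e / 2"
        using b by simp
      ultimately show ?thesis
        by linarith
    qed
    finally show ?case
      by simp
  qed
qed

section \<open>Consistent and inconsistent sequences\<close>

lemma id_eventually: "\<forall>\<^sub>F i in sequentially. 1 \<le> id i"
  by (auto simp: eventually_sequentially)

lemma order_root_n_eventually_bounded:
  assumes "order_root_n f"
  obtains B where "0 < B" "\<And>n. 1 \<le> n \<Longrightarrow> real n * (norm (f n))\<^sup>2 \<le> B"
    "\<forall>\<^sub>F i in sequentially. real (id i) * (norm (f i))\<^sup>2 \<le> B"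
proof -
  obtain c C where c: "0 < c" "c < C" "\<And>n. 1 \<le> n \<Longrightarrow> c\<^sup>2 \<le> real n * (norm (f n))\<^sup>2"
    and C: "\<And>n. 1 \<le> n \<Longrightarrow> real n * (norm (f n))\<^sup>2 \<le> C\<^sup>2"
    by (rule order_root_nD[OF assms]) (rule that)
  show thesis
    by (rule that[of "C\<^sup>2"]) (use C c in \<open>auto simp: eventually_sequentially\<close>)
qed

lemma consistent_iff_sum_head:
  assumes f: "order_root_n f"
  shows "consist id f \<longleftrightarrow>
    (\<exists>c1 c2 :: real. \<exists>n0 :: nat. c1 > 0 \<and> c2 > 0 \<and>
       (\<forall>n>n0. (\<Sum>j | 1 \<le> j \<and> real j < c2. (f n \<bullet> \<phi> j)\<^sup>2) > c1 * (1 / real n)))" (is "_ \<longleftrightarrow> ?R")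
proof
  obtain B where B: "0 < B" "\<And>n. 1 \<le> n \<Longrightarrow> real n * (norm (f n))\<^sup>2 \<le> B"
    "\<forall>\<^sub>F i in sequentially. real (id i) * (norm (f i))\<^sup>2 \<le> B"
    by (rule order_root_n_eventually_bounded[OF f]) (rule that)
  assume cons: "consist id f"
  obtain l c where lc: "1 \<le> l" "0 < c" "\<forall>\<^sub>F i in sequentially. c \<le> real (id i) * (norm (proj l (f i)))\<^sup>2"
    by (rule consistent_imp_head[OF id_eventually B(3) cons]) (rule that)
  then obtain n0 where n0: "\<And>n. n0 \<le> n \<Longrightarrow> c \<le> real n * (norm (proj l (f n)))\<^sup>2"
    by (auto simp: eventually_sequentially)
  show ?R
  proof (intro exI conjI allI impI)
    show "c / 2 > 0" "real l + 1 > 0"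
      using lc by auto
    fix n assume "n0 < n"
    have l: "nat (\<lceil>real l + 1\<rceil> - 1) = l"
      by simp
    have "c / 2 < real n * (norm (proj l (f n)))\<^sup>2"
      using n0[of n] \<open>n0 < n\<close> lc(2) by linarith
    then show "c / 2 * (1 / real n) < (\<Sum>j | 1 \<le> j \<and> real j < real l + 1. (f n \<bullet> \<phi> j)\<^sup>2)"
      unfolding sum_head_coeff l using \<open>n0 < n\<close> by (simp add: field_simps)
  qed
next
  assume ?R
  then obtain c1 c2 :: real and n0 where c: "0 < c1"
    "\<And>n. n0 < n \<Longrightarrow> (\<Sum>j | 1 \<le> j \<and> real j < c2. (f n \<bullet> \<phi> j)\<^sup>2) > c1 * (1 / real n)"
    by blast
  define l where "l = nat (\<lceil>c2\<rceil> - 1)"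
  have "c1 \<le> real n * (norm (proj l (f n)))\<^sup>2" if "n0 < n" for n
    using c(2)[OF that] that unfolding sum_head_coeff l_def[symmetric] by (simp add: field_simps)
  then show "consist id f"
    by (intro consistent_if_head[where l = l, OF id_eventually c(1)]) (auto simp: eventually_sequentially intro!: exI[of _ "Suc n0"])
qed

lemma inconsistent_iff_sum_head:
  assumes f: "order_root_n f"
  shows "inconsist id f \<longleftrightarrow>
    (\<forall>c2 :: real. c2 > 0 \<longrightarrow> (\<lambda>n. \<Sum>j | 1 \<le> j \<and> real j < c2. (f n \<bullet> \<phi> j)\<^sup>2) \<in> o(\<lambda>n. 1 / real n))"
proof -
  have iff: "(\<lambda>n. \<Sum>j | 1 \<le> j \<and> real j < c2. (f n \<bullet> \<phi> j)\<^sup>2) \<in> o(\<lambda>n. 1 / real n) \<longleftrightarrow>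
     (\<lambda>n. real (id n) * (norm (proj (nat (\<lceil>c2\<rceil> - 1)) (f n)))\<^sup>2) \<longlonglongrightarrow> 0" for c2 :: real
    using smallo_inverse_iff[OF id_eventually] unfolding sum_head_coeff by simp
  show ?thesis
    unfolding iff
  proof
    assume "inconsist id f"
    then show "\<forall>c2 :: real. c2 > 0 \<longrightarrow> (\<lambda>n. real (id n) * (norm (proj (nat (\<lceil>c2\<rceil> - 1)) (f n)))\<^sup>2) \<longlonglongrightarrow> 0"
      using inconsistent_imp_head[OF id_eventually] by blast
  next
    assume *: "\<forall>c2 :: real. c2 > 0 \<longrightarrow> (\<lambda>n. real (id n) * (norm (proj (nat (\<lceil>c2\<rceil> - 1)) (f n)))\<^sup>2) \<longlonglongrightarrow> 0"
    have "(\<lambda>n. real (id n) * (norm (proj l (f n)))\<^sup>2) \<longlonglongrightarrow> 0" for l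
      using *[rule_format, of "real l + 1"] by (simp add: add_nonneg_pos)
    moreover obtain B where "0 < B" "\<And>n. 1 \<le> n \<Longrightarrow> real n * (norm (f n))\<^sup>2 \<le> B"
      "\<forall>\<^sub>F i in sequentially. real (id i) * (norm (f i))\<^sup>2 \<le> B"
      by (rule order_root_n_eventually_bounded[OF f]) (rule that)
    ultimately show "inconsist id f"
      by (intro inconsistent_if_head[OF id_eventually])
  qed
qed

lemma U_set_sequences_consistent:
  assumes sub: "subsequence_index N" and f: "order_root_n_along N f"
    and U: "\<And>i. f i \<in> (\<lambda>u. \<gamma> *\<^sub>R u) ` U_set \<phi> l P0"
  shows "consist N f"
proof -
  obtain c where c: "0 < c" "\<And>i. c * real (N i) powr (-1/2) < norm (f i)"
    using f unfolding order_root_n_along_def by blast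
  have "c\<^sup>2 \<le> real (N i) * (norm (proj l (f i)))\<^sup>2" for i
  proof -
    from U[of i] obtain u where "f i = \<gamma> *\<^sub>R u" "u \<in> U_set \<phi> l P0"
      by (rule imageE)
    then have "proj l (f i) = f i"
      by (simp add: proj_scaleR U_set_iff)
    then show ?thesis
      using root_n_bounds(3)[of "N i" c "norm (f i)"] c sub by (simp add: subsequence_index_def)
  qed
  then show ?thesis
    using c(1) by (intro consistent_if_head[where c = "c\<^sup>2" and l = l] subsequence_index_eventually_ge_1[OF sub]) auto
qed

lemma coefficients_zero_imp_zero:
  assumes "\<And>j. 1 \<le> j \<Longrightarrow> f \<bullet> \<phi> j = 0"
  shows "f = 0"
proof -
  have "(\<lambda>_. 0 :: real) sums (norm f)\<^sup>2"
    using parseval[of f] assms by simp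
  then show ?thesis
    by (simp add: sums_iff)
qed

lemma not_Xi_infinite_coefficients:
  assumes "f \<notin> Xi_space \<phi>"
  shows "infinite {j. 1 \<le> j \<and> f \<bullet> \<phi> j \<noteq> 0}"
proof
  assume fin: "finite {j. 1 \<le> j \<and> f \<bullet> \<phi> j \<noteq> 0}"
  define l where "l = Suc (Max (insert 0 {j. 1 \<le> j \<and> f \<bullet> \<phi> j \<noteq> 0}))"
  have "f \<bullet> \<phi> j = 0" if "l < j" for j
  proof (rule ccontr)
    assume "f \<bullet> \<phi> j \<noteq> 0"
    then have "j \<le> Max (insert 0 {j. 1 \<le> j \<and> f \<bullet> \<phi> j \<noteq> 0})"
      using that fin by (intro Max_ge) auto
    then show False
      using that by (simp add: l_def)
  qed
  then have "f - proj l f = 0"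
    by (intro coefficients_zero_imp_zero) (auto simp: inner_diff_left proj_coeff)
  then have "f \<in> U_set \<phi> l (norm f + 1)"
    by (simp add: U_set_iff)
  then show False
    using assms unfolding Xi_space_def by (auto simp: l_def intro!: bexI[of _ "norm f + 1"] simp: add_nonneg_pos)
qed

text \<open>The average of \<open>f\<close> and of the function with all coefficients of \<open>f\<close> except the one at
  \<open>m\<close> negated is \<open>(f \<bullet> \<phi> m) \<phi> m\<close>.  Flipping its sign gives the other endpoint of the segment.\<close>

lemma ortho_symmetric_contains_coordinate_segment:
  assumes V: "convex V" "ortho_symmetric \<phi> V" and f: "f \<in> V" and m: "1 \<le> m"
    and t: "\<bar>t\<bar> \<le> \<bar>f \<bullet> \<phi> m\<bar>"
  shows "t *\<^sub>R \<phi> m \<in> V"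
proof -
  define \<theta> where "\<theta> = f \<bullet> \<phi> m"
  have flip: "g \<in> V" if "h \<in> V" "\<And>j. 1 \<le> j \<Longrightarrow> g \<bullet> \<phi> j = h \<bullet> \<phi> j \<or> g \<bullet> \<phi> j = - (h \<bullet> \<phi> j)" for g h
    using V(2) that unfolding ortho_symmetric_def by blast
  have mid: "(1 - u) *\<^sub>R x + u *\<^sub>R y \<in> V" if "x \<in> V" "y \<in> V" "0 \<le> u" "u \<le> 1" for x y u
    using V(1) that by (simp add: convex_alt)
  have "(2 * \<theta>) *\<^sub>R \<phi> m - f \<in> V"
    using m by (intro flip[OF f]) (auto simp: inner_diff_left orthonormal \<theta>_def)
  from mid[OF f this, of "1 / 2"] have pos: "\<theta> *\<^sub>R \<phi> m \<in> V"
    by (simp add: algebra_simps flip: scaleR_add_left)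
  have neg: "(- \<theta>) *\<^sub>R \<phi> m \<in> V"
    by (rule flip[OF pos]) simp
  show ?thesis
  proof (cases "\<theta> = 0")
    case True
    then show ?thesis
      using pos t by (simp add: \<theta>_def)
  next
    case False
    define u where "u = (1 - t / \<theta>) / 2"
    have "\<bar>t / \<theta>\<bar> \<le> 1"
      using t False by (simp add: \<theta>_def abs_divide divide_le_eq_1)
    then have "t / \<theta> \<le> 1" "- 1 \<le> t / \<theta>"
      by linarith+
    then have u: "0 \<le> u" "u \<le> 1"
      by (simp_all add: u_def)
    have "(1 - u) *\<^sub>R (\<theta> *\<^sub>R \<phi> m) + u *\<^sub>R ((- \<theta>) *\<^sub>R \<phi> m) = ((1 - 2 * u) * \<theta>) *\<^sub>R \<phi> m"
      by (simp add: algebra_simps flip: scaleR_add_left scaleR_diff_left)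
    also have "(1 - 2 * u) * \<theta> = t"
      using False by (simp add: u_def field_simps)
    finally show ?thesis
      using mid[OF pos neg u] by simp
  qed
qed

text \<open>A function outside the space has infinitely many non-zero coefficients, so the set contains
  segments along coordinates arbitrarily far out.  Vectors of length exactly \<open>n\<^sup>-\<^sup>1\<^sup>/\<^sup>2\<close> on these
  segments leave every finite-dimensional head.\<close>

lemma maximality_of_Xi:
  assumes fX: "f \<notin> Xi_space \<phi>" and V: "convex V" "ortho_symmetric \<phi> V" and f: "f \<in> V"
  shows "\<exists>N g. subsequence_index N \<and> order_root_n_along N g \<and> (\<forall>i. g i \<in> V) \<and>
               inconsist N g"
proof -
  define S where "S = {j. 1 \<le> j \<and> f \<bullet> \<phi> j \<noteq> 0}"
  have S: "infinite S"
    unfolding S_def by (rule not_Xi_infinite_coefficients[OF fX])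
  \<comment> \<open>The successor ensures \<open>i < m i\<close>, so that the projection with index \<open>i\<close> kills \<open>\<phi> (m i)\<close>.\<close>
  define m where "m i = enumerate S (Suc i)" for i
  have m: "m i \<in> S" "i < m i" for i
    using enumerate_in_set[OF S, of "Suc i"] le_enumerate[OF S, of "Suc i"] by (auto simp: m_def)
  define \<theta> where "\<theta> i = f \<bullet> \<phi> (m i)" for i
  have \<theta>: "\<theta> i \<noteq> 0" "1 \<le> m i" for i
    using m(1)[of i] by (auto simp: S_def \<theta>_def)
  \<comment> \<open>Strictly increasing, and so large that a vector of length \<open>N i powr (-1/2)\<close> fits into the
    segment of half-length \<open>\<bar>\<theta> i\<bar>\<close>.\<close>
  define N where "N i = (\<Sum>k\<le>i. nat \<lceil>1 / (\<theta> k)\<^sup>2\<rceil> + 1)" for i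
  have N1: "1 \<le> N i" for i
  proof -
    have "0 < N i"
      unfolding N_def by (intro sum_pos) auto
    then show ?thesis by simp
  qed
  have sub: "subsequence_index N"
    using N1 by (auto simp: subsequence_index_def strict_mono_Suc_iff N_def)
  have N\<theta>: "1 \<le> real (N i) * (\<theta> i)\<^sup>2" for i
  proof -
    have "nat \<lceil>1 / (\<theta> i)\<^sup>2\<rceil> + 1 \<le> N i"
      unfolding N_def by (intro member_le_sum) auto
    then have "1 / (\<theta> i)\<^sup>2 \<le> real (N i)"
      by linarith
    then show ?thesis
      using \<theta>(1)[of i] by (simp add: field_simps)
  qed
  define g where "g i = real (N i) powr (-1/2) *\<^sub>R \<phi> (m i)" for i
  have norm_g: "norm (g i) = real (N i) powr (-1/2)" for i
    using orthonormal[OF \<theta>(2) \<theta>(2), of i i] by (simp add: g_def norm_eq_sqrt_inner)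
  have pos: "0 < real (N i) powr (-1/2)" for i
    using N1[of i] by simp
  have "g i \<in> V" for i
    unfolding g_def
  proof (rule ortho_symmetric_contains_coordinate_segment[OF V f \<theta>(2)])
    show "\<bar>real (N i) powr (-1/2)\<bar> \<le> \<bar>f \<bullet> \<phi> (m i)\<bar>"
      using root_n_bounds(1)[OF N1, of 1 "\<bar>\<theta> i\<bar>" i] N\<theta>[of i] by (simp add: \<theta>_def)
  qed
  moreover have "order_root_n_along N g"
    unfolding order_root_n_along_def norm_g using pos by (intro exI[of _ "1/2"] exI[of _ 2]) auto
  moreover have "inconsist N g"
  proof (rule inconsistent_if_head)
    show "\<forall>\<^sub>F i in sequentially. 1 \<le> N i"
      using N1 by simp
    have "real (N i) * (norm (g i))\<^sup>2 \<le> 1" for i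
      using root_n_bounds(2)[OF N1, of 1 "norm (g i)" i] by (simp add: norm_g)
    then show "\<forall>\<^sub>F i in sequentially. real (N i) * (norm (g i))\<^sup>2 \<le> 1"
      by simp
    show "(\<lambda>i. real (N i) * (norm (proj l (g i)))\<^sup>2) \<longlonglongrightarrow> 0" for l
    proof (rule tendsto_eventually)
      have "proj l (g i) = 0" if "l \<le> i" for i
        unfolding proj_def g_def using that m(2)[of i] \<theta>(2)[of i]
        by (intro sum.neutral) (auto simp: orthonormal)
      then show "\<forall>\<^sub>F i in sequentially. real (N i) * (norm (proj l (g i)))\<^sup>2 = 0"
        by (auto simp: eventually_sequentially)
    qed
  qed
  ultimately show ?thesis
    using sub by blast
qed

text \<open>An orthogonal component in the span of the first \<open>l\<close> basis functions is not longer than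
  the projection on this span.\<close>

lemma consistent_if_U_set_component:
  assumes c1: "0 < c1"
    and f1: "\<And>n. 1 \<le> n \<Longrightarrow> f1 n \<in> U_set \<phi> l P0 \<and> c1 * real n powr (-1/2) \<le> norm (f1 n) \<and> f1 n \<bullet> (f n - f1 n) = 0"
  shows "consist id f"
proof (rule consistent_if_head[OF id_eventually])
  show "0 < c1\<^sup>2"
    using c1 by simp
  have "c1\<^sup>2 \<le> real n * (norm (proj l (f n)))\<^sup>2" if n: "1 \<le> n" for n
  proof -
    have "norm (f1 n) \<le> norm (proj l (f n))"
      using f1[OF n] by (intro norm_le_norm_proj) (auto simp: U_set_iff)
    then have "c1 * real n powr (-1/2) \<le> norm (proj l (f n))"
      using f1[OF n] by linarith
    then show ?thesis
      using root_n_bounds(1)[OF n] c1 by simp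
  qed
  then show "\<forall>\<^sub>F i in sequentially. c1\<^sup>2 \<le> real (id i) * (norm (proj l (f i)))\<^sup>2"
    by (auto simp: eventually_sequentially)
qed

lemma consistent_add_orthogonal:
  assumes "0 < c1 \<and> c1 < C1 \<and>
    (\<forall>n\<ge>1. f1 n \<in> U_set \<phi> l P0 \<and> f2 n \<bullet> f1 n = 0 \<and>
       c1 * real n powr (-1/2) \<le> norm (f1 n) \<and> norm (f1 n) \<le> C1 * real n powr (-1/2) \<and>
       c1 * real n powr (-1/2) \<le> norm (f2 n) \<and> norm (f2 n) \<le> C1 * real n powr (-1/2))"
  shows "consist id (\<lambda>n. f1 n + f2 n)"
  using assms
  by (intro consistent_if_U_set_component[of c1 f1 l P0]) (auto simp: inner_commute)

text \<open>All projections with large index can serve as the component \<open>f\<^sub>1\<^sub>n\<close>, with the same constants.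
  This freedom is used where the index has to be large for a second reason.\<close>

lemma consistent_proj_component:
  assumes f: "order_root_n f" and cons: "consist id f"
  obtains l P0 c1 C1 where "1 \<le> l" "0 < P0" "0 < c1" "c1 < C1"
    "\<And>m n. l \<le> m \<Longrightarrow> 1 \<le> n \<Longrightarrow> proj m (f n) \<in> U_set \<phi> m P0 \<and>
        c1 * real n powr (-1/2) \<le> norm (proj m (f n)) \<and> norm (proj m (f n)) \<le> C1 * real n powr (-1/2)"
proof -
  obtain c0 C where C0: "0 < c0" "c0 < C" "\<And>n. 1 \<le> n \<Longrightarrow> c0\<^sup>2 \<le> real n * (norm (f n))\<^sup>2"
    and C: "\<And>n. 1 \<le> n \<Longrightarrow> real n * (norm (f n))\<^sup>2 \<le> C\<^sup>2"
    by (rule order_root_nD[OF f]) (rule that)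
  obtain l c where lc: "1 \<le> l" "0 < c" "\<And>m n. l \<le> m \<Longrightarrow> 1 \<le> n \<Longrightarrow> c \<le> real n * (norm (proj m (f n)))\<^sup>2"
    by (rule consistent_uniform_head[OF f cons]) (rule that)
  show thesis
  proof (rule that[of l C "min (sqrt c) (C / 2)" C])
    show "1 \<le> l" "0 < C" "0 < min (sqrt c) (C / 2)" "min (sqrt c) (C / 2) < C"
      using lc C0 by auto
    fix m n :: nat assume m: "l \<le> m" and n: "1 \<le> n"
    have le: "norm (proj m (f n)) \<le> C * real n powr (-1/2)"
    proof -
      have "norm (f n) \<le> C * real n powr (-1/2)"
        using root_n_bounds(2)[OF n, of C "norm (f n)"] C[OF n] C0 by simp
      then show ?thesis
        using norm_proj_le[of m "f n"] by linarith
    qed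
    have "real n powr (-1/2) \<le> real n powr 0"
      using n by (intro powr_mono) auto
    then have "C * real n powr (-1/2) \<le> C * 1"
      using C0 n by (intro mult_left_mono) auto
    then have "proj m (f n) \<in> U_set \<phi> m C"
      using le by (simp add: U_set_iff proj_proj)
    moreover have "sqrt c * real n powr (-1/2) \<le> norm (proj m (f n))"
      using root_n_bounds(1)[OF n, of "sqrt c" "norm (proj m (f n))"] lc(3)[OF m n] lc(2) by simp
    then have "min (sqrt c) (C / 2) * real n powr (-1/2) \<le> norm (proj m (f n))"
      by (rule order_trans[rotated]) (intro mult_right_mono, auto)
    ultimately show "proj m (f n) \<in> U_set \<phi> m C \<and>
        min (sqrt c) (C / 2) * real n powr (-1/2) \<le> norm (proj m (f n)) \<and> norm (proj m (f n)) \<le> C * real n powr (-1/2)"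
      using le by blast
  qed
qed

lemma consistent_iff_U_set_component:
  assumes f: "order_root_n f"
  shows "consist id f \<longleftrightarrow>
    (\<exists>l\<ge>1. \<exists>P0>0. \<exists>c1 C1 f1. 0 < c1 \<and> c1 < C1 \<and>
       (\<forall>n\<ge>1. f1 n \<in> U_set \<phi> l P0 \<and>
          c1 * real n powr (-1/2) \<le> norm (f1 n) \<and> norm (f1 n) \<le> C1 * real n powr (-1/2) \<and>
          (norm (f n))\<^sup>2 = (norm (f1 n))\<^sup>2 + (norm (f n - f1 n))\<^sup>2))" (is "_ \<longleftrightarrow> ?R")
proof
  assume "consist id f"
  then obtain l P0 c1 C1 where l: "1 \<le> l" "0 < P0" "0 < c1" "c1 < C1"
    "\<And>m n. l \<le> m \<Longrightarrow> 1 \<le> n \<Longrightarrow> proj m (f n) \<in> U_set \<phi> m P0 \<and>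
        c1 * real n powr (-1/2) \<le> norm (proj m (f n)) \<and> norm (proj m (f n)) \<le> C1 * real n powr (-1/2)"
    by (rule consistent_proj_component[OF f]) (rule that)
  show ?R
  proof (rule exI[of _ l], rule conjI[OF l(1)], rule exI[of _ P0], rule conjI[OF l(2)], rule exI[of _ c1],
      rule exI[of _ C1], rule exI[of _ "\<lambda>n. proj l (f n)"], intro conjI l(3,4) allI impI)
    fix n :: nat assume n: "1 \<le> n"
    show "proj l (f n) \<in> U_set \<phi> l P0" "c1 * real n powr (-1/2) \<le> norm (proj l (f n))"
      "norm (proj l (f n)) \<le> C1 * real n powr (-1/2)"
      using l(5)[OF order_refl n] by auto
    show "(norm (f n))\<^sup>2 = (norm (proj l (f n)))\<^sup>2 + (norm (f n - proj l (f n)))\<^sup>2"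
      by (rule norm_split_proj)
  qed
next
  assume ?R
  then obtain l P0 c1 f1 where "0 < c1"
    "\<And>n. 1 \<le> n \<Longrightarrow> f1 n \<in> U_set \<phi> l P0 \<and> c1 * real n powr (-1/2) \<le> norm (f1 n) \<and>
       (norm (f n))\<^sup>2 = (norm (f1 n))\<^sup>2 + (norm (f n - f1 n))\<^sup>2"
    by blast
  then show "consist id f"
    by (intro consistent_if_U_set_component[of c1 f1 l P0]) (simp_all add: inner_diff_iff_pythagoras)
qed

text \<open>For large \<open>l\<close> the weighted energy of the tail is below any given \<open>\<delta>\<close>, uniformly in \<open>n\<close>.  The
  index must not depend on the level \<open>\<alpha>\<close>, hence the version of uniform continuity without a bound on
  the threshold.\<close>

lemma type_II_error_determined_by_U_set_component:
  assumes f: "order_root_n f" and cons: "consist id f" and \<epsilon>: "0 < \<epsilon>"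
  shows "\<exists>l\<ge>1. \<exists>P0>0. \<exists>c1 C1 f1. 0 < c1 \<and> c1 < C1 \<and>
     (\<forall>n\<ge>1. f1 n \<in> U_set \<phi> l P0 \<and>
        c1 * real n powr (-1/2) \<le> norm (f1 n) \<and> norm (f1 n) \<le> C1 * real n powr (-1/2) \<and>
        f1 n \<bullet> (f n - f1 n) = 0) \<and>
     (\<forall>\<alpha>\<in>{0<..<1}. \<forall>K. level_tests id \<alpha> K \<longrightarrow>
        (\<exists>n\<^sub>\<epsilon>. \<forall>n>n\<^sub>\<epsilon>.
           \<bar>err2 n (K n) (f n) - err2 n (K n) (f1 n)\<bar> \<le> \<epsilon> \<and>
           err2 n (K n) (f n - f1 n) \<ge> 1 - \<alpha> - \<epsilon>))"
proof -
  obtain B where B: "0 < B" "\<And>n. 1 \<le> n \<Longrightarrow> real n * (norm (f n))\<^sup>2 \<le> B"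
    "\<forall>\<^sub>F i in sequentially. real (id i) * (norm (f i))\<^sup>2 \<le> B"
    by (rule order_root_n_eventually_bounded[OF f]) (rule that)
  obtain l0 P0 c1 C1 where l0: "1 \<le> l0" "0 < P0" "0 < c1" "c1 < C1"
    "\<And>m n. l0 \<le> m \<Longrightarrow> 1 \<le> n \<Longrightarrow> proj m (f n) \<in> U_set \<phi> m P0 \<and>
        c1 * real n powr (-1/2) \<le> norm (proj m (f n)) \<and> norm (proj m (f n)) \<le> C1 * real n powr (-1/2)"
    by (rule consistent_proj_component[OF f cons]) (rule that)
  obtain \<delta> where \<delta>: "0 < \<delta>" "\<And>a b x. square_summable a \<Longrightarrow> square_summable b \<Longrightarrow>
      (\<Sum>j. (a j)\<^sup>2) \<le> (\<kappa> (Suc 0))\<^sup>2 * B \<Longrightarrow> (\<Sum>j. (b j)\<^sup>2) \<le> \<delta> \<Longrightarrow>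
      \<bar>energy_cdf (\<lambda>j. a j + b j) \<tau> x - energy_cdf a \<tau> x\<bar> \<le> \<epsilon> / 2"
    by (rule energy_cdf_uniformly_continuous_bounded[OF tau_square_summable tau_pos[of 0], of "\<epsilon> / 2" "(\<kappa> (Suc 0))\<^sup>2 * B"])
       (use \<epsilon> in simp, rule that)
  obtain l1 where l1: "1 \<le> l1" "\<And>m. l1 \<le> m \<Longrightarrow> (\<kappa> (Suc m))\<^sup>2 * B \<le> \<delta>"
    by (rule kappa_eventually_small[OF \<delta>(1)]) (rule that)
  define l where "l = max l0 l1"
  define f1 f2 where "f1 n = proj l (f n)" and "f2 n = f n - f1 n" for n
  have E1: "real n * weighted_energy (f1 n) \<le> (\<kappa> (Suc 0))\<^sup>2 * B" if n: "1 \<le> n" for n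
  proof -
    have "weighted_energy (f1 n) \<le> (\<kappa> (Suc 0))\<^sup>2 * (norm (f n))\<^sup>2"
      using weighted_energy_le_norm[of "f1 n"] norm_proj_le[of l "f n"]
      by (elim order_trans) (auto simp: f1_def intro!: mult_left_mono power_mono)
    then have "real n * weighted_energy (f1 n) \<le> real n * ((\<kappa> (Suc 0))\<^sup>2 * (norm (f n))\<^sup>2)"
      by (intro mult_left_mono) auto
    also have "\<dots> = (\<kappa> (Suc 0))\<^sup>2 * (real n * (norm (f n))\<^sup>2)"
      by simp
    also have "\<dots> \<le> (\<kappa> (Suc 0))\<^sup>2 * B"
      using B(2)[OF n] by (intro mult_left_mono) auto
    finally show ?thesis .
  qed
  have E2: "real n * weighted_energy (f2 n) \<le> \<delta>" if n: "1 \<le> n" for n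
  proof -
    have "real n * (norm (f2 n))\<^sup>2 \<le> real n * (norm (f n))\<^sup>2"
      unfolding f2_def f1_def by (intro mult_left_mono power_mono norm_diff_proj_le) auto
    then have "real n * (norm (f2 n))\<^sup>2 \<le> B"
      using B(2)[OF n] by linarith
    from scaled_weighted_energy_le[OF this, of l]
    have "real n * weighted_energy (f2 n) \<le> (\<kappa> (Suc l))\<^sup>2 * B"
      by (simp add: f2_def f1_def proj_diff proj_proj)
    then show ?thesis
      using l1(2)[of l] by (simp add: l_def)
  qed
  have "\<exists>n\<^sub>\<epsilon>. \<forall>n>n\<^sub>\<epsilon>.
           \<bar>err2 n (K n) (f n) - err2 n (K n) (f1 n)\<bar> \<le> \<epsilon> \<and>
           err2 n (K n) (f2 n) \<ge> 1 - \<alpha> - \<epsilon>"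
    if K: "level_tests id \<alpha> K" for \<alpha> K
  proof -
    obtain x where x: "\<And>i. 1 \<le> i \<Longrightarrow> err1 i (K i) = 1 - energy_cdf (\<lambda>_. 0) \<tau> (x i)"
      "\<And>i f. 1 \<le> i \<Longrightarrow> err2 i (K i) f = energy_cdf (signal i f) \<tau> (x i)"
      using generated_tests_thresholds[of K id] K by (auto simp: tests_of_level_def)
    have "\<forall>\<^sub>F i in sequentially. err1 (id i) (K i) < \<alpha> + \<epsilon> / 2"
      using \<epsilon> by (intro order_tendstoD(2)[OF levels_tendsto[OF K]]) simp
    then obtain n0 where n0: "\<And>n. n0 \<le> n \<Longrightarrow> err1 n (K n) < \<alpha> + \<epsilon> / 2"
      by (auto simp: eventually_sequentially)
    show ?thesis
    proof (intro exI[of _ n0] allI impI conjI)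
      fix n assume "n0 < n"
      then have n: "1 \<le> n" "n0 \<le> n"
        by auto
      have "f n = f1 n + f2 n"
        by (simp add: f2_def)
      then have "\<bar>err2 n (K n) (f n) - err2 n (K n) (f1 n)\<bar> \<le> \<epsilon> / 2"
        using \<delta>(2)[OF signal_square_summable signal_square_summable, of n "f1 n" n "f2 n" "x n"] E1[OF n(1)] E2[OF n(1)]
        by (simp add: x(2)[OF n(1)] signal_add signal_energy)
      then show "\<bar>err2 n (K n) (f n) - err2 n (K n) (f1 n)\<bar> \<le> \<epsilon>"
        using \<epsilon> by simp
      have "\<bar>energy_cdf (\<lambda>j. 0 + signal n (f2 n) j) \<tau> (x n) - energy_cdf (\<lambda>_. 0) \<tau> (x n)\<bar> \<le> \<epsilon> / 2"
        using E2[OF n(1)] B(1) by (intro \<delta>(2)) (auto simp: signal_square_summable signal_energy)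
      then have "\<bar>energy_cdf (signal n (f2 n)) \<tau> (x n) - energy_cdf (\<lambda>_. 0) \<tau> (x n)\<bar> \<le> \<epsilon> / 2"
        by simp
      then show "1 - \<alpha> - \<epsilon> \<le> err2 n (K n) (f2 n)"
        using n0[OF n(2)] unfolding x[OF n(1)] by linarith
    qed
  qed
  note tests = this
  have l: "1 \<le> l" "l0 \<le> l"
    using l0(1) by (auto simp: l_def)
  show ?thesis
  proof (rule exI[of _ l], rule conjI[OF l(1)], rule exI[of _ P0], rule conjI[OF l0(2)], rule exI[of _ c1],
      rule exI[of _ C1], rule exI[of _ f1], intro conjI l0(3,4) allI impI ballI)
    fix n :: nat assume n: "1 \<le> n"
    show "f1 n \<in> U_set \<phi> l P0" "c1 * real n powr (-1/2) \<le> norm (f1 n)" "norm (f1 n) \<le> C1 * real n powr (-1/2)"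
      using l0(5)[OF l(2) n] by (auto simp: f1_def)
    show "f1 n \<bullet> (f n - f1 n) = 0"
      by (simp add: f1_def proj_inner_diff)
  qed (use tests in \<open>simp add: f2_def\<close>)
qed

text \<open>The signals may be arbitrarily large, but tests of a fixed level have bounded thresholds, hence
  the version of uniform continuity with a bound on the threshold.\<close>

lemma type_II_error_add_inconsistent:
  assumes inc: "inconsist id f1" and \<alpha>: "\<alpha> \<in> {0<..<1}"
    and K: "level_tests id \<alpha> K"
  shows "(\<lambda>n. err2 n (K n) (f n) - err2 n (K n) (f n + f1 n)) \<longlonglongrightarrow> 0"
proof (rule tendstoI)
  fix e :: real assume e: "0 < e"
  let ?F = "energy_cdf (\<lambda>_. 0) \<tau>"
  obtain x where x: "\<And>i. 1 \<le> i \<Longrightarrow> err1 i (K i) = 1 - ?F (x i)"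
    "\<And>i f. 1 \<le> i \<Longrightarrow> err2 i (K i) f = energy_cdf (signal i f) \<tau> (x i)"
    using generated_tests_thresholds[of K id] K by (auto simp: tests_of_level_def)
  obtain X where X: "?F X = 1 - \<alpha> / 2"
    using null_quantile_exists[of "1 - \<alpha> / 2"] \<alpha> by auto
  obtain \<delta> where \<delta>: "0 < \<delta>" "\<And>a b x. square_summable a \<Longrightarrow> square_summable b \<Longrightarrow> (\<Sum>j. (b j)\<^sup>2) \<le> \<delta> \<Longrightarrow> x \<le> X \<Longrightarrow>
      \<bar>energy_cdf (\<lambda>j. a j + b j) \<tau> x - energy_cdf a \<tau> x\<bar> \<le> e / 2"
    by (rule energy_cdf_uniformly_continuous[OF tau_square_summable tau_pos[of 0], of "e / 2" X])
       (use e in simp, rule that)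
  have "\<forall>\<^sub>F n in sequentially. \<alpha> / 2 < err1 (id n) (K n)"
    using \<alpha> by (intro order_tendstoD(1)[OF levels_tendsto[OF K]]) auto
  moreover have "\<forall>\<^sub>F n in sequentially. real (id n) * weighted_energy (f1 n) < \<delta>"
    using inc \<delta>(1) unfolding inconsistent_iff_weighted_energy[OF id_eventually] by (rule order_tendstoD(2))
  ultimately show "\<forall>\<^sub>F n in sequentially. dist (err2 n (K n) (f n) - err2 n (K n) (f n + f1 n)) 0 < e"
    using id_eventually
  proof eventually_elim
    case (elim n)
    then have n: "1 \<le> n" by simp
    have "x n \<le> X"
    proof (rule ccontr)
      assume "\<not> ?thesis"
      then have "?F X \<le> ?F (x n)"
        by (intro energy_cdf_mono) simp
      then show False
        using elim x(1)[OF n] X by simp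
    qed
    then have "\<bar>err2 n (K n) (f n + f1 n) - err2 n (K n) (f n)\<bar> \<le> e / 2"
      unfolding x(2)[OF n] signal_add using elim by (intro \<delta>(2) signal_square_summable) (simp_all add: signal_energy)
    then show ?case
      using e by (simp add: dist_real_def abs_minus_commute)
  qed
qed

section \<open>Purely consistent sequences\<close>

text \<open>If the tail carries at most half of the lower bound of \<open>n \<parallel>f\<^sub>n\<parallel>\<^sup>2\<close>, the head carries the
  other half.\<close>

lemma tail_negligible_imp_consistent:
  assumes f: "order_root_n f" and tail: "tail_negligible f"
  shows "consist id f"
proof -
  obtain c C where c: "0 < c" "c < C" "\<And>n. 1 \<le> n \<Longrightarrow> c\<^sup>2 \<le> real n * (norm (f n))\<^sup>2"
    and C: "\<And>n. 1 \<le> n \<Longrightarrow> real n * (norm (f n))\<^sup>2 \<le> C\<^sup>2"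
    by (rule order_root_nD[OF f]) (rule that)
  have c2: "0 < c\<^sup>2 / 2"
    using c by simp
  obtain l where l: "1 \<le> l" "\<And>n. real n * (norm (f n - proj l (f n)))\<^sup>2 \<le> c\<^sup>2 / 2"
    by (rule tail_negligible_uniform[OF tail c2]) (rule that)
  have "c\<^sup>2 / 2 \<le> real n * (norm (proj l (f n)))\<^sup>2" if "1 \<le> n" for n
  proof -
    have "real n * (norm (f n))\<^sup>2 = real n * (norm (proj l (f n)))\<^sup>2 + real n * (norm (f n - proj l (f n)))\<^sup>2"
      using norm_split_proj[of "f n" l] by (simp add: algebra_simps)
    then show ?thesis
      using c(3)[OF that] l(2)[of n] by linarith
  qed
  then show ?thesis
    by (intro consistent_if_head[OF id_eventually c2, of l]) (auto simp: eventually_sequentially)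
qed

text \<open>A component \<open>f\<^sub>2\<close> orthogonal to the rest satisfies \<open>\<langle>f, f\<^sub>2\<rangle> = \<parallel>f\<^sub>2\<parallel>\<^sup>2\<close>; when tails are
  negligible and \<open>f\<^sub>2\<close> is inconsistent, the left-hand side is of smaller order than \<open>1 / n\<close>.\<close>

lemma purely_consistent_iff_tail_negligible:
  assumes f: "order_root_n f"
  shows "purely_consist f \<longleftrightarrow> tail_negligible f"
proof
  assume pure: "purely_consist f"
  show "tail_negligible f"
  proof (rule ccontr)
    assume "\<not> tail_negligible f"
    then obtain \<epsilon> N where N: "0 < \<epsilon>" "subsequence_index N"
      "\<And>i. \<epsilon> < real (N i) * (norm (f (N i) - proj i (f (N i))))\<^sup>2"
      "inconsist N (\<lambda>i. f (N i) - proj i (f (N i)))"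
      by (rule not_tail_negligible_witness[OF f]) (rule that)
    have "sqrt \<epsilon> * real (N i) powr (-1/2) < norm (f (N i) - proj i (f (N i)))" for i
      using root_n_bounds(3)[of "N i" "sqrt \<epsilon>"] N by (simp add: subsequence_index_def)
    moreover have "f (N i) = proj i (f (N i)) + (f (N i) - proj i (f (N i)))" for i
      by simp
    moreover have "(f (N i) - proj i (f (N i))) \<bullet> proj i (f (N i)) = 0" for i
      using proj_inner_diff[of i "f (N i)" "f (N i)"] by (simp add: inner_commute)
    moreover have "0 < sqrt \<epsilon>"
      using N(1) by simp
    ultimately have "\<exists>N f1 f2. subsequence_index N \<and>
          (\<forall>i. f (N i) = f1 i + f2 i \<and> f2 i \<bullet> f1 i = 0) \<and>
          (\<exists>c1>0. \<forall>i. norm (f2 i) > c1 * real (N i) powr (-1/2)) \<and>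
          inconsist N f2"
      using N(2,4)
      by (intro exI[of _ N] exI[of _ "\<lambda>i. proj i (f (N i))"] exI[of _ "\<lambda>i. f (N i) - proj i (f (N i))"]) blast
    then show False
      using pure unfolding purely_consistent_def by blast
  qed
next
  assume tail: "tail_negligible f"
  obtain B where B: "0 < B" "\<And>n. 1 \<le> n \<Longrightarrow> real n * (norm (f n))\<^sup>2 \<le> B"
    "\<forall>\<^sub>F i in sequentially. real (id i) * (norm (f i))\<^sup>2 \<le> B"
    by (rule order_root_n_eventually_bounded[OF f]) (rule that)
  have False if sub: "subsequence_index N" and split: "\<And>i. f (N i) = f1 i + f2 i \<and> f2 i \<bullet> f1 i = 0"
    and c1: "0 < c1" "\<And>i. c1 * real (N i) powr (-1/2) < norm (f2 i)"
    and inc: "inconsist N f2" for N f1 f2 c1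
  proof -
    have N: "1 \<le> N i" for i
      using sub by (simp add: subsequence_index_def)
    have "norm (f2 i) \<le> norm (f (N i))" for i
      using orthogonal_pythagoras[of "f2 i" "f1 i"] split[of i]
      by - (rule power2_le_imp_le, auto simp: add.commute)
    then have "real (N i) * (norm (f2 i))\<^sup>2 \<le> real (N i) * (norm (f (N i)))\<^sup>2" for i
      by (intro mult_left_mono power_mono) auto
    then have "real (N i) * (norm (f2 i))\<^sup>2 \<le> B" for i
      using B(2)[OF N, of i] order_trans by blast
    then have "(\<lambda>i. real (N i) * (f (N i) \<bullet> f2 i)) \<longlonglongrightarrow> 0"
      by (rule tail_negligible_inner_inconsistent[OF tail f sub inc])
    moreover have "c1\<^sup>2 \<le> real (N i) * (f (N i) \<bullet> f2 i)" for i
    proof -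
      have "f (N i) \<bullet> f2 i = (norm (f2 i))\<^sup>2"
        using split[of i] by (simp add: inner_add_left inner_commute[of "f1 i"] power2_norm_eq_inner)
      then show ?thesis
        using root_n_bounds(3)[OF N, of c1 "norm (f2 i)" i] c1 by (simp add: less_imp_le)
    qed
    ultimately have "c1\<^sup>2 \<le> 0"
      by (intro LIMSEQ_le_const) auto
    then show False
      using c1 by simp
  qed
  then have "\<not> (\<exists>N f1 f2. subsequence_index N \<and>
          (\<forall>i. f (N i) = f1 i + f2 i \<and> f2 i \<bullet> f1 i = 0) \<and>
          (\<exists>c1>0. \<forall>i. norm (f2 i) > c1 * real (N i) powr (-1/2)) \<and>
          inconsist N f2)"
    by metis
  then show "purely_consist f"
    unfolding purely_consistent_def using f tail_negligible_imp_consistent[OF f tail] by blast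
qed

lemma purely_consistent_iff_infsum_tail:
  assumes f: "order_root_n f"
  shows "purely_consist f \<longleftrightarrow>
    (\<forall>\<epsilon>>0. \<exists>C1 :: real. \<exists>n0 :: nat. \<forall>n>n0.
       (\<Sum>\<^sub>\<infinity>j\<in>{j. 1 \<le> j \<and> C1 < real j}. (f n \<bullet> \<phi> j)\<^sup>2) \<le> \<epsilon> * (1 / real n))"
  unfolding purely_consistent_iff_tail_negligible[OF f] infsum_tail_coeff
proof
  assume tail: "tail_negligible f"
  show "\<forall>\<epsilon>>0. \<exists>C1 :: real. \<exists>n0 :: nat. \<forall>n>n0. (norm (f n - proj (nat \<lfloor>C1\<rfloor>) (f n)))\<^sup>2 \<le> \<epsilon> * (1 / real n)"
  proof (intro allI impI)
    fix \<epsilon> :: real assume "0 < \<epsilon>"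
    obtain l where l: "1 \<le> l" "\<And>n. real n * (norm (f n - proj l (f n)))\<^sup>2 \<le> \<epsilon>"
      by (rule tail_negligible_uniform[OF tail \<open>0 < \<epsilon>\<close>]) (rule that)
    have "(norm (f n - proj (nat \<lfloor>real l\<rfloor>) (f n)))\<^sup>2 \<le> \<epsilon> * (1 / real n)" if "0 < n" for n
      using l(2)[of n] that by (simp add: field_simps)
    then show "\<exists>C1 :: real. \<exists>n0 :: nat. \<forall>n>n0. (norm (f n - proj (nat \<lfloor>C1\<rfloor>) (f n)))\<^sup>2 \<le> \<epsilon> * (1 / real n)"
      by blast
  qed
next
  assume *: "\<forall>\<epsilon>>0. \<exists>C1 :: real. \<exists>n0 :: nat. \<forall>n>n0. (norm (f n - proj (nat \<lfloor>C1\<rfloor>) (f n)))\<^sup>2 \<le> \<epsilon> * (1 / real n)"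
  show "tail_negligible f"
    unfolding tail_negligible_def
  proof (intro allI impI)
    fix \<epsilon> :: real assume "0 < \<epsilon>"
    then obtain C1 :: real and n0 where "\<And>n. n0 < n \<Longrightarrow> (norm (f n - proj (nat \<lfloor>C1\<rfloor>) (f n)))\<^sup>2 \<le> \<epsilon> * (1 / real n)"
      using * by blast
    then have "real n * (norm (f n - proj (nat \<lfloor>C1\<rfloor>) (f n)))\<^sup>2 \<le> \<epsilon>" if "n0 < n" for n
      using that by (fastforce simp: field_simps)
    then show "\<exists>l. \<forall>\<^sub>F n in sequentially. real n * (norm (f n - proj l (f n)))\<^sup>2 \<le> \<epsilon>"
      by (intro exI[of _ "nat \<lfloor>C1\<rfloor>"]) (auto simp: eventually_sequentially intro!: exI[of _ "Suc n0"])
  qed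
qed

lemma purely_consistent_iff_U_set_approximation:
  assumes f: "order_root_n f"
  shows "purely_consist f \<longleftrightarrow>
    (\<forall>\<epsilon>>0. \<exists>l\<ge>1. \<exists>P0>0. \<exists>f1. \<forall>n\<ge>1. f1 n \<in> U_set \<phi> l P0 \<and>
       norm (f n - f1 n) \<le> \<epsilon> * real n powr (-1/2) \<and>
       (norm (f n))\<^sup>2 = (norm (f1 n))\<^sup>2 + (norm (f n - f1 n))\<^sup>2)" (is "_ \<longleftrightarrow> ?R")
  unfolding purely_consistent_iff_tail_negligible[OF f]
proof
  assume tail: "tail_negligible f"
  obtain B where B: "0 < B" "\<And>n. 1 \<le> n \<Longrightarrow> real n * (norm (f n))\<^sup>2 \<le> B"
    "\<forall>\<^sub>F i in sequentially. real (id i) * (norm (f i))\<^sup>2 \<le> B"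
    by (rule order_root_n_eventually_bounded[OF f]) (rule that)
  show ?R
  proof (intro allI impI)
    fix \<epsilon> :: real assume \<epsilon>: "0 < \<epsilon>"
    then have "0 < \<epsilon>\<^sup>2" by simp
    obtain l where l: "1 \<le> l" "\<And>n. real n * (norm (f n - proj l (f n)))\<^sup>2 \<le> \<epsilon>\<^sup>2"
      by (rule tail_negligible_uniform[OF tail \<open>0 < \<epsilon>\<^sup>2\<close>]) (rule that)
    have "proj l (f n) \<in> U_set \<phi> l (sqrt B)" if n: "1 \<le> n" for n
    proof -
      have "(norm (f n))\<^sup>2 \<le> real n * (norm (f n))\<^sup>2"
        using n by (simp add: mult_le_cancel_right1)
      then have "norm (f n) \<le> sqrt B"
        using B(2)[OF n] by (intro real_le_rsqrt) linarith
      then show ?thesis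
        using norm_proj_le[of l "f n"] by (simp add: U_set_iff proj_proj)
    qed
    moreover have "norm (f n - proj l (f n)) \<le> \<epsilon> * real n powr (-1/2)" if "1 \<le> n" for n
      using root_n_bounds(2)[OF that, of \<epsilon>] l(2) \<epsilon> by simp
    ultimately show "\<exists>l\<ge>1. \<exists>P0>0. \<exists>f1. \<forall>n\<ge>1. f1 n \<in> U_set \<phi> l P0 \<and>
       norm (f n - f1 n) \<le> \<epsilon> * real n powr (-1/2) \<and>
       (norm (f n))\<^sup>2 = (norm (f1 n))\<^sup>2 + (norm (f n - f1 n))\<^sup>2"
      using l(1) B(1) norm_split_proj
      by (intro exI[of _ l] conjI exI[of _ "sqrt B"] exI[of _ "\<lambda>n. proj l (f n)"]) auto
  qed
next
  assume *: ?R
  show "tail_negligible f"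
    unfolding tail_negligible_def
  proof (intro allI impI)
    fix \<epsilon> :: real assume \<epsilon>: "0 < \<epsilon>"
    then have "0 < sqrt \<epsilon>" by simp
    then obtain l P0 f1 where f1: "\<And>n. 1 \<le> n \<Longrightarrow> f1 n \<in> U_set \<phi> l P0"
      "\<And>n. 1 \<le> n \<Longrightarrow> norm (f n - f1 n) \<le> sqrt \<epsilon> * real n powr (-1/2)"
      using * by metis
    have "real n * (norm (f n - proj l (f n)))\<^sup>2 \<le> \<epsilon>" if n: "1 \<le> n" for n
    proof -
      have "norm (f n - proj l (f n)) \<le> norm (f n - f1 n)"
        using f1(1)[OF n] by (intro proj_best_approximation) (simp add: U_set_iff)
      then have "norm (f n - proj l (f n)) \<le> sqrt \<epsilon> * real n powr (-1/2)"
        using f1(2)[OF n] by linarith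
      then show ?thesis
        using root_n_bounds(2)[OF n, of "sqrt \<epsilon>"] \<epsilon> by simp
    qed
    then show "\<exists>l. \<forall>\<^sub>F n in sequentially. real n * (norm (f n - proj l (f n)))\<^sup>2 \<le> \<epsilon>"
      by (auto simp: eventually_sequentially)
  qed
qed

text \<open>By polarization the remainder is twice the inner product.  When tails are not negligible, the
  tails themselves violate the condition, as \<open>\<langle>f, f - P f\<rangle> = \<parallel>f - P f\<parallel>\<^sup>2\<close>.\<close>

lemma purely_consistent_iff_asymptotically_orthogonal:
  assumes f: "order_root_n f"
  shows "purely_consist f \<longleftrightarrow>
    (\<forall>N f1. subsequence_index N \<and> order_root_n_along N f1 \<and> inconsist N f1 \<longrightarrow>
       (\<lambda>i. (norm (f (N i) + f1 i))\<^sup>2 - (norm (f (N i)))\<^sup>2 - (norm (f1 i))\<^sup>2) \<in> o(\<lambda>i. 1 / real (N i)))" (is "_ \<longleftrightarrow> ?R")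
proof -
  have polar: "(norm (g + h))\<^sup>2 - (norm g)\<^sup>2 - (norm h)\<^sup>2 = 2 * (g \<bullet> h)" for g h :: L2
    by (simp add: power2_norm_eq_inner inner_add_left inner_add_right inner_commute)
  have iff: "(\<lambda>i. (norm (f (N i) + f1 i))\<^sup>2 - (norm (f (N i)))\<^sup>2 - (norm (f1 i))\<^sup>2) \<in> o(\<lambda>i. 1 / real (N i)) \<longleftrightarrow>
     (\<lambda>i. real (N i) * (f (N i) \<bullet> f1 i)) \<longlonglongrightarrow> 0" if "subsequence_index N" for N f1
  proof -
    have "(\<lambda>i. 2 * (real (N i) * (f (N i) \<bullet> f1 i))) \<longlonglongrightarrow> 0 \<longleftrightarrow> (\<lambda>i. real (N i) * (f (N i) \<bullet> f1 i)) \<longlonglongrightarrow> 0"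
      using tendsto_mult_left_iff[of "2::real" "\<lambda>i. real (N i) * (f (N i) \<bullet> f1 i)" 0] by simp
    then show ?thesis
      unfolding polar using smallo_inverse_iff[OF subsequence_index_eventually_ge_1[OF that]]
      by (simp add: mult.left_commute)
  qed
  show ?thesis
    unfolding purely_consistent_iff_tail_negligible[OF f]
  proof (intro iffI allI impI)
    fix N f1
    assume tail: "tail_negligible f"
      and *: "subsequence_index N \<and> order_root_n_along N f1 \<and> inconsist N f1"
    obtain c C where C: "0 < c" "c < C" "\<And>i. norm (f1 i) < C * real (N i) powr (-1/2)"
      using * unfolding order_root_n_along_def by blast
    have "real (N i) * (norm (f1 i))\<^sup>2 \<le> C\<^sup>2" for i
      using root_n_bounds(2)[of "N i" C "norm (f1 i)"] C * by (simp add: subsequence_index_def less_imp_le)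
    then show "(\<lambda>i. (norm (f (N i) + f1 i))\<^sup>2 - (norm (f (N i)))\<^sup>2 - (norm (f1 i))\<^sup>2) \<in> o(\<lambda>i. 1 / real (N i))"
      using tail_negligible_inner_inconsistent[OF tail f] * iff by blast
  next
    assume *: ?R
    show "tail_negligible f"
    proof (rule ccontr)
      assume "\<not> tail_negligible f"
      then obtain \<epsilon> N where N: "0 < \<epsilon>" "subsequence_index N"
        "\<And>i. \<epsilon> < real (N i) * (norm (f (N i) - proj i (f (N i))))\<^sup>2"
        "inconsist N (\<lambda>i. f (N i) - proj i (f (N i)))"
        by (rule not_tail_negligible_witness[OF f]) (rule that)
      define g where "g i = f (N i) - proj i (f (N i))" for i
      obtain c C where C: "0 < c" "c < C" "\<And>n. 1 \<le> n \<Longrightarrow> c\<^sup>2 \<le> real n * (norm (f n))\<^sup>2"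
        and CB: "\<And>n. 1 \<le> n \<Longrightarrow> real n * (norm (f n))\<^sup>2 \<le> C\<^sup>2"
        by (rule order_root_nD[OF f]) (rule that)
      have N1: "1 \<le> N i" for i
        using N(2) by (simp add: subsequence_index_def)
      have lower: "sqrt \<epsilon> * real (N i) powr (-1/2) < norm (g i)" for i
        using root_n_bounds(3)[OF N1, of "sqrt \<epsilon>"] N by (simp add: g_def)
      have upper: "norm (g i) < (sqrt \<epsilon> + C) * real (N i) powr (-1/2)" for i
      proof -
        have "norm (g i) \<le> norm (f (N i))"
          unfolding g_def by (rule norm_diff_proj_le)
        also have "\<dots> \<le> C * real (N i) powr (-1/2)"
          using root_n_bounds(2)[OF N1, of C "norm (f (N i))" i] CB[OF N1, of i] C by simp
        also have "\<dots> < (sqrt \<epsilon> + C) * real (N i) powr (-1/2)"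
          using N(1) N1[of i] by (intro mult_strict_right_mono) auto
        finally show ?thesis .
      qed
      have "order_root_n_along N g"
        unfolding order_root_n_along_def
        by (intro exI[of _ "sqrt \<epsilon>"] exI[of _ "sqrt \<epsilon> + C"]) (use lower upper N(1) C in auto)
      then have "(\<lambda>i. real (N i) * (f (N i) \<bullet> g i)) \<longlonglongrightarrow> 0"
        using *[rule_format, of N g] N(2,4) iff[OF N(2), of g] by (simp add: g_def[abs_def])
      moreover have "\<epsilon> \<le> real (N i) * (f (N i) \<bullet> g i)" for i
      proof -
        have "f (N i) \<bullet> g i = g i \<bullet> g i"
          using proj_inner_diff[of i "f (N i)" "f (N i)"] by (simp add: g_def inner_diff_left)
        then show ?thesis
          using N(3)[of i] by (simp add: g_def power2_norm_eq_inner less_imp_le)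
      qed
      ultimately have "\<epsilon> \<le> 0"
        by (intro LIMSEQ_le_const) auto
      then show False
        using N(1) by simp
    qed
  qed
qed

end

section \<open>The theorem\<close>

theorem theorem8p2:
  fixes M :: "'w measure" and \<xi> :: "nat \<Rightarrow> 'w \<Rightarrow> real"
    and \<phi> :: "nat \<Rightarrow> L2" and \<sigma> \<kappa> :: "nat \<Rightarrow> real"
  assumes "orthonormal_basis \<phi>"
    and "standard_gaussian_noise M \<xi>"
    and "D1 \<kappa>"
    and "D2 \<sigma>"
  shows
    \<comment> \<open>(a)\<close>
    "(\<forall>f. order_root_n f \<longrightarrow>
        (consistent M \<xi> \<phi> \<sigma> \<kappa> id f \<longleftrightarrow>
          (\<exists>c1 c2 :: real. \<exists>n0 :: nat. c1 > 0 \<and> c2 > 0 \<and>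
             (\<forall>n>n0. (\<Sum>j | 1 \<le> j \<and> real j < c2. (f n \<bullet> \<phi> j)\<^sup>2) > c1 * (1 / real n)))))
   \<and> \<comment> \<open>(b)\<close>
     (\<forall>f. order_root_n f \<longrightarrow>
        (inconsistent M \<xi> \<phi> \<sigma> \<kappa> id f \<longleftrightarrow>
          (\<forall>c2 :: real. c2 > 0 \<longrightarrow>
             (\<lambda>n. \<Sum>j | 1 \<le> j \<and> real j < c2. (f n \<bullet> \<phi> j)\<^sup>2) \<in> o(\<lambda>n. 1 / real n))))
   \<and> \<comment> \<open>(c)\<close>
     (\<forall>l\<ge>1. \<forall>P0>0. \<forall>\<gamma>>0. \<forall>N f.
        subsequence_index N \<and> order_root_n_along N f \<and>
        (\<forall>i. f i \<in> (\<lambda>u. \<gamma> *\<^sub>R u) ` U_set \<phi> l P0) \<longrightarrow>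
        consistent M \<xi> \<phi> \<sigma> \<kappa> N f)
   \<and> (\<forall>f V. f \<notin> Xi_space \<phi> \<and> convex V \<and> ortho_symmetric \<phi> V \<and> f \<in> V \<longrightarrow>
        (\<exists>N g. subsequence_index N \<and> order_root_n_along N g \<and> (\<forall>i. g i \<in> V) \<and>
               inconsistent M \<xi> \<phi> \<sigma> \<kappa> N g))
   \<and> \<comment> \<open>(d)\<close>
     (\<forall>f. order_root_n f \<longrightarrow>
        (consistent M \<xi> \<phi> \<sigma> \<kappa> id f \<longleftrightarrow>
          (\<exists>l\<ge>1. \<exists>P0>0. \<exists>c1 C1 f1. 0 < c1 \<and> c1 < C1 \<and>
             (\<forall>n\<ge>1. f1 n \<in> U_set \<phi> l P0 \<and>
                c1 * real n powr (-1/2) \<le> norm (f1 n) \<and> norm (f1 n) \<le> C1 * real n powr (-1/2) \<and>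
                (norm (f n))\<^sup>2 = (norm (f1 n))\<^sup>2 + (norm (f n - f1 n))\<^sup>2))))
   \<and> (\<forall>l\<ge>1. \<forall>P0>0. \<forall>c1 C1 f1 f2.
        0 < c1 \<and> c1 < C1 \<and>
        (\<forall>n\<ge>1. f1 n \<in> U_set \<phi> l P0 \<and> f2 n \<bullet> f1 n = 0 \<and>
           c1 * real n powr (-1/2) \<le> norm (f1 n) \<and> norm (f1 n) \<le> C1 * real n powr (-1/2) \<and>
           c1 * real n powr (-1/2) \<le> norm (f2 n) \<and> norm (f2 n) \<le> C1 * real n powr (-1/2)) \<longrightarrow>
        consistent M \<xi> \<phi> \<sigma> \<kappa> id (\<lambda>n. f1 n + f2 n))
   \<and> \<comment> \<open>(e)\<close>
     (\<forall>f. order_root_n f \<and> consistent M \<xi> \<phi> \<sigma> \<kappa> id f \<longrightarrow>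
        (\<forall>\<epsilon>>0. \<exists>l\<ge>1. \<exists>P0>0. \<exists>c1 C1 f1. 0 < c1 \<and> c1 < C1 \<and>
           (\<forall>n\<ge>1. f1 n \<in> U_set \<phi> l P0 \<and>
              c1 * real n powr (-1/2) \<le> norm (f1 n) \<and> norm (f1 n) \<le> C1 * real n powr (-1/2) \<and>
              f1 n \<bullet> (f n - f1 n) = 0) \<and>
           (\<forall>\<alpha>\<in>{0<..<1}. \<forall>K. tests_of_level M \<xi> \<phi> \<sigma> \<kappa> id \<alpha> K \<longrightarrow>
              (\<exists>n\<^sub>\<epsilon>. \<forall>n>n\<^sub>\<epsilon>.
                 \<bar>type_II_error M \<xi> \<phi> \<sigma> n (K n) (f n) - type_II_error M \<xi> \<phi> \<sigma> n (K n) (f1 n)\<bar> \<le> \<epsilon> \<and>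
                 type_II_error M \<xi> \<phi> \<sigma> n (K n) (f n - f1 n) \<ge> 1 - \<alpha> - \<epsilon>))))
   \<and> \<comment> \<open>(f)\<close>
     (\<forall>f f1. consistent M \<xi> \<phi> \<sigma> \<kappa> id f \<and> inconsistent M \<xi> \<phi> \<sigma> \<kappa> id f1 \<longrightarrow>
        (\<forall>\<alpha>\<in>{0<..<1}. \<forall>K. tests_of_level M \<xi> \<phi> \<sigma> \<kappa> id \<alpha> K \<longrightarrow>
           (\<lambda>n. type_II_error M \<xi> \<phi> \<sigma> n (K n) (f n)
              - type_II_error M \<xi> \<phi> \<sigma> n (K n) (f n + f1 n)) \<longlonglongrightarrow> 0))
   \<and> \<comment> \<open>(g)\<close>
     (\<forall>f. order_root_n f \<longrightarrow>
        (purely_consistent M \<xi> \<phi> \<sigma> \<kappa> f \<longleftrightarrow>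
          (\<forall>\<epsilon>>0. \<exists>C1 :: real. \<exists>n0 :: nat. \<forall>n>n0.
             (\<Sum>\<^sub>\<infinity>j\<in>{j. 1 \<le> j \<and> C1 < real j}. (f n \<bullet> \<phi> j)\<^sup>2) \<le> \<epsilon> * (1 / real n))))
   \<and> \<comment> \<open>(h)\<close>
     (\<forall>f. order_root_n f \<longrightarrow>
        (purely_consistent M \<xi> \<phi> \<sigma> \<kappa> f \<longleftrightarrow>
          (\<forall>\<epsilon>>0. \<exists>l\<ge>1. \<exists>P0>0. \<exists>f1. \<forall>n\<ge>1. f1 n \<in> U_set \<phi> l P0 \<and>
             norm (f n - f1 n) \<le> \<epsilon> * real n powr (-1/2) \<and>
             (norm (f n))\<^sup>2 = (norm (f1 n))\<^sup>2 + (norm (f n - f1 n))\<^sup>2)))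
   \<and> \<comment> \<open>(i)\<close>
     (\<forall>f. order_root_n f \<longrightarrow>
        (purely_consistent M \<xi> \<phi> \<sigma> \<kappa> f \<longleftrightarrow>
          (\<forall>N f1. subsequence_index N \<and> order_root_n_along N f1 \<and>
             inconsistent M \<xi> \<phi> \<sigma> \<kappa> N f1 \<longrightarrow>
             (\<lambda>i. (norm (f (N i) + f1 i))\<^sup>2 - (norm (f (N i)))\<^sup>2 - (norm (f1 i))\<^sup>2)
               \<in> o(\<lambda>i. 1 / real (N i)))))"
proof -
  interpret sequence_model \<phi> M \<xi> \<sigma> \<kappa>
    using assms by unfold_locales
  show ?thesis
    apply (intro conjI)
    subgoal by (intro allI impI consistent_iff_sum_head)
    subgoal by (intro allI impI inconsistent_iff_sum_head)
    subgoal by (intro allI impI, elim conjE, rule U_set_sequences_consistent) auto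
    subgoal by (intro allI impI, elim conjE, rule maximality_of_Xi)
    subgoal by (intro allI impI consistent_iff_U_set_component)
    subgoal by (intro allI impI, rule consistent_add_orthogonal)
    subgoal by (intro allI impI, elim conjE, rule type_II_error_determined_by_U_set_component)
    subgoal by (intro allI impI ballI, elim conjE, rule type_II_error_add_inconsistent)
    subgoal by (intro allI impI purely_consistent_iff_infsum_tail)
    subgoal by (intro allI impI purely_consistent_iff_U_set_approximation)
    subgoal by (intro allI impI purely_consistent_iff_asymptotically_orthogonal)
    done
qed

end
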